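(* Let $\mathcal{L}>0$ and let $\Phi:\mathbb{R}_+\to\mathbb{R}_+$ satisfy all of the following conditions. (1) $\Phi$ is monotonically increasing. (2) $\int_x^\infty \frac{dt}{\Phi(t)}<\infty$ for every $x>0$. (3) For every closed curve $f$ (as in the context) with $\mathcal{E}_\Phi(f)<\infty$, one has $f\in W_\Phi\cap W^{1,\infty}(\mathbb{R}/\mathcal{L}\mathbb{Z})$ and $f$ is bi-Lipschitz. (4) For every bi-Lipschitz $f\in W_\Phi\cap W^{1,\infty}(\mathbb{R}/\mathcal{L}\mathbb{Z})$ with $\|f'\|_{\mathbb{R}^n}=1$ a.e., $$\lim_{\epsilon\to+0}\epsilon\int_{\mathbb{R}/\mathcal{L}\mathbb{Z}}\bigl(\Lambda(\|f(s_1)-f(s_1+\epsilon)\|_{\mathbb{R}^n})-\Lambda(\epsilon)\bigr)\,ds_1=0$$ and $$\lim_{\epsilon\to+0}\int_{\mathbb{R}/\mathcal{L}\mathbb{Z}}\Lambda(\|f(s_1)-f(s_1+\epsilon)\|_{\mathbb{R}^n})\int_{s_1}^{s_1+\epsilon}\|f'(s_1)-f'(s_2)\|_{\mathbb{R}^n}^2\,ds_2\,ds_1=0.$$ (5) (a) For every $\lambda\in(0,1)$ there is a constant $C(\lambda,\mathcal{L})>0$ such that $\Phi(\lambda x)\geq C(\lambda,\mathcal{L})\Phi(x)$ for every $x\in(0,\frac{\mathcal{L}}{2}]$; (b) $\inf_{x\in(0,\mathcal{L}/2]}\left(\frac{1}{\Phi(x)}+\Lambda(x)\right)\geq 0$.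 Set $$\mathcal{E}_{\Phi,1}(f)=\iint_{(\mathbb{R}/\mathcal{L}\mathbb{Z})^2}\frac{\|\Delta\tau\|_{\mathbb{R}^n}^2}{2\Phi(\|\Delta f\|_{\mathbb{R}^n})}\,ds_1ds_2,$$ $$\mathcal{E}_{\Phi,2}(f)=\iint_{(\mathbb{R}/\mathcal{L}\mathbb{Z})^2}\left(\frac{1}{\Phi(\|\Delta f\|_{\mathbb{R}^n})}-\Lambda(\|\Delta f\|_{\mathbb{R}^n})\right)\left\langle\tau(s_1)\wedge\frac{\Delta f}{\|\Delta f\|_{\mathbb{R}^n}},\ \tau(s_2)\wedge\frac{\Delta f}{\|\Delta f\|_{\mathbb{R}^n}}\right\rangle_{\bigwedge^2\mathbb{R}^n}ds_1ds_2.$$ If $f$ is a closed curve (as in the context) with $\mathcal{E}_\Phi(f)<\infty$, then the integrals $\mathcal{E}_{\Phi,1}(f)$ and $\mathcal{E}_{\Phi,2}(f)$ are absolutely convergent, and $$\mathcal{E}_\Phi(f)=\mathcal{E}_{\Phi,1}(f)+\mathcal{E}_{\Phi,2}(f)+2\mathcal{L}\int_{\mathcal{L}/2}^\infty\frac{dx}{\Phi(x)}.$$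
   Context: $\mathbb{R}_+=\{x\in\mathbb{R}: x>0\}$. A closed curve $f:\mathbb{R}/\mathcal{L}\mathbb{Z}\to\mathbb{R}^n$ here means a closed curve without self-intersections, of total length $\mathcal{L}$, parametrized by arc-length; $\tau=f'$ is its unit tangent vector (defined a.e.). For a function $u$ on $\mathbb{R}/\mathcal{L}\mathbb{Z}$, $\Delta u=u(s_1)-u(s_2)$. $\mathscr{D}(f(s_1),f(s_2))=\mathrm{dist}_{\mathbb{R}/\mathcal{L}\mathbb{Z}}(s_1,s_2)$ is the distance along the curve. The energy is $$\mathcal{E}_\Phi(f)=\iint_{(\mathbb{R}/\mathcal{L}\mathbb{Z})^2}\left(\frac{1}{\Phi(\|f(s_1)-f(s_2)\|_{\mathbb{R}^n})}-\frac{1}{\Phi(\mathscr{D}(f(s_1),f(s_2)))}\right)ds_1ds_2.$$ The function space $W_\Phi$ is $$W_\Phi=\left\{u\in W^{1,2}(\mathbb{R}/\mathcal{L}\mathbb{Z};\mathbb{R}^n)\ :\ \iint_{(\mathbb{R}/\mathcal{L}\mathbb{Z})^2}\frac{\|\Delta u'\|_{\mathbb{R}^n}^2}{\Phi(\mathrm{dist}_{\mathbb{R}/\mathcal{L}\mathbb{Z}}(s_1,s_2))}\,ds_1ds_2<\infty\right\}.$$ $\Lambda(x)=-\frac1x\int_x^\infty\frac{dt}{\Phi(t)}$ for $x>0$. Bi-Lipschitz means there are constants $c,C>0$ with $c\,\mathrm{dist}_{\mathbb{R}/\mathcal{L}\mathbb{Z}}(s_1,s_2)\le\|f(s_1)-f(s_2)\|_{\mathbb{R}^n}\le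 C\,\mathrm{dist}_{\mathbb{R}/\mathcal{L}\mathbb{Z}}(s_1,s_2)$ for all $s_1,s_2$. The inner product on 2-vectors is $\langle a\wedge b,c\wedge d\rangle_{\bigwedge^2\mathbb{R}^n}=(a\cdot c)(b\cdot d)-(a\cdot d)(b\cdot c)$. *)

theory Defs
  imports "HOL-Analysis.Analysis" "HOL-Library.Periodic_Fun"
begin

text \<open>
  A function on the circle \<open>\<real>/L\<int>\<close> is represented by its \<open>L\<close>-periodic lift to \<open>\<real>\<close>, and an
  integral over the circle is a Lebesgue integral over the fundamental domain \<open>{0..L}\<close>.
  The functions \<open>\<Phi>\<close> and \<open>\<Lambda>\<close> are only meaningful on \<open>{0<..}\<close>; the double integrals below evaluate
  them elsewhere only where the two points coincide, which is a null set.
\<close>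

definition circle_dist :: "real \<Rightarrow> real \<Rightarrow> real \<Rightarrow> real" where
  "circle_dist L s t = infdist s (range (\<lambda>k::int. t + of_int k * L))"


section \<open>Closed curves\<close>

definition curve_length :: "(real \<Rightarrow> 'a::metric_space) \<Rightarrow> real \<Rightarrow> real \<Rightarrow> ennreal" where
  "curve_length f a b =
     (SUP p\<in>{p. sorted p \<and> set p \<subseteq> {a..b}}.
        \<Sum>i<length p - 1. ennreal (dist (f (p ! i)) (f (p ! Suc i))))"

text \<open>
  The last condition is the parametrization by arc-length; with \<open>a = 0\<close> and \<open>b = L\<close> it also says
  that the total length is \<open>L\<close>.
\<close>

definition closed_curve :: "real \<Rightarrow> (real \<Rightarrow> 'a::metric_space) \<Rightarrow> bool" where
  "closed_curve L f \<longleftrightarrow>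
     periodic_fun_simple f L \<and> inj_on f {0..<L} \<and>
     (\<forall>a b. a \<le> b \<longrightarrow> curve_length f a b = ennreal (b - a))"

definition bilipschitz_circle :: "real \<Rightarrow> (real \<Rightarrow> 'a::metric_space) \<Rightarrow> bool" where
  "bilipschitz_circle L f \<longleftrightarrow>
     periodic_fun_simple f L \<and>
     (\<exists>c>0. \<exists>C>0. \<forall>s t. c * circle_dist L s t \<le> dist (f s) (f t) \<and>
                     dist (f s) (f t) \<le> C * circle_dist L s t)"


section \<open>Sobolev spaces on the circle\<close>

definition smooth_circle :: "real \<Rightarrow> (real \<Rightarrow> real) \<Rightarrow> bool" where
  "smooth_circle L \<phi> \<longleftrightarrow>
     periodic_fun_simple \<phi> L \<and> (\<forall>k x. ((deriv ^^ k) \<phi>) differentiable (at x))"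

definition has_weak_deriv ::
    "real \<Rightarrow> (real \<Rightarrow> 'a::euclidean_space) \<Rightarrow> (real \<Rightarrow> 'a) \<Rightarrow> bool" where
  "has_weak_deriv L u v \<longleftrightarrow>
     periodic_fun_simple u L \<and> periodic_fun_simple v L \<and>
     u absolutely_integrable_on {0..L} \<and> v absolutely_integrable_on {0..L} \<and>
     (\<forall>\<phi>. smooth_circle L \<phi> \<longrightarrow>
        (LINT s:{0..L}|lebesgue. deriv \<phi> s *\<^sub>R u s) = - (LINT s:{0..L}|lebesgue. \<phi> s *\<^sub>R v s))"

definition L2_circle :: "real \<Rightarrow> (real \<Rightarrow> 'a::euclidean_space) set" where
  "L2_circle L = {u. periodic_fun_simple u L \<and> set_borel_measurable lebesgue {0..L} u \<and>
                     (\<lambda>s. (norm (u s))\<^sup>2) absolutely_integrable_on {0..L}}"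

definition Linf_circle :: "real \<Rightarrow> (real \<Rightarrow> 'a::euclidean_space) set" where
  "Linf_circle L = {u. periodic_fun_simple u L \<and> set_borel_measurable lebesgue {0..L} u \<and>
                       (\<exists>M. AE s in lebesgue. norm (u s) \<le> M)}"

definition W12 :: "real \<Rightarrow> (real \<Rightarrow> 'a::euclidean_space) set" where
  "W12 L = {u \<in> L2_circle L. \<exists>v\<in>L2_circle L. has_weak_deriv L u v}"

definition W1inf :: "real \<Rightarrow> (real \<Rightarrow> 'a::euclidean_space) set" where
  "W1inf L = {u \<in> Linf_circle L. \<exists>v\<in>Linf_circle L. has_weak_deriv L u v}"

definition W_Phi :: "real \<Rightarrow> (real \<Rightarrow> real) \<Rightarrow> (real \<Rightarrow> 'a::euclidean_space) set" where
  "W_Phi L \<Phi> = {u \<in> W12 L. \<exists>v. has_weak_deriv L u v \<and>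
     (\<lambda>(s, t). (norm (v s - v t))\<^sup>2 / \<Phi> (circle_dist L s t))
        absolutely_integrable_on ({0..L} \<times> {0..L})}"


section \<open>The energies\<close>

definition Lam :: "(real \<Rightarrow> real) \<Rightarrow> real \<Rightarrow> real" where
  "Lam \<Phi> x = - (1 / x) * (LINT t:{x..}|lebesgue. 1 / \<Phi> t)"

definition energy_density ::
    "real \<Rightarrow> (real \<Rightarrow> real) \<Rightarrow> (real \<Rightarrow> 'a::euclidean_space) \<Rightarrow> real \<times> real \<Rightarrow> real" where
  "energy_density L \<Phi> f = (\<lambda>(s, t). 1 / \<Phi> (norm (f s - f t)) - 1 / \<Phi> (circle_dist L s t))"

text \<open>
  For a closed curve and increasing \<open>\<Phi>\<close> the density is nonnegative and measurable, so finiteness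
  of the energy is integrability of the density.
\<close>

definition finite_energy ::
    "real \<Rightarrow> (real \<Rightarrow> real) \<Rightarrow> (real \<Rightarrow> 'a::euclidean_space) \<Rightarrow> bool" where
  "finite_energy L \<Phi> f \<longleftrightarrow> energy_density L \<Phi> f absolutely_integrable_on ({0..L} \<times> {0..L})"

definition energy ::
    "real \<Rightarrow> (real \<Rightarrow> real) \<Rightarrow> (real \<Rightarrow> 'a::euclidean_space) \<Rightarrow> real" where
  "energy L \<Phi> f = (LINT p:({0..L} \<times> {0..L})|lebesgue. energy_density L \<Phi> f p)"

text \<open>
  Unit tangent vector: the classical derivative. An arc-length parametrized curve is Lipschitz, so
  the derivative exists almost everywhere (and agrees there with the weak one); the arbitrary value
  of \<^const>\<open>vector_derivative\<close> on the remaining null set does not affect the integrals.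
\<close>

definition tangent :: "(real \<Rightarrow> 'a::euclidean_space) \<Rightarrow> real \<Rightarrow> 'a" where
  "tangent f s = vector_derivative f (at s)"

definition wedge_inner :: "'a::real_inner \<Rightarrow> 'a \<Rightarrow> 'a \<Rightarrow> 'a \<Rightarrow> real" where
  "wedge_inner a b c d = (a \<bullet> c) * (b \<bullet> d) - (a \<bullet> d) * (b \<bullet> c)"

definition energy1_density ::
    "(real \<Rightarrow> real) \<Rightarrow> (real \<Rightarrow> 'a::euclidean_space) \<Rightarrow> real \<times> real \<Rightarrow> real" where
  "energy1_density \<Phi> f =
     (\<lambda>(s, t). (norm (tangent f s - tangent f t))\<^sup>2 / (2 * \<Phi> (norm (f s - f t))))"

definition energy2_density ::
    "(real \<Rightarrow> real) \<Rightarrow> (real \<Rightarrow> 'a::euclidean_space) \<Rightarrow> real \<times> real \<Rightarrow> real" where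
  "energy2_density \<Phi> f =
     (\<lambda>(s, t). (1 / \<Phi> (norm (f s - f t)) - Lam \<Phi> (norm (f s - f t))) *
        wedge_inner (tangent f s) ((f s - f t) /\<^sub>R norm (f s - f t))
                    (tangent f t) ((f s - f t) /\<^sub>R norm (f s - f t)))"

definition energy1 ::
    "real \<Rightarrow> (real \<Rightarrow> real) \<Rightarrow> (real \<Rightarrow> 'a::euclidean_space) \<Rightarrow> real" where
  "energy1 L \<Phi> f = (LINT p:({0..L} \<times> {0..L})|lebesgue. energy1_density \<Phi> f p)"

definition energy2 ::
    "real \<Rightarrow> (real \<Rightarrow> real) \<Rightarrow> (real \<Rightarrow> 'a::euclidean_space) \<Rightarrow> real" where
  "energy2 L \<Phi> f = (LINT p:({0..L} \<times> {0..L})|lebesgue. energy2_density \<Phi> f p)"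

end

theory Submission
  imports Defs
begin

text \<open>
  Write \<open>\<tau> = f'\<close>, \<open>r = |f(s) - f(t)|\<close>, \<open>R = (f(s) - f(t)) / r\<close>, \<open>D\<close> for the distance along the curve,
  \<open>b = 1 / \<Phi>\<close> and \<open>F(x) = \<integral>\<^sub>x\<^sup>\<infinity> b\<close>, so that \<open>\<Lambda>(x) = - F(x) / x\<close>.

  The cosine formula is integration by parts in disguise. If \<open>G'(x) = x \<Lambda>(x)\<close>, then \<open>G'' = b\<close> and
  the chain rule gives \<open>\<partial>\<^sub>s \<partial>\<^sub>t G(r) = - \<Lambda>(r) \<tau>(s) \<bullet> \<tau>(t) - (b(r) - \<Lambda>(r)) (\<tau>(s) \<bullet> R) (\<tau>(t) \<bullet> R)\<close>. Because
  \<open>|\<Delta>\<tau>|\<^sup>2 / 2 = 1 - \<tau>(s) \<bullet> \<tau>(t)\<close>, the densities of \<open>\<E>\<^sub>1\<close> and \<open>\<E>\<^sub>2\<close> add up to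
  \<open>b(r) + \<partial>\<^sub>s \<partial>\<^sub>t G(r)\<close>, and after subtracting the energy density \<open>b(r) - b(D)\<close> there remains
  \<open>b(D) + \<partial>\<^sub>s \<partial>\<^sub>t G(r)\<close> (\<open>density_sum\<close>). Over \<open>{D > \<epsilon>}\<close> the first term integrates to
  \<open>2 L (F(\<epsilon>) - F(L/2))\<close>, and the second one to boundary terms at \<open>D = \<epsilon>\<close> (\<open>truncated_integral\<close>).
  These are \<open>2 \<integral> \<Lambda>(|f(s) - f(s + \<epsilon>)|) (f(s + \<epsilon>) - f(s)) \<bullet> \<tau>(s) ds\<close>, and
  \<open>(f(s + \<epsilon>) - f(s)) \<bullet> \<tau>(s) = \<epsilon> - (1/2) \<integral>\<^sub>s\<^sup>s\<^sup>+\<^sup>\<epsilon> |\<tau>(s) - \<tau>(t)|\<^sup>2 dt\<close>. The divergent part \<open>2 L F(\<epsilon>)\<close> cancels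
  against \<open>2 \<epsilon> L \<Lambda>(\<epsilon>)\<close>, and what is left is precisely what the two limit hypotheses send to zero
  (\<open>boundary_flux\<close>). So \<open>\<E>\<^sub>1 + \<E>\<^sub>2 - \<E> = - 2 L F(L/2)\<close>.

  Removing the truncation needs absolute convergence. For \<open>\<E>\<^sub>1\<close> it is the definition of \<open>W\<^sub>\<Phi>\<close> together
  with the comparison of \<open>\<Phi>(r)\<close> with \<open>\<Phi>(D)\<close>. For \<open>\<E>\<^sub>2\<close> the inner product of 2-vectors is at most the
  mean of \<open>|P \<tau>(s)|\<^sup>2\<close> and \<open>|P \<tau>(t)|\<^sup>2\<close>, where \<open>P\<close> is the projection orthogonal to the chord. The chord
  is the mean of \<open>\<tau>\<close> over the arc, so \<open>|P \<tau>(s)|\<^sup>2\<close> is at most the mean of \<open>|\<tau>(s) - \<tau>|\<^sup>2\<close> over the arc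
  (\<open>P_le_mean_q\<close>), and an inequality of Hardy type, whose constant is controlled by
  \<open>1/\<Phi> + \<Lambda> \<ge> 0\<close>, bounds the integral by the \<open>W\<^sub>\<Phi>\<close> seminorm.

  Two points of regularity need care. The tangent is the classical derivative while the hypotheses
  speak of weak ones; \<open>weak_deriv_is_classical\<close>, \<open>weak_deriv_unique\<close> and
  \<open>ex_borel_unit_tangent\<close> identify them almost everywhere with one Borel unit field. And \<open>\<Phi>\<close> may
  jump, so \<open>F\<close> is only Lipschitz; \<open>F_chain_rule_AE\<close> is the chain rule that survives.

  All double integrals are computed in the coordinates \<open>t = s + h\<close>, \<open>|h| \<le> L/2\<close>, where \<open>D = |h|\<close>.
\<close>

section \<open>Lipschitz functions and differentiation almost everywhere\<close>

text \<open>
  A countable base assigns to different isolated points different basic neighbourhoods.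
\<close>

lemma countable_if_all_points_isolated:
  fixes X :: "'a::second_countable_topology set"
  assumes "\<And>x. x \<in> X \<Longrightarrow> \<exists>U. open U \<and> x \<in> U \<and> U \<inter> X = {x}"
  shows "countable X"
proof -
  obtain B :: "'a set set" where B: "countable B" "topological_basis B"
    using ex_countable_basis by blast
  have "\<exists>V\<in>B. V \<inter> X = {x}" if x: "x \<in> X" for x
  proof -
    obtain U where U: "open U" "x \<in> U" "U \<inter> X = {x}" using assms[OF x] by blast
    obtain V where "V \<in> B" "x \<in> V" "V \<subseteq> U" using topological_basisE[OF B(2) U(1,2)] by blast
    then show ?thesis using U x by blast
  qed
  then obtain V where V: "\<And>x. x \<in> X \<Longrightarrow> V x \<in> B \<and> V x \<inter> X = {x}" by metis
  have "inj_on V X" by (rule inj_onI) (metis V singleton_inject)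
  moreover have "V ` X \<subseteq> B" using V by blast
  ultimately show ?thesis using B(1) by (meson countable_image_inj_on countable_subset)
qed

lemma has_vector_derivative_iff_quotient:
  fixes g :: "real \<Rightarrow> 'b::real_normed_vector"
  shows "(g has_vector_derivative D) (at x within S) \<longleftrightarrow>
    ((\<lambda>y. (g y - g x) /\<^sub>R (y - x)) \<longlongrightarrow> D) (at x within S)"
proof -
  have eq: "\<forall>\<^sub>F y in at x within S. norm ((g y - g x - (y - x) *\<^sub>R D) /\<^sub>R norm (y - x))
      = norm ((g y - g x) /\<^sub>R (y - x) - D)"
  proof -
    have "norm ((g y - g x - (y - x) *\<^sub>R D) /\<^sub>R norm (y - x))
      = norm ((g y - g x) /\<^sub>R (y - x) - D)" if "y \<noteq> x" for y
    proof -
      have "(g y - g x) /\<^sub>R (y - x) - D = (g y - g x - (y - x) *\<^sub>R D) /\<^sub>R (y - x)"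
        using that by (simp add: scaleR_diff_right scaleR_add_right diff_diff_add)
      then show ?thesis by (simp add: divide_inverse)
    qed
    then show ?thesis by (auto simp: eventually_at_filter)
  qed
  have "(g has_vector_derivative D) (at x within S) \<longleftrightarrow>
     ((\<lambda>y. norm ((g y - g x - (y - x) *\<^sub>R D) /\<^sub>R norm (y - x))) \<longlongrightarrow> 0) (at x within S)"
    by (simp only: has_vector_derivative_def has_derivative_at_within tendsto_norm_zero_iff
        bounded_linear_scaleR_left simp_thms)
  also have "\<dots> \<longleftrightarrow> ((\<lambda>y. norm ((g y - g x) /\<^sub>R (y - x) - D)) \<longlongrightarrow> 0) (at x within S)"
    by (rule filterlim_cong[OF refl refl eq])
  also have "\<dots> \<longleftrightarrow> ((\<lambda>y. (g y - g x) /\<^sub>R (y - x)) \<longlongrightarrow> D) (at x within S)"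
    by (simp add: tendsto_norm_zero_iff LIM_zero_iff)
  finally show ?thesis .
qed

text \<open>
  Difference quotients of a Lipschitz function are bounded by the Lipschitz constant, so dominated
  convergence applies to them; their integrals are differences of means of the function over
  short intervals at the two endpoints, which converge to the endpoint values.
\<close>

lemma Lipschitz_fundamental_theorem:
  fixes g g' :: "real \<Rightarrow> 'b::euclidean_space"
  assumes ab: "a \<le> b"
    and lip: "\<And>x y. x \<in> {a..b} \<Longrightarrow> y \<in> {a..b} \<Longrightarrow> norm (g x - g y) \<le> K * \<bar>x - y\<bar>"
    and N: "negligible N"
    and deriv: "\<And>x. x \<in> {a<..<b} - N \<Longrightarrow> (g has_vector_derivative g' x) (at x)"
  shows "(g' has_integral (g b - g a)) {a..b}"
proof (cases "a = b")
  case True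
  then show ?thesis by auto
next
  case False
  then have ab': "a < b" using ab by simp
  \<comment> \<open>Extending by constants makes the difference quotients meaningful up to the endpoints.\<close>
  define e where "e x = g (max a (min b x))" for x
  have K0: "0 \<le> K"
    using lip[of a b] ab' by (smt (verit) atLeastAtMost_iff norm_ge_zero zero_le_mult_iff)
  have elip: "norm (e x - e y) \<le> K * \<bar>x - y\<bar>" for x y
  proof -
    have "norm (e x - e y) \<le> K * \<bar>max a (min b x) - max a (min b y)\<bar>"
      unfolding e_def using ab by (intro lip) auto
    also have "\<dots> \<le> K * \<bar>x - y\<bar>"
      by (intro mult_left_mono K0) linarith
    finally show ?thesis .
  qed
  have econt: "continuous_on S e" for S
  proof -
    have "K-lipschitz_on S e"
      by (intro lipschitz_onI) (use elip K0 in \<open>auto simp: dist_norm\<close>)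
    then show ?thesis by (rule lipschitz_on_continuous_on)
  qed
  define E where "E x = integral {a..x} e" for x
  define \<delta> where "\<delta> n = inverse (real (Suc n))" for n
  have dpos: "0 < \<delta> n" and d1: "\<delta> n \<le> 1" for n by (auto simp: \<delta>_def field_simps)
  have dlim: "\<delta> \<longlonglongrightarrow> 0" unfolding \<delta>_def by (rule LIMSEQ_inverse_real_of_nat)
  have dadd: "(\<lambda>n. x + \<delta> n) \<longlonglongrightarrow> x" for x
    using tendsto_add[OF tendsto_const dlim, of x] by simp
  have dnz: "\<delta> n \<noteq> 0" for n using dpos[of n] by simp
  have Ed: "(E has_vector_derivative e x) (at x within {a..b + 2})" if "x \<in> {a..b+2}" for x
    unfolding E_def by (rule integral_has_vector_derivative) (use that econt in auto)
  have Eint: "(e has_integral (E y - E x)) {x..y}" if "a \<le> x" "x \<le> y" "y \<le> b + 2" for x y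
    by (rule fundamental_theorem_of_calculus)
       (use that in \<open>auto intro!: has_vector_derivative_within_subset[OF Ed]\<close>)
  have quot_lim: "(\<lambda>n. (E (x + \<delta> n) - E x) /\<^sub>R \<delta> n) \<longlonglongrightarrow> e x" if x: "x \<in> {a..b}" for x
  proof -
    have "((\<lambda>y. (E y - E x) /\<^sub>R (y - x)) \<longlongrightarrow> e x) (at x within {a..b+2})"
      using Ed[of x] x by (simp add: has_vector_derivative_iff_quotient)
    moreover have "filterlim (\<lambda>n. x + \<delta> n) (at x within {a..b+2}) sequentially"
    proof -
      have "x + \<delta> n \<in> {a..b + 2}" for n using dpos[of n] d1[of n] x by auto
      then show ?thesis unfolding filterlim_at using dadd dnz by auto
    qed
    ultimately have "(\<lambda>n. (E (x + \<delta> n) - E x) /\<^sub>R (x + \<delta> n - x)) \<longlonglongrightarrow> e x"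
      by (rule filterlim_compose)
    then show ?thesis by simp
  qed
  define q where "q n x = (e (x + \<delta> n) - e x) /\<^sub>R \<delta> n" for n x
  have qint: "(q n has_integral
      ((E (b + \<delta> n) - E b) /\<^sub>R \<delta> n - (E (a + \<delta> n) - E a) /\<^sub>R \<delta> n)) {a..b}" for n
  proof -
    have 1: "(e has_integral (E b - E a)) {a..b}" by (rule Eint) (use ab in auto)
    have 2: "(e has_integral (E (b + \<delta> n) - E (a + \<delta> n))) {a + \<delta> n..b + \<delta> n}"
      by (rule Eint) (use ab dpos[of n] d1[of n] in auto)
    have "((\<lambda>x. e (x + \<delta> n)) has_integral (E (b + \<delta> n) - E (a + \<delta> n))) {a..b}"
      using has_integral_affinity[of e _ "a + \<delta> n" "b + \<delta> n" 1 "\<delta> n"] 2 by auto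
    from has_integral_diff[OF this 1]
    have "((\<lambda>x. (e (x + \<delta> n) - e x) /\<^sub>R \<delta> n) has_integral
        ((E (b + \<delta> n) - E (a + \<delta> n)) - (E b - E a)) /\<^sub>R \<delta> n) {a..b}"
      by (rule has_integral_cmul)
    then show ?thesis unfolding q_def by (simp add: scaleR_diff_right algebra_simps)
  qed
  define h where "h x = (if x \<in> {a<..<b} - N then g' x else 0)" for x
  define q0 where "q0 n x = (if x \<in> {a<..<b} - N then q n x else 0)" for n x
  have neg: "negligible (N \<union> {a, b})" using N by auto
  have q0int: "(q0 n has_integral
      ((E (b + \<delta> n) - E b) /\<^sub>R \<delta> n - (E (a + \<delta> n) - E a) /\<^sub>R \<delta> n)) {a..b}" for n
    by (rule has_integral_spike[OF neg _ qint]) (auto simp: q0_def)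
  have conv: "(\<lambda>n. q0 n x) \<longlonglongrightarrow> h x" if "x \<in> {a..b}" for x
  proof (cases "x \<in> {a<..<b} - N")
    case True
    have gd: "(g has_vector_derivative g' x) (at x)" using deriv True by blast
    have "(e has_vector_derivative g' x) (at x)"
    proof (rule has_vector_derivative_transform_within_open[OF gd])
      show "open {a<..<b}" "x \<in> {a<..<b}" using True by auto
      show "g y = e y" if "y \<in> {a<..<b}" for y using that by (auto simp: e_def)
    qed
    then have "((\<lambda>y. (e y - e x) /\<^sub>R (y - x)) \<longlongrightarrow> g' x) (at x)"
      by (simp add: has_vector_derivative_iff_quotient)
    moreover have "filterlim (\<lambda>n. x + \<delta> n) (at x) sequentially"
      unfolding filterlim_at using dadd dnz by auto
    ultimately have "(\<lambda>n. (e (x + \<delta> n) - e x) /\<^sub>R (x + \<delta> n - x)) \<longlonglongrightarrow> g' x"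
      by (rule filterlim_compose)
    then show ?thesis using True by (simp add: q0_def q_def h_def)
  next
    case False
    then show ?thesis by (auto simp: q0_def h_def)
  qed
  have bound: "norm (q0 n x) \<le> K" for n x
  proof -
    have "norm (q n x) \<le> K"
    proof -
      have "norm (q n x) = norm (e (x + \<delta> n) - e x) / \<delta> n"
        using dpos[of n] by (simp add: q_def divide_inverse mult.commute)
      also have "\<dots> \<le> K" using elip[of "x + \<delta> n" x] dpos[of n] by (simp add: pos_divide_le_eq)
      finally show ?thesis .
    qed
    then show ?thesis using K0 by (auto simp: q0_def)
  qed
  have *: "h integrable_on {a..b}" "(\<lambda>n. integral {a..b} (q0 n)) \<longlonglongrightarrow> integral {a..b} h"
    using dominated_convergence[of q0 "{a..b}" "\<lambda>_. K" h] q0int bound conv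
    by (auto simp: has_integral_integrable)
  have "integral {a..b} (q0 n) =
      (E (b + \<delta> n) - E b) /\<^sub>R \<delta> n - (E (a + \<delta> n) - E a) /\<^sub>R \<delta> n" for n
    using q0int by (rule integral_unique)
  moreover have "(\<lambda>n. (E (b + \<delta> n) - E b) /\<^sub>R \<delta> n - (E (a + \<delta> n) - E a) /\<^sub>R \<delta> n) \<longlonglongrightarrow> e b - e a"
    by (intro tendsto_diff quot_lim) (use ab in auto)
  ultimately have "integral {a..b} h = e b - e a"
    using *(2) LIMSEQ_unique by auto
  then have hint: "(h has_integral (g b - g a)) {a..b}"
    using *(1) ab by (auto simp: has_integral_integral e_def)
  show ?thesis
    by (rule has_integral_spike[OF neg _ hint]) (auto simp: h_def)
qed

text \<open>
  The one-sided differentiation theorem \<open>integrable_ccontinuous_explicit\<close>, used for \<open>v\<close> and for its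
  reflection, gives both one-sided derivatives.
\<close>

lemma Lebesgue_differentiation_real:
  fixes v :: "real \<Rightarrow> 'b::euclidean_space"
  assumes v: "\<And>a b. v integrable_on {a..b}"
  obtains N where "negligible N"
    "\<And>x c. x \<notin> N \<Longrightarrow> c < x \<Longrightarrow> ((\<lambda>u. integral {c..u} v) has_vector_derivative v x) (at x)"
proof -
  have R: "\<exists>N. negligible N \<and> (\<forall>x e. x \<notin> N \<and> 0 < e \<longrightarrow>
      (\<exists>d>0. \<forall>h. 0 < h \<and> h < d \<longrightarrow> norm (integral {x..x + h} w /\<^sub>R h - w x) < e))"
    if w: "\<And>a b. w integrable_on {a..b}" for w :: "real \<Rightarrow> 'b"
    using integrable_ccontinuous_explicit[of w] w by (simp add: cbox_interval) metis
  obtain N1 where N1: "negligible N1" "\<And>x e. x \<notin> N1 \<Longrightarrow> 0 < e \<Longrightarrow>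
      (\<exists>d>0. \<forall>h. 0 < h \<and> h < d \<longrightarrow> norm (integral {x..x + h} v /\<^sub>R h - v x) < e)"
    using R[of v] v by blast
  have "(\<lambda>x. v (- x)) integrable_on {a..b}" for a b
    using Henstock_Kurzweil_Integration.integrable_reflect_real[where f=v and a="-b" and b="-a"] v by simp
  from R[OF this] obtain N2 where N2: "negligible N2" "\<And>x e. x \<notin> N2 \<Longrightarrow> 0 < e \<Longrightarrow>
      (\<exists>d>0. \<forall>h. 0 < h \<and> h < d \<longrightarrow> norm (integral {x..x + h} (\<lambda>x. v (-x)) /\<^sub>R h - v (-x)) < e)"
    by blast
  have refl: "integral {-x..h-x} (\<lambda>x. v (-x)) = integral {x-h..x} v" for x h
    using Henstock_Kurzweil_Integration.integral_reflect_real[where f=v and a="x-h" and b="x"] by (simp add: algebra_simps)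
  define N where "N = N1 \<union> uminus ` N2"
  show ?thesis
  proof (rule that[of N])
    show "negligible N" unfolding N_def
      by (intro negligible_Un N1(1) negligible_differentiable_image_negligible N2(1))
         (auto intro!: derivative_intros)
    fix x c assume x: "x \<notin> N" and c: "c < x"
    have x1: "x \<notin> N1" and x2: "- x \<notin> N2" using x by (auto simp: N_def image_iff)
    have "((\<lambda>y. (integral {c..y} v - integral {c..x} v) /\<^sub>R (y - x)) \<longlongrightarrow> v x) (at x)"
    proof (rule tendstoI)
      fix e :: real assume e: "0 < e"
      obtain d1 where d1: "d1 > 0" "\<And>h. 0 < h \<Longrightarrow> h < d1 \<Longrightarrow> norm (integral {x..x + h} v /\<^sub>R h - v x) < e"
        using N1(2)[OF x1 e] by blast
      obtain d2 where d2: "d2 > 0" "\<And>h. 0 < h \<Longrightarrow> h < d2 \<Longrightarrow> norm (integral {x-h..x} v /\<^sub>R h - v x) < e"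
        using N2(2)[OF x2 e] by (auto simp: refl)
      define d where "d = min d1 (min d2 (x - c))"
      have "d > 0" using d1 d2 c by (auto simp: d_def)
      have "dist ((integral {c..y} v - integral {c..x} v) /\<^sub>R (y - x)) (v x) < e"
        if y: "y \<noteq> x" "dist y x < d" for y
      proof (cases "x < y")
        case True
        have "integral {c..x} v + integral {x..y} v = integral {c..y} v"
          by (rule Henstock_Kurzweil_Integration.integral_combine) (use True c v in auto)
        then have "integral {c..y} v - integral {c..x} v = integral {x..x + (y - x)} v"
          by (simp add: algebra_simps)
        then show ?thesis
          using d1(2)[of "y - x"] True y by (auto simp: d_def dist_norm dist_real_def)
      next
        case False
        then have yx: "y < x" using y by simp
        have cy: "c < y" using y False by (auto simp: d_def dist_real_def)
        have "integral {c..y} v + integral {y..x} v = integral {c..x} v"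
          by (rule Henstock_Kurzweil_Integration.integral_combine) (use yx cy v in auto)
        then have "(integral {c..y} v - integral {c..x} v) /\<^sub>R (y - x) =
              integral {x - (x - y)..x} v /\<^sub>R (x - y)"
        proof -
          have "integral {c..y} v - integral {c..x} v = - integral {x - (x - y)..x} v"
            by (simp add: algebra_simps flip: \<open>integral {c..y} v + integral {y..x} v = integral {c..x} v\<close>)
          moreover have "inverse (y - x) = - inverse (x - y)"
            by (metis inverse_minus_eq minus_diff_eq)
          ultimately show ?thesis by simp
        qed
        then show ?thesis
          using d2(2)[of "x - y"] yx y by (auto simp: d_def dist_norm dist_real_def)
      qed
      then show "\<forall>\<^sub>F y in at x. dist ((integral {c..y} v - integral {c..x} v) /\<^sub>R (y - x)) (v x) < e"
        unfolding eventually_at using \<open>d > 0\<close> by blast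
    qed
    then show "((\<lambda>u. integral {c..u} v) has_vector_derivative v x) (at x)"
      by (simp add: has_vector_derivative_iff_quotient)
  qed
qed

lemma has_vector_derivative_norm_le_Lipschitz:
  fixes f :: "real \<Rightarrow> 'b::real_normed_vector"
  assumes d: "(f has_vector_derivative D) (at x)" and lip: "\<And>y. norm (f y - f x) \<le> K * \<bar>y - x\<bar>"
  shows "norm D \<le> K"
proof (rule tendsto_upperbound)
  show "((\<lambda>y. norm ((f y - f x) /\<^sub>R (y - x))) \<longlongrightarrow> norm D) (at x)"
    using d by (intro tendsto_norm) (simp add: has_vector_derivative_iff_quotient)
  show "\<forall>\<^sub>F y in at x. norm ((f y - f x) /\<^sub>R (y - x)) \<le> K"
  proof -
    have "norm ((f y - f x) /\<^sub>R (y - x)) \<le> K" if "y \<noteq> x" for y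
    proof -
      have "norm ((f y - f x) /\<^sub>R (y - x)) = norm (f y - f x) / \<bar>y - x\<bar>"
        by (simp add: divide_inverse mult.commute)
      also have "\<dots> \<le> K" using lip[of y] that by (simp add: pos_divide_le_eq)
      finally show ?thesis .
    qed
    then show ?thesis by (auto simp: eventually_at_filter)
  qed
qed auto

lemma norm_has_real_derivative:
  fixes g :: "real \<Rightarrow> 'b::real_inner"
  assumes g: "(g has_vector_derivative g') (at x)" and nz: "g x \<noteq> 0"
  shows "((\<lambda>x. norm (g x)) has_real_derivative sgn (g x) \<bullet> g') (at x)"
proof -
  have "((\<lambda>x. norm (g x)) has_derivative (\<lambda>t. (t *\<^sub>R g') \<bullet> sgn (g x))) (at x)"
    using g has_derivative_norm[OF nz] unfolding has_vector_derivative_def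
    by (rule has_derivative_compose)
  then show ?thesis
    by (simp add: has_field_derivative_def mult_commute_abs inner_commute[of g'])
qed

lemma norm_sgn_diff_le:
  fixes x y :: "'a::real_normed_vector"
  assumes m: "0 < m" "m \<le> norm x" "m \<le> norm y"
  shows "norm (sgn x - sgn y) \<le> 2 / m * norm (x - y)"
proof -
  have nz: "norm x > 0" "norm y > 0" using m by auto
  have "inverse (norm x) = inverse (norm y) + (norm y - norm x) * inverse (norm x * norm y)"
    using nz by (simp add: field_simps)
  then have "y /\<^sub>R norm x = y /\<^sub>R norm y + (norm y - norm x) *\<^sub>R (y /\<^sub>R (norm x * norm y))"
    by (metis scaleR_add_left scaleR_scaleR)
  then have "sgn x - sgn y = (x - y) /\<^sub>R norm x + (norm y - norm x) *\<^sub>R (y /\<^sub>R (norm x * norm y))"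
    by (simp add: sgn_div_norm scaleR_diff_right)
  also have "norm \<dots> \<le> norm ((x - y) /\<^sub>R norm x) + norm ((norm y - norm x) *\<^sub>R (y /\<^sub>R (norm x * norm y)))"
    by (rule norm_triangle_ineq)
  also have "\<dots> = (norm (x - y) + \<bar>norm y - norm x\<bar>) / norm x"
  proof -
    have "norm ((x - y) /\<^sub>R norm x) = norm (x - y) / norm x"
      by (simp add: divide_inverse mult.commute)
    moreover have "norm ((norm y - norm x) *\<^sub>R (y /\<^sub>R (norm x * norm y))) = \<bar>norm y - norm x\<bar> / norm x"
      using nz by (simp add: divide_inverse abs_mult)
    ultimately show ?thesis by (simp add: add_divide_distrib)
  qed
  also have "\<dots> \<le> (2 * norm (x - y)) / norm x"
    using nz norm_triangle_ineq3[of y x] by (intro divide_right_mono) (auto simp: norm_minus_commute)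
  also have "\<dots> \<le> (2 * norm (x - y)) / m"
    using m nz by (intro divide_left_mono mult_pos_pos) auto
  finally show ?thesis by simp
qed

lemma borel_measurable_antimono_pos:
  fixes b :: "real \<Rightarrow> real"
  assumes "\<And>x y. 0 < x \<Longrightarrow> x \<le> y \<Longrightarrow> b y \<le> b x" and "\<And>x. x \<le> 0 \<Longrightarrow> b x = 0"
  shows "b \<in> borel_measurable borel"
proof -
  have "(\<lambda>x. - b x) \<in> borel_measurable (restrict_space borel {0<..})"
    by (rule borel_measurable_mono_on_fnc) (auto simp: mono_on_def intro: assms)
  then have "(\<lambda>x. indicator {0<..} x *\<^sub>R (- b x)) \<in> borel_measurable borel"
    by (simp add: borel_measurable_restrict_space_iff)
  then have "(\<lambda>x. - (indicator {0<..} x *\<^sub>R (- b x))) \<in> borel_measurable borel" by measurable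
  also have "(\<lambda>x. - (indicator {0<..} x *\<^sub>R (- b x))) = b"
    by (auto simp: fun_eq_iff indicator_def assms)
  finally show ?thesis .
qed

section \<open>Weak derivatives on the circle\<close>

text \<open>
  Trigonometric polynomials serve as test functions: the class is closed under differentiation, which
  makes smoothness an induction, and it is dense enough to detect a function almost everywhere.
\<close>

inductive_set trig_polys :: "real \<Rightarrow> real \<Rightarrow> (real \<Rightarrow> real) set" for w m :: real where
  const: "(\<lambda>_. c) \<in> trig_polys w m"
| cosine: "(\<lambda>x. cos (w * (x - m))) \<in> trig_polys w m"
| sine: "(\<lambda>x. sin (w * (x - m))) \<in> trig_polys w m"
| add: "f \<in> trig_polys w m \<Longrightarrow> g \<in> trig_polys w m \<Longrightarrow> (\<lambda>x. f x + g x) \<in> trig_polys w m"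
| mult: "f \<in> trig_polys w m \<Longrightarrow> g \<in> trig_polys w m \<Longrightarrow> (\<lambda>x. f x * g x) \<in> trig_polys w m"

lemma trig_polys_power: "f \<in> trig_polys w m \<Longrightarrow> (\<lambda>x. f x ^ n) \<in> trig_polys w m"
  by (induction n) (auto intro: trig_polys.intros)

lemma trig_polys_deriv:
  assumes "f \<in> trig_polys w m"
  shows "\<exists>f'\<in>trig_polys w m. \<forall>x. (f has_real_derivative f' x) (at x)"
  using assms
proof induction
  case (const c)
  show ?case by (intro bexI[of _ "\<lambda>_. 0"]) (auto intro: trig_polys.const)
next
  case cosine
  have "(\<lambda>x. (- w) * sin (w * (x - m))) \<in> trig_polys w m"
    by (intro trig_polys.intros)
  then show ?case by (rule bexI[rotated]) (auto intro!: derivative_eq_intros)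
next
  case sine
  have "(\<lambda>x. w * cos (w * (x - m))) \<in> trig_polys w m"
    by (intro trig_polys.intros)
  then show ?case by (rule bexI[rotated]) (auto intro!: derivative_eq_intros)
next
  case (add f g)
  then obtain f' g' where "f' \<in> trig_polys w m" "g' \<in> trig_polys w m"
    "\<And>x. (f has_real_derivative f' x) (at x)" "\<And>x. (g has_real_derivative g' x) (at x)" by blast
  then show ?case
    by (intro bexI[of _ "\<lambda>x. f' x + g' x"]) (auto intro!: derivative_intros trig_polys.intros)
next
  case (mult f g)
  then obtain f' g' where "f' \<in> trig_polys w m" "g' \<in> trig_polys w m"
    "\<And>x. (f has_real_derivative f' x) (at x)" "\<And>x. (g has_real_derivative g' x) (at x)" by blast
  then show ?case using mult
    by (intro bexI[of _ "\<lambda>x. f' x * g x + f x * g' x"])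
       (auto intro!: derivative_eq_intros trig_polys.intros)
qed

lemma deriv_trig_polys: "f \<in> trig_polys w m \<Longrightarrow> deriv f \<in> trig_polys w m"
  using trig_polys_deriv[of f w m] by (metis DERIV_imp_deriv ext)

lemma trig_polys_smooth_circle:
  assumes L: "0 < L" and f: "f \<in> trig_polys (2 * pi / L) m"
  shows "smooth_circle L f"
proof -
  have "f (x + L) = f x" for x using f
  proof induction
    case cosine
    have "2 * pi / L * (x + L - m) = 2 * pi / L * (x - m) + 2 * pi"
      using L by (simp add: field_simps)
    then show ?case by (simp only: cos_periodic)
  next
    case sine
    have "2 * pi / L * (x + L - m) = 2 * pi / L * (x - m) + 2 * pi"
      using L by (simp add: field_simps)
    then show ?case by (simp only: sin_periodic)
  qed auto
  moreover have "(deriv ^^ k) f \<in> trig_polys (2 * pi / L) m" for k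
    by (induction k) (auto intro: f deriv_trig_polys)
  ultimately show ?thesis
    unfolding smooth_circle_def periodic_fun_simple_def
    by (meson trig_polys_deriv real_differentiable_def)
qed

lemma smooth_circle_DERIV:
  assumes "smooth_circle L \<phi>"
  shows "(\<phi> has_real_derivative deriv \<phi> x) (at x)" "isCont (deriv \<phi>) x"
proof -
  have d: "((deriv ^^ k) \<phi>) differentiable (at x)" for k x
    using assms by (auto simp: smooth_circle_def)
  show "(\<phi> has_real_derivative deriv \<phi> x) (at x)" using d[of 0 x]
    by (simp add: DERIV_deriv_iff_real_differentiable)
  show "isCont (deriv \<phi>) x" using d[of 1 x]
    by (simp add: differentiable_imp_continuous_within)
qed

lemma integration_by_parts_on_circle:
  fixes u w :: "real \<Rightarrow> 'b::euclidean_space"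
  assumes L: "0 < L" and \<phi>: "smooth_circle L \<phi>"
    and lip: "\<And>x y. x \<in> {0..L} \<Longrightarrow> y \<in> {0..L} \<Longrightarrow> norm (u x - u y) \<le> K * \<bar>x - y\<bar>"
    and per: "u L = u 0"
    and N: "negligible N"
    and deriv: "\<And>x. x \<in> {0<..<L} - N \<Longrightarrow> (u has_vector_derivative w x) (at x)"
  shows "((\<lambda>x. deriv \<phi> x *\<^sub>R u x + \<phi> x *\<^sub>R w x) has_integral 0) {0..L}"
proof -
  note D = smooth_circle_DERIV[OF \<phi>]
  have cont\<phi>: "continuous_on {0..L} \<phi>"
    by (meson D(1) DERIV_isCont continuous_at_imp_continuous_on)
  have contd: "continuous_on {0..L} (deriv \<phi>)"
    by (meson D(2) continuous_at_imp_continuous_on)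
  obtain A where "\<forall>x\<in>{0..L}. \<bar>\<phi> x\<bar> \<le> A"
    using compact_imp_bounded[OF compact_continuous_image[OF cont\<phi>]] by (auto simp: bounded_real)
  note A = bspec[OF this]
  obtain B where "\<forall>x\<in>{0..L}. \<bar>deriv \<phi> x\<bar> \<le> B"
    using compact_imp_bounded[OF compact_continuous_image[OF contd]] by (auto simp: bounded_real)
  note B = bspec[OF this]
  have K0: "0 \<le> K"
    using lip[of 0 L] L by (smt (verit) atLeastAtMost_iff norm_ge_zero zero_le_mult_iff)
  have ub: "norm (u x) \<le> norm (u 0) + K * L" if "x \<in> {0..L}" for x
  proof -
    have "norm (u x - u 0) \<le> K * \<bar>x - 0\<bar>" using lip[of x 0] that L by auto
    also have "\<dots> \<le> K * L" using that K0 by (intro mult_left_mono) auto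
    finally show ?thesis using norm_triangle_sub[of "u x" "u 0"] by linarith
  qed
  have \<phi>lip: "\<bar>\<phi> x - \<phi> y\<bar> \<le> B * \<bar>x - y\<bar>" if "x \<in> {0..L}" "y \<in> {0..L}" for x y
  proof -
    have "norm (\<phi> x - \<phi> y) \<le> B * norm (x - y)"
    proof (rule field_differentiable_bound[where S="{0..L}" and f'="deriv \<phi>"])
      show "(\<phi> has_field_derivative deriv \<phi> z) (at z within {0..L})" if "z \<in> {0..L}" for z
        using D(1) by (rule has_field_derivative_at_within)
      show "norm (deriv \<phi> z) \<le> B" if "z \<in> {0..L}" for z using B[OF that] by simp
    qed (use that in auto)
    then show ?thesis by simp
  qed
  define U where "U = norm (u 0) + K * L"
  have prod_lip: "norm (\<phi> x *\<^sub>R u x - \<phi> y *\<^sub>R u y) \<le> (B * U + A * K) * \<bar>x - y\<bar>"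
    if x: "x \<in> {0..L}" and y: "y \<in> {0..L}" for x y
  proof -
    have "\<phi> x *\<^sub>R u x - \<phi> y *\<^sub>R u y = (\<phi> x - \<phi> y) *\<^sub>R u x + \<phi> y *\<^sub>R (u x - u y)"
      by (simp add: algebra_simps)
    then have "norm (\<phi> x *\<^sub>R u x - \<phi> y *\<^sub>R u y) \<le> \<bar>\<phi> x - \<phi> y\<bar> * norm (u x) + \<bar>\<phi> y\<bar> * norm (u x - u y)"
      by (metis norm_scaleR norm_triangle_ineq)
    also have "\<dots> \<le> (B * \<bar>x - y\<bar>) * U + A * (K * \<bar>x - y\<bar>)"
      by (intro add_mono mult_mono \<phi>lip lip A x y)
         (use ub[OF x] A[OF x] \<phi>lip[OF x y] in \<open>auto simp: U_def\<close>)
    finally show ?thesis by (simp add: algebra_simps)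
  qed
  have "((\<lambda>x. \<phi> x *\<^sub>R w x + deriv \<phi> x *\<^sub>R u x) has_integral (\<phi> L *\<^sub>R u L - \<phi> 0 *\<^sub>R u 0)) {0..L}"
    by (rule Lipschitz_fundamental_theorem[OF _ prod_lip N])
       (use L deriv D(1) in \<open>auto intro!: has_vector_derivative_scaleR\<close>)
  moreover have "\<phi> L = \<phi> 0"
    using \<phi> unfolding smooth_circle_def periodic_fun_simple_def by (metis add_0)
  ultimately show ?thesis using per by (simp add: add.commute)
qed

lemma abs_integrable_continuous_scaleR:
  fixes w :: "real \<Rightarrow> 'b::euclidean_space"
  assumes "continuous_on {a..b} h" "w absolutely_integrable_on {a..b}"
  shows "(\<lambda>x. h x *\<^sub>R w x) absolutely_integrable_on {a..b}"
proof (rule absolutely_integrable_bounded_measurable_product[where h="(*\<^sub>R)", OF _ _ _ _ assms(2)])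
  show "bilinear ((*\<^sub>R) :: real \<Rightarrow> 'b \<Rightarrow> 'b)"
    by (auto simp: bilinear_def linear_iff algebra_simps)
  show "h \<in> borel_measurable (lebesgue_on {a..b})"
    using assms(1) by (intro continuous_imp_measurable_on_sets_lebesgue) auto
  show "bounded (h ` {a..b})"
    using assms(1) by (intro compact_imp_bounded compact_continuous_image) auto
qed auto

text \<open>
  By Lebesgue differentiation a function is almost everywhere the limit of its means over short intervals.
\<close>

lemma AE_zero_if_integrals_zero:
  fixes w :: "real \<Rightarrow> 'b::euclidean_space"
  assumes w: "w integrable_on {c..d}"
    and 0: "\<And>a b. c < a \<Longrightarrow> a < b \<Longrightarrow> b < d \<Longrightarrow> integral {a..b} w = 0"
  shows "\<exists>N. negligible N \<and> (\<forall>x\<in>{c..d} - N. w x = 0)"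
proof -
  define v where "v x = (if x \<in> {c..d} then w x else 0)" for x
  have "v integrable_on UNIV" using w unfolding v_def by (simp only: integrable_restrict_UNIV)
  then have vint: "v integrable_on cbox a b" for a b
    by (meson integrable_on_subcbox subset_UNIV)
  obtain N where N: "negligible N"
     "\<And>x e. \<lbrakk>x \<notin> N; 0 < e\<rbrakk> \<Longrightarrow> \<exists>k>0. \<forall>h. 0 < h \<and> h < k \<longrightarrow>
            norm (integral (cbox x (x + h *\<^sub>R One)) v /\<^sub>R h ^ DIM(real) - v x) < e"
    using integrable_ccontinuous_explicit[of v] vint by metis
  have "w x = 0" if x: "x \<in> {c..d} - (N \<union> {c, d})" for x
  proof (rule ccontr)
    assume "w x \<noteq> 0"
    then obtain k where k: "k > 0" "\<And>h. 0 < h \<Longrightarrow> h < k \<Longrightarrow>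
            norm (integral {x..x + h} v /\<^sub>R h - v x) < norm (w x)"
      using N(2)[of x "norm (w x)"] x by (auto simp: cbox_interval)
    define h where "h = min (k/2) ((d - x)/2)"
    have h: "0 < h" "h < k" "x + h < d" using x k(1) by (auto simp: h_def min_def field_simps)
    have "integral {x..x+h} v = integral {x..x+h} w"
      by (rule integral_cong) (use x h in \<open>auto simp: v_def\<close>)
    also have "\<dots> = 0" by (rule 0) (use x h in auto)
    finally show False using k(2)[OF h(1,2)] x by (simp add: v_def)
  qed
  moreover have "negligible (N \<union> {c, d})" using N(1) by auto
  ultimately show ?thesis by blast
qed

text \<open>
  Intervals inside a period are superlevel sets of a shifted cosine, so powers of shifted cosines,
  whose span approximates continuous functions of the cosine, can test against indicators of intervals.
\<close>

lemma cos_superlevel_set_is_interval: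
  assumes L: "0 < L" and ab: "0 < a" "a < b" "b < L" and x: "0 \<le> x" "x \<le> L"
  shows "cos (2 * pi / L * (x - (a + b) / 2)) > cos (2 * pi / L * ((b - a) / 2)) \<longleftrightarrow> a < x \<and> x < b"
proof -
  define t where "t = 2 * pi / L * (x - (a + b) / 2)"
  define d where "d = 2 * pi / L * ((b - a) / 2)"
  have w: "0 < 2 * pi / L" using L by simp
  have "d = pi * ((b - a) / L)" "0 < (b - a) / L" "(b - a) / L < 1"
    using L ab by (auto simp: d_def)
  then have d: "0 < d" "d < pi"
    using mult_strict_left_mono[of "(b - a) / L" 1 pi] mult_pos_pos[OF pi_gt_zero] by (metis, metis mult.right_neutral pi_gt_zero)
  have iff1: "\<bar>t\<bar> < d \<longleftrightarrow> a < x \<and> x < b"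
  proof -
    have "\<bar>t\<bar> = 2 * pi / L * \<bar>x - (a + b) / 2\<bar>" using L by (simp add: t_def abs_mult)
    then have "\<bar>t\<bar> < d \<longleftrightarrow> \<bar>x - (a + b) / 2\<bar> < (b - a) / 2" unfolding d_def
      using w mult_less_cancel_left_pos by metis
    then show ?thesis by (auto simp: abs_if field_simps split: if_splits)
  qed
  have far: "\<bar>t\<bar> \<le> 2 * pi - d"
  proof -
    have "\<bar>t\<bar> = 2 * pi / L * \<bar>x - (a + b) / 2\<bar>" using L by (simp add: t_def abs_mult)
    also have "\<dots> \<le> 2 * pi / L * (L - (b - a) / 2)"
      using w x ab by (intro mult_left_mono) (auto simp: abs_if field_simps)
    also have "\<dots> = 2 * pi - d" using L by (simp add: d_def field_simps)
    finally show ?thesis .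
  qed
  have "cos t > cos d \<longleftrightarrow> \<bar>t\<bar> < d"
  proof (cases "\<bar>t\<bar> \<le> pi")
    case True
    then show ?thesis using cos_mono_less_eq[of d "\<bar>t\<bar>"] d by auto
  next
    case False
    have "cos t = cos (2 * pi - \<bar>t\<bar>)" by (simp add: cos_diff)
    also have "\<dots> \<le> cos d"
      using False far d cos_mono_le_eq[of "2 * pi - \<bar>t\<bar>" d] by auto
    finally show ?thesis using False d by auto
  qed
  then show ?thesis using iff1 by (simp add: t_def d_def)
qed

text \<open>
  Orthogonality passes from powers to polynomials in the shifted cosine, by the Weierstrass theorem to
  continuous functions of it, and by dominated convergence to the indicator of a superlevel set, that
  is, of an arbitrary interval; then the Lebesgue differentiation theorem applies.
\<close>

lemma AE_zero_if_orthogonal_to_cos_powers: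
  fixes w :: "real \<Rightarrow> 'b::euclidean_space"
  assumes L: "0 < L" and w: "w absolutely_integrable_on {0..L}"
    and orth: "\<And>m n. integral {0..L} (\<lambda>x. cos (2 * pi / L * (x - m)) ^ n *\<^sub>R w x) = 0"
  shows "\<exists>N. negligible N \<and> (\<forall>x\<in>{0..L} - N. w x = 0)"
proof (rule AE_zero_if_integrals_zero)
  show wi: "w integrable_on {0..L}" using w by (rule absolutely_integrable_on_def[THEN iffD1, THEN conjunct1])
  have nwi: "(\<lambda>x. norm (w x)) integrable_on {0..L}"
    using w by (simp add: absolutely_integrable_on_def)
  define c where "c m x = cos (2 * pi / L * (x - m))" for m x :: real
  have cc: "continuous_on S (c m)" for S m unfolding c_def by (intro continuous_intros)
  have c1: "c m x \<in> {-1..1}" for m x by (simp add: c_def)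
  have wint: "(\<lambda>x. h (c m x) *\<^sub>R w x) integrable_on {0..L}" if "continuous_on {-1..1} h" for h m
  proof -
    have "continuous_on {0..L} (h \<circ> c m)"
      by (rule continuous_on_compose[OF cc continuous_on_subset[OF that]]) (use c1 in auto)
    then show ?thesis
      using abs_integrable_continuous_scaleR[OF _ w, of "h \<circ> c m"] by (auto simp: absolutely_integrable_on_def)
  qed
  have poly: "integral {0..L} (\<lambda>x. q (c m x) *\<^sub>R w x) = 0" if q: "real_polynomial_function q" for q m
  proof -
    obtain a and n::nat where q': "q = (\<lambda>x. \<Sum>i\<le>n. a i * x ^ i)"
      using real_polynomial_function_imp_sum[OF q] by blast
    have "integral {0..L} (\<lambda>x. q (c m x) *\<^sub>R w x) = integral {0..L} (\<lambda>x. \<Sum>i\<le>n. a i *\<^sub>R (c m x ^ i *\<^sub>R w x))"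
      by (simp add: q' scaleR_sum_left)
    also have "\<dots> = (\<Sum>i\<le>n. integral {0..L} (\<lambda>x. a i *\<^sub>R (c m x ^ i *\<^sub>R w x)))"
      by (rule integral_sum) (auto intro!: integrable_cmul wint continuous_intros)
    also have "\<dots> = 0"
      by (simp only: integral_cmul orth[folded c_def] scaleR_zero_right sum.neutral_const)
    finally show ?thesis .
  qed
  let ?I = "\<lambda>h m. integral {0..L} (\<lambda>x. h (c m x) *\<^sub>R w x)"
  have cont: "?I h m = 0" if h: "continuous_on {-1..1} h" for h m
  proof -
    define I where "I = integral {0..L} (\<lambda>x. norm (w x))"
    have I0: "0 \<le> I" unfolding I_def by (rule integral_nonneg[OF nwi]) auto
    have le: "norm (?I h m) \<le> e * I" if e: "e > 0" for e
    proof -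
      obtain q where q: "real_polynomial_function q" "\<And>y. y \<in> {-1..1} \<Longrightarrow> \<bar>h y - q y\<bar> < e"
        using Stone_Weierstrass_real_polynomial_function[OF _ h e] by auto
      have qc: "continuous_on {-1..1} q"
        using q(1) by (simp add: continuous_on_polymonial_function real_polynomial_function_eq)
      have "?I h m
          = ?I h m - ?I q m"
        using poly[OF q(1)] by simp
      also have "\<dots> = integral {0..L} (\<lambda>x. h (c m x) *\<^sub>R w x - q (c m x) *\<^sub>R w x)"
        by (rule integral_diff[symmetric]) (intro wint h qc)+
      also have "norm \<dots> \<le> integral {0..L} (\<lambda>x. e * norm (w x))"
      proof (rule integral_norm_bound_integral)
        show "(\<lambda>x. h (c m x) *\<^sub>R w x - q (c m x) *\<^sub>R w x) integrable_on {0..L}"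
          by (intro integrable_diff wint h qc)
        show "(\<lambda>x. e * norm (w x)) integrable_on {0..L}" using integrable_cmul[OF nwi, of e] by simp
        show "norm (h (c m x) *\<^sub>R w x - q (c m x) *\<^sub>R w x) \<le> e * norm (w x)" for x
          unfolding scaleR_diff_left[symmetric] norm_scaleR
          using q(2)[OF c1, of m x] by (intro mult_right_mono) auto
      qed
      finally show ?thesis by (simp add: I_def)
    qed
    have "norm (?I h m) \<le> 0"
    proof (rule field_le_epsilon)
      fix e :: real assume "0 < e"
      then have "e / (I + 1) * I \<le> e" using I0 by (simp add: field_simps)
      moreover have "0 < e / (I + 1)" using I0 \<open>0 < e\<close> by simp
      ultimately show "norm (?I h m) \<le> 0 + e"
        using le[of "e / (I + 1)"] by linarith
    qed
    then show ?thesis by simp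
  qed
  fix a b assume ab: "0 < a" "a < b" "b < L"
  define m where "m = (a + b) / 2"
  define t where "t = cos (2 * pi / L * ((b - a) / 2))"
  \<comment> \<open>Ramps of slope \<open>n\<close> that increase to the indicator of \<open>{t<..}\<close>.\<close>
  define h where "h n y = min 1 (max 0 (real n * (y - t)))" for n y
  have hlim: "(\<lambda>n. h n y) \<longlonglongrightarrow> (if y > t then 1 else 0)" for y
  proof (cases "y > t")
    case True
    obtain k :: nat where k: "real k > 1 / (y - t)" using reals_Archimedean2 by blast
    have "h n y = 1" if "n \<ge> k" for n
    proof -
      have "1 \<le> real k * (y - t)" using k True by (simp add: field_simps)
      also have "\<dots> \<le> real n * (y - t)" using that True by (intro mult_right_mono) auto
      finally show ?thesis by (simp add: h_def)
    qed
    then show ?thesis using True by (auto intro!: tendsto_eventually eventually_sequentiallyI[of k])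
  next
    case False
    then have "real n * (y - t) \<le> 0" for n by (simp add: mult_nonneg_nonpos)
    then have "h n y = 0" for n by (simp add: h_def max_absorb1)
    then show ?thesis using False by simp
  qed
  have "(\<lambda>n. integral {0..L} (\<lambda>x. h n (c m x) *\<^sub>R w x))
      \<longlonglongrightarrow> integral {0..L} (\<lambda>x. (if c m x > t then 1 else 0) *\<^sub>R w x)"
  proof (rule dominated_convergence(2)[OF _ nwi])
    show "(\<lambda>x. h n (c m x) *\<^sub>R w x) integrable_on {0..L}" for n
      by (rule wint) (auto simp: h_def intro!: continuous_intros)
    show "norm (h n (c m x) *\<^sub>R w x) \<le> norm (w x)" for n x
      by (simp add: h_def mult_left_le_one_le)
    show "(\<lambda>n. h n (c m x) *\<^sub>R w x) \<longlonglongrightarrow> (if c m x > t then 1 else 0) *\<^sub>R w x" for x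
      by (intro tendsto_scaleR hlim tendsto_const)
  qed
  moreover have "integral {0..L} (\<lambda>x. h n (c m x) *\<^sub>R w x) = 0" for n
    by (rule cont) (auto simp: h_def intro!: continuous_intros)
  ultimately have "integral {0..L} (\<lambda>x. (if c m x > t then 1 else 0) *\<^sub>R w x) = 0"
    by (simp add: LIMSEQ_const_iff)
  also have "integral {0..L} (\<lambda>x. (if c m x > t then 1 else 0) *\<^sub>R w x) =
      integral {0..L} (\<lambda>x. if x \<in> {a<..<b} then w x else 0)"
    by (rule integral_cong)
       (use cos_superlevel_set_is_interval[OF L ab] in \<open>auto simp: c_def m_def t_def\<close>)
  also have "\<dots> = integral {a<..<b} w"
  proof -
    have "{a<..<b} \<inter> {0..L} = {a<..<b}" using ab by auto
    then show ?thesis by (simp only: integral_restrict_Int)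
  qed
  also have "\<dots> = integral {a..b} w" by (simp add: integral_open_interval_real)
  finally show "integral {a..b} w = 0" .
qed

lemma weak_deriv_integral:
  fixes u v :: "real \<Rightarrow> 'b::euclidean_space"
  assumes wd: "has_weak_deriv L u v" and \<phi>: "smooth_circle L \<phi>"
  shows "integral {0..L} (\<lambda>s. deriv \<phi> s *\<^sub>R u s) = - integral {0..L} (\<lambda>s. \<phi> s *\<^sub>R v s)"
proof -
  note D = smooth_circle_DERIV[OF \<phi>]
  have "(\<lambda>s. deriv \<phi> s *\<^sub>R u s) absolutely_integrable_on {0..L}"
    using wd D(2) by (intro abs_integrable_continuous_scaleR)
      (auto simp: has_weak_deriv_def intro: continuous_at_imp_continuous_on)
  moreover have "(\<lambda>s. \<phi> s *\<^sub>R v s) absolutely_integrable_on {0..L}"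
    using wd D(1) by (intro abs_integrable_continuous_scaleR)
      (auto simp: has_weak_deriv_def intro!: continuous_at_imp_continuous_on DERIV_isCont)
  moreover have "(LINT s:{0..L}|lebesgue. deriv \<phi> s *\<^sub>R u s) = - (LINT s:{0..L}|lebesgue. \<phi> s *\<^sub>R v s)"
    using wd \<phi> by (auto simp: has_weak_deriv_def)
  ultimately show ?thesis by (simp add: set_lebesgue_integral_eq_integral)
qed

lemma weak_deriv_unique:
  fixes u v w :: "real \<Rightarrow> 'b::euclidean_space"
  assumes L: "0 < L" and v: "has_weak_deriv L u v" and w: "has_weak_deriv L u w"
  shows "\<exists>N. negligible N \<and> (\<forall>x\<in>{0..L} - N. v x = w x)"
proof -
  have vi: "v absolutely_integrable_on {0..L}" and wi: "w absolutely_integrable_on {0..L}"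
    using v w by (auto simp: has_weak_deriv_def)
  have "\<exists>N. negligible N \<and> (\<forall>x\<in>{0..L} - N. v x - w x = 0)"
  proof (rule AE_zero_if_orthogonal_to_cos_powers[OF L])
    show "(\<lambda>x. v x - w x) absolutely_integrable_on {0..L}"
      using vi wi by (rule set_integral_diff)
    fix m n
    define \<phi> where "\<phi> x = cos (2 * pi / L * (x - m)) ^ n" for x
    have "\<phi> \<in> trig_polys (2 * pi / L) m" unfolding \<phi>_def
      by (intro trig_polys_power trig_polys.cosine)
    then have sm: "smooth_circle L \<phi>" by (rule trig_polys_smooth_circle[OF L])
    have c: "continuous_on {0..L} \<phi>" unfolding \<phi>_def by (intro continuous_intros)
    have i: "(\<lambda>x. \<phi> x *\<^sub>R g x) integrable_on {0..L}" if "g absolutely_integrable_on {0..L}" for g :: "real \<Rightarrow> 'b"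
      using abs_integrable_continuous_scaleR[OF c that] by (simp add: absolutely_integrable_on_def)
    have "integral {0..L} (\<lambda>x. \<phi> x *\<^sub>R (v x - w x)) =
        integral {0..L} (\<lambda>x. \<phi> x *\<^sub>R v x) - integral {0..L} (\<lambda>x. \<phi> x *\<^sub>R w x)"
      unfolding scaleR_diff_right by (intro integral_diff i vi wi)
    also have "\<dots> = 0" using weak_deriv_integral[OF v sm] weak_deriv_integral[OF w sm] by simp
    finally show "integral {0..L} (\<lambda>x. cos (2 * pi / L * (x - m)) ^ n *\<^sub>R (v x - w x)) = 0"
      by (simp add: \<phi>_def)
  qed
  then show ?thesis by simp
qed

text \<open>
  The derivative of \<open>cos\<^sup>k sin\<close> is a combination of \<open>cos\<^sup>k\<^sup>+\<^sup>1\<close> and \<open>cos\<^sup>k\<^sup>-\<^sup>1\<close>, so orthogonality to derivatives and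
  to constants propagates to all powers of the cosine.
\<close>

lemma cos_power_derivative_recursion:
  fixes g :: "real \<Rightarrow> 'b::euclidean_space"
  assumes g: "continuous_on {0..L} g" and mean: "integral {0..L} g = 0"
    and orth: "\<And>\<phi>. \<phi> \<in> trig_polys w m \<Longrightarrow> integral {0..L} (\<lambda>x. deriv \<phi> x *\<^sub>R g x) = 0"
    and w: "w \<noteq> 0"
  shows "integral {0..L} (\<lambda>x. cos (w * (x - m)) ^ n *\<^sub>R g x) = 0"
proof (induction n rule: less_induct)
  case (less n)
  define c where "c x = cos (w * (x - m))" for x
  define s where "s x = sin (w * (x - m))" for x
  have i: "(\<lambda>x. (a * c x ^ k) *\<^sub>R g x) integrable_on {0..L}" for a k
    by (intro integrable_continuous_interval continuous_intros g) (auto simp: c_def intro!: continuous_intros)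
  show ?case
  proof (cases n)
    case 0
    then show ?thesis using mean by simp
  next
    case (Suc k)
    define \<phi> where "\<phi> x = c x ^ k * s x" for x
    have mem: "\<phi> \<in> trig_polys w m"
      unfolding \<phi>_def c_def s_def by (intro trig_polys.mult trig_polys_power trig_polys.cosine trig_polys.sine)
    have d: "deriv \<phi> x = w * (real (Suc k) * c x ^ Suc k - real k * c x ^ (k - 1))" for x
    proof -
      have "(\<phi> has_real_derivative
          (real k * c x ^ (k - 1) * (- s x * w)) * s x + c x ^ k * (c x * w)) (at x)"
        unfolding \<phi>_def c_def s_def by (auto intro!: derivative_eq_intros)
      then have "deriv \<phi> x = (real k * c x ^ (k - 1) * (- s x * w)) * s x + c x ^ k * (c x * w)"
        by (rule DERIV_imp_deriv)
      also have "\<dots> = - w * real k * c x ^ (k - 1) * (s x)\<^sup>2 + w * c x ^ Suc k"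
        by (simp add: power2_eq_square)
      also have "(s x)\<^sup>2 = 1 - (c x)\<^sup>2" by (simp add: s_def c_def sin_squared_eq)
      also have "- w * real k * c x ^ (k - 1) * (1 - (c x)\<^sup>2) + w * c x ^ Suc k =
          w * (real (Suc k) * c x ^ Suc k - real k * c x ^ (k - 1))"
        by (cases k) (auto simp: algebra_simps power2_eq_square)
      finally show ?thesis .
    qed
    have "0 = integral {0..L} (\<lambda>x. deriv \<phi> x *\<^sub>R g x)" using orth[OF mem] by simp
    also have "\<dots> = integral {0..L} (\<lambda>x. (w * real (Suc k) * c x ^ Suc k) *\<^sub>R g x - (w * real k * c x ^ (k-1)) *\<^sub>R g x)"
      by (simp add: d algebra_simps scaleR_diff_left)
    also have "\<dots> = integral {0..L} (\<lambda>x. (w * real (Suc k) * c x ^ Suc k) *\<^sub>R g x)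
       - integral {0..L} (\<lambda>x. (w * real k * c x ^ (k-1)) *\<^sub>R g x)"
      by (intro integral_diff i)
    also have "\<dots> = (w * real (Suc k)) *\<^sub>R integral {0..L} (\<lambda>x. c x ^ Suc k *\<^sub>R g x)
        - (w * real k) *\<^sub>R integral {0..L} (\<lambda>x. c x ^ (k - 1) *\<^sub>R g x)"
      by (simp only: integral_cmul scaleR_scaleR[symmetric])
    also have "integral {0..L} (\<lambda>x. c x ^ (k - 1) *\<^sub>R g x) = 0"
      using less[of "k - 1"] Suc by (simp add: c_def)
    finally have "(w * real (Suc k)) *\<^sub>R integral {0..L} (\<lambda>x. c x ^ Suc k *\<^sub>R g x) = 0" by simp
    then have "integral {0..L} (\<lambda>x. c x ^ Suc k *\<^sub>R g x) = 0"
      using w by (simp del: of_nat_Suc power_Suc)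
    then show ?thesis unfolding Suc c_def .
  qed
qed

text \<open>
  The primitive \<open>V\<close> of the weak derivative \<open>v\<close> is differentiable almost everywhere with derivative \<open>v\<close>.
  Integrating by parts, \<open>u - V\<close> is orthogonal to the derivatives of all test functions, hence it is a constant.
\<close>

lemma weak_deriv_is_classical:
  fixes u v :: "real \<Rightarrow> 'b::euclidean_space"
  assumes L: "0 < L" and wd: "has_weak_deriv L u v" and cont: "continuous_on {0..L} u"
    and bdd: "AE s in lebesgue. norm (v s) \<le> M"
  shows "\<exists>N. negligible N \<and> (\<forall>x\<in>{0<..<L} - N. (u has_vector_derivative v x) (at x))"
proof -
  have vi: "v absolutely_integrable_on {0..L}" using wd by (auto simp: has_weak_deriv_def)
  obtain N0 where N0: "negligible N0" "\<And>x. x \<notin> N0 \<Longrightarrow> norm (v x) \<le> M"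
    using bdd by (auto simp: negligible_iff_null_sets elim!: AE_E3)
  define v0 where "v0 x = (if x \<in> {0..L} - N0 then v x else 0)" for x
  have M0: "0 \<le> M"
  proof -
    obtain x where "x \<notin> N0" using N0(1) non_negligible_UNIV by (metis UNIV_eq_I)
    then show ?thesis using N0(2) norm_ge_zero order_trans by blast
  qed
  have v0b: "norm (v0 x) \<le> M" for x using N0(2) M0 by (auto simp: v0_def)
  have v0i: "v0 integrable_on {a..b}" for a b
  proof -
    have "(\<lambda>x. if x \<in> {0..L} then v x else 0) integrable_on UNIV"
      using vi by (simp only: integrable_restrict_UNIV absolutely_integrable_on_def)
    then have "v0 integrable_on UNIV"
      by (rule integrable_spike[OF _ N0(1)]) (auto simp: v0_def)
    then show ?thesis by (metis integrable_on_subcbox subset_UNIV cbox_interval)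
  qed
  have v0v: "integral {0..L} (\<lambda>x. h x *\<^sub>R v0 x) = integral {0..L} (\<lambda>x. h x *\<^sub>R v x)" for h
    by (rule integral_spike[OF N0(1)]) (auto simp: v0_def)
  define V where "V x = integral {-1..x} v0" for x
  obtain N1 where N1: "negligible N1"
    "\<And>x. x \<notin> N1 \<Longrightarrow> -1 < x \<Longrightarrow> (V has_vector_derivative v0 x) (at x)"
    using Lebesgue_differentiation_real[OF v0i] unfolding V_def by metis
  have Vdiff: "V y - V x = integral {x..y} v0" if "-1 \<le> x" "x \<le> y" for x y
    using Henstock_Kurzweil_Integration.integral_combine[OF that v0i] by (simp add: V_def algebra_simps)
  have Vlip': "norm (V y - V x) \<le> M * \<bar>y - x\<bar>" if "-1 \<le> x" "x \<le> y" for x y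
  proof -
    have "norm (integral {x..y} v0) \<le> M * measure lborel {x..y}"
      by (rule has_integral_bound_real[where f=v0 and S="{}"]) (use M0 v0i v0b in \<open>auto simp: integrable_integral\<close>)
    then show ?thesis using Vdiff[OF that] that by simp
  qed
  have Vlip: "norm (V x - V y) \<le> M * \<bar>x - y\<bar>" if "x \<in> {0..L}" "y \<in> {0..L}" for x y
    using Vlip'[of x y] Vlip'[of y x] that
    by (cases "x \<le> y") (auto simp: norm_minus_commute abs_minus_commute)
  have Vcont: "continuous_on {0..L} V"
  proof -
    have "M-lipschitz_on {0..L} V" using M0 Vlip by (intro lipschitz_onI) (auto simp: dist_norm)
    then show ?thesis by (rule lipschitz_on_continuous_on)
  qed
  have Vper: "V L = V 0"
  proof -
    have "(\<lambda>_. 1) \<in> trig_polys (2 * pi / L) 0" by (rule trig_polys.const)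
    from weak_deriv_integral[OF wd trig_polys_smooth_circle[OF L this]]
    have "integral {0..L} v = 0" by simp
    moreover have "V L - V 0 = integral {0..L} v0" using L by (intro Vdiff) auto
    ultimately show ?thesis using v0v[of "\<lambda>_. 1"] by simp
  qed
  define C where "C = (1 / L) *\<^sub>R integral {0..L} (\<lambda>x. u x - V x)"
  define g where "g x = u x - V x - C" for x
  have gc: "continuous_on {0..L} g" unfolding g_def by (intro continuous_intros cont Vcont)
  have mean: "integral {0..L} g = 0"
  proof -
    have "integral {0..L} g = integral {0..L} (\<lambda>x. u x - V x) - integral {0..L} (\<lambda>x. C)"
      unfolding g_def by (intro integral_diff integrable_continuous_interval continuous_intros cont Vcont)
    also have "\<dots> = 0" using L by (simp add: C_def)
    finally show ?thesis .
  qed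
  have orth: "integral {0..L} (\<lambda>x. deriv \<phi> x *\<^sub>R g x) = 0" if mem: "\<phi> \<in> trig_polys (2 * pi / L) m" for \<phi> m
  proof -
    have sm: "smooth_circle L \<phi>" by (rule trig_polys_smooth_circle[OF L mem])
    note D = smooth_circle_DERIV[OF sm]
    have dc: "continuous_on {0..L} (deriv \<phi>)" using D(2) by (auto intro: continuous_at_imp_continuous_on)
    have \<phi>c: "continuous_on {0..L} \<phi>" using D(1) by (auto intro!: continuous_at_imp_continuous_on DERIV_isCont)
    have i: "(\<lambda>x. deriv \<phi> x *\<^sub>R h x) integrable_on {0..L}" if "continuous_on {0..L} h" for h :: "real \<Rightarrow> 'b"
      by (intro integrable_continuous_interval continuous_intros dc that)
    have "((\<lambda>x. deriv \<phi> x *\<^sub>R V x + \<phi> x *\<^sub>R v0 x) has_integral 0) {0..L}"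
      by (rule integration_by_parts_on_circle[OF L sm Vlip Vper N1(1)]) (use N1(2) in auto)
    then have "integral {0..L} (\<lambda>x. deriv \<phi> x *\<^sub>R V x + \<phi> x *\<^sub>R v0 x) = 0"
        "(\<lambda>x. deriv \<phi> x *\<^sub>R V x + \<phi> x *\<^sub>R v0 x) integrable_on {0..L}" by (auto simp: integral_unique)
    moreover have "(\<lambda>x. \<phi> x *\<^sub>R v0 x) integrable_on {0..L}"
      using integrable_diff[OF calculation(2) i[OF Vcont]] by simp
    ultimately have "integral {0..L} (\<lambda>x. deriv \<phi> x *\<^sub>R V x) = - integral {0..L} (\<lambda>x. \<phi> x *\<^sub>R v0 x)"
      using integral_add[OF i[OF Vcont]] by (simp add: eq_neg_iff_add_eq_0)
    then have 1: "integral {0..L} (\<lambda>x. deriv \<phi> x *\<^sub>R V x) = integral {0..L} (\<lambda>x. deriv \<phi> x *\<^sub>R u x)"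
      using weak_deriv_integral[OF wd sm] v0v by simp
    have "(deriv \<phi> has_integral (\<phi> L - \<phi> 0)) {0..L}"
      by (rule fundamental_theorem_of_calculus)
         (use L D(1) in \<open>auto simp: has_real_derivative_iff_has_vector_derivative[symmetric] intro: has_field_derivative_at_within\<close>)
    moreover have "\<phi> L = \<phi> 0"
      using sm unfolding smooth_circle_def periodic_fun_simple_def by (metis add_0)
    ultimately have "(deriv \<phi> has_integral 0) {0..L}" by simp
    then have "((\<lambda>x. deriv \<phi> x *\<^sub>R C) has_integral 0 *\<^sub>R C) {0..L}" by (rule has_integral_scaleR_left)
    then have 2: "integral {0..L} (\<lambda>x. deriv \<phi> x *\<^sub>R C) = 0" by (simp add: integral_unique)
    have "integral {0..L} (\<lambda>x. deriv \<phi> x *\<^sub>R g x) =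
       integral {0..L} (\<lambda>x. deriv \<phi> x *\<^sub>R u x - deriv \<phi> x *\<^sub>R V x - deriv \<phi> x *\<^sub>R C)"
      by (simp add: g_def scaleR_diff_right)
    also have "\<dots> = integral {0..L} (\<lambda>x. deriv \<phi> x *\<^sub>R u x) - integral {0..L} (\<lambda>x. deriv \<phi> x *\<^sub>R V x)
        - integral {0..L} (\<lambda>x. deriv \<phi> x *\<^sub>R C)"
      by (simp only: integral_diff integrable_diff i cont Vcont continuous_on_const)
    finally show ?thesis using 1 2 by simp
  qed
  have "\<exists>N. negligible N \<and> (\<forall>x\<in>{0..L} - N. g x = 0)"
  proof (rule AE_zero_if_orthogonal_to_cos_powers[OF L])
    show "g absolutely_integrable_on {0..L}"
      using gc by (rule absolutely_integrable_continuous_real)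
    show "integral {0..L} (\<lambda>x. cos (2 * pi / L * (x - m)) ^ n *\<^sub>R g x) = 0" for m n
      using L by (intro cos_power_derivative_recursion gc mean orth) auto
  qed
  then obtain N where N: "negligible N" "\<And>x. x \<in> {0..L} - N \<Longrightarrow> g x = 0" by blast
  have g0: "g x = 0" if x: "x \<in> {0<..<L}" for x
  proof (rule ccontr)
    assume nz: "g x \<noteq> 0"
    have "continuous_on {0<..<L} g" by (rule continuous_on_subset[OF gc]) auto
    then have "open ({0<..<L} \<inter> g -` (- {0}))"
      by (intro continuous_open_preimage) auto
    moreover have "{0<..<L} \<inter> g -` (- {0}) \<subseteq> N" using N(2) by auto
    ultimately show False
      using nz x N(1) open_not_negligible negligible_subset by blast
  qed
  have "(u has_vector_derivative v x) (at x)" if x: "x \<in> {0<..<L} - (N0 \<union> N1)" for x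
  proof -
    have "(V has_vector_derivative v x) (at x)" using N1(2)[of x] x by (auto simp: v0_def)
    then have "((\<lambda>x. V x + C) has_vector_derivative v x) (at x)"
      by (auto intro!: derivative_eq_intros)
    then show ?thesis
    proof (rule has_vector_derivative_transform_within_open)
      show "V y + C = u y" if "y \<in> {0<..<L}" for y using g0[OF that] by (simp add: g_def algebra_simps)
    qed (use x in auto)
  qed
  moreover have "negligible (N0 \<union> N1)" using N0 N1 by auto
  ultimately show ?thesis by blast
qed

section \<open>The tangent of a curve parametrized by arc length\<close>

lemma closed_curve_Lipschitz:
  assumes "closed_curve L f"
  shows "dist (f s) (f t) \<le> \<bar>s - t\<bar>"
proof -
  have "dist (f a) (f b) \<le> b - a" if "a \<le> b" for a b
  proof -
    have "ennreal (dist (f a) (f b)) = (\<Sum>i<length [a, b] - 1. ennreal (dist (f ([a, b] ! i)) (f ([a, b] ! Suc i))))"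
      by simp
    also have "\<dots> \<le> curve_length f a b"
      unfolding curve_length_def by (rule SUP_upper) (use that in auto)
    also have "\<dots> = ennreal (b - a)" using assms that by (simp add: closed_curve_def)
    finally show ?thesis using that by (simp add: ennreal_le_iff)
  qed
  from this[of s t] this[of t s] show ?thesis by (cases "s \<le> t") (auto simp: dist_commute)
qed

text \<open>
  The bound is additive over adjacent intervals, so the sums over partitions telescope.
\<close>

lemma curve_length_le_integral:
  fixes f :: "real \<Rightarrow> 'a::metric_space"
  assumes ab: "a \<le> b" and h: "h integrable_on {a..b}" and h0: "\<And>x. 0 \<le> h x"
    and le: "\<And>x y. a \<le> x \<Longrightarrow> x \<le> y \<Longrightarrow> y \<le> b \<Longrightarrow> dist (f x) (f y) \<le> integral {x..y} h"
  shows "curve_length f a b \<le> ennreal (integral {a..b} h)"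
  unfolding curve_length_def
proof (rule SUP_least)
  fix p :: "real list" assume "p \<in> {p. sorted p \<and> set p \<subseteq> {a..b}}"
  then have p: "sorted p" and sub: "set p \<subseteq> {a..b}" by auto
  have mem: "p ! i \<in> {a..b}" if "i < length p" for i using sub that nth_mem by blast
  define H where "H x = integral {a..x} h" for x
  have Hdiff: "H y - H x = integral {x..y} h" if "a \<le> x" "x \<le> y" "y \<le> b" for x y
    using Henstock_Kurzweil_Integration.integral_combine[of a x y h] that
      integrable_on_subinterval[OF h, of a y]
    by (simp add: H_def algebra_simps)
  show "(\<Sum>i<length p - 1. ennreal (dist (f (p ! i)) (f (p ! Suc i)))) \<le> ennreal (integral {a..b} h)"
  proof (cases "p = []")
    case True
    then show ?thesis by simp
  next
    case False
    have "(\<Sum>i<length p - 1. ennreal (dist (f (p ! i)) (f (p ! Suc i)))) =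
        ennreal (\<Sum>i<length p - 1. dist (f (p ! i)) (f (p ! Suc i)))"
      by (rule sum_ennreal) auto
    also have "\<dots> \<le> ennreal (\<Sum>i<length p - 1. H (p ! Suc i) - H (p ! i))"
    proof (intro ennreal_leI sum_mono)
      fix i assume "i \<in> {..<length p - 1}"
      then have i: "Suc i < length p" by auto
      have "p ! i \<le> p ! Suc i" using p i by (simp add: sorted_nth_mono)
      then show "dist (f (p ! i)) (f (p ! Suc i)) \<le> H (p ! Suc i) - H (p ! i)"
        using mem[of i] mem[of "Suc i"] i by (subst Hdiff) (auto intro!: le)
    qed
    also have "(\<Sum>i<length p - 1. H (p ! Suc i) - H (p ! i)) = H (p ! (length p - 1)) - H (p ! 0)"
      by (rule sum_lessThan_telescope)
    also have "\<dots> = integral {p ! 0..p ! (length p - 1)} h"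
      using False mem[of 0] mem[of "length p - 1"] p by (intro Hdiff) (auto simp: sorted_nth_mono)
    also have "\<dots> \<le> integral {a..b} h"
    proof -
      have "{p ! 0..p ! (length p - 1)} \<subseteq> {a..b}"
        using False mem[of 0] mem[of "length p - 1"] by auto
      then show ?thesis using h h0 integrable_on_subinterval[OF h] by (intro integral_subset_le) auto
    qed
    finally show ?thesis by (simp add: ennreal_leI)
  qed
qed

text \<open>
  The derivative exists almost everywhere because \<open>f\<close> is the primitive of a bounded weak derivative;
  Lipschitz continuity bounds its norm by \<open>1\<close>. As the integral of the speed dominates the length, which
  is \<open>b - a\<close> on \<open>{a..b}\<close>, the speed is \<open>1\<close> almost everywhere. On the exceptional null set \<open>T\<close> is a fixed
  unit vector, so that it is a unit field everywhere.
\<close>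

lemma ex_borel_unit_tangent:
  fixes f :: "real \<Rightarrow> 'a::euclidean_space"
  assumes L: "0 < L" and f: "closed_curve L f" and W: "f \<in> W1inf L"
  obtains T N where "T \<in> borel_measurable borel" "\<And>s. T (s + L) = T s" "\<And>s. norm (T s) = 1"
    "negligible N" "\<And>s. s \<notin> N \<Longrightarrow> (f has_vector_derivative T s) (at s)"
proof -
  have per: "f (s + L) = f s" for s
    using f by (simp add: closed_curve_def periodic_fun_simple_def)
  interpret P: periodic_fun_simple f L by standard (rule per)
  have lip: "norm (f s - f t) \<le> 1 * \<bar>s - t\<bar>" for s t
    using closed_curve_Lipschitz[OF f] by (simp add: dist_norm)
  have "1-lipschitz_on UNIV f" using lip by (intro lipschitz_onI) (auto simp: dist_norm)
  then have cont: "continuous_on S f" for S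
    by (meson continuous_on_subset lipschitz_on_continuous_on subset_UNIV)
  obtain v M where v: "has_weak_deriv L f v" "AE s in lebesgue. norm (v s) \<le> M"
    using W by (auto simp: W1inf_def Linf_circle_def)
  obtain N0 where N0: "negligible N0" "\<And>x. x \<in> {0<..<L} - N0 \<Longrightarrow> (f has_vector_derivative v x) (at x)"
    using weak_deriv_is_classical[OF L v(1) cont v(2)] by blast
  define ND where "ND = {x. \<not> f differentiable (at x)}"
  have negND: "negligible ND"
  proof (rule negligible_subset)
    show "negligible (\<Union>k::int. (+) (real_of_int k * L) ` (N0 \<union> {0}))"
      by (intro negligible_countable_Union) (auto intro!: negligible_translation simp: N0)
    show "ND \<subseteq> (\<Union>k::int. (+) (real_of_int k * L) ` (N0 \<union> {0}))"
    proof
      fix x assume x: "x \<in> ND"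
      define k where "k = \<lfloor>x / L\<rfloor>"
      define y where "y = x - real_of_int k * L"
      have y: "0 \<le> y" "y < L"
      proof -
        have "real_of_int k \<le> x / L" "x / L < real_of_int k + 1" unfolding k_def by linarith+
        then have "real_of_int k * L \<le> x" "x < (real_of_int k + 1) * L"
          using L by (simp_all add: pos_le_divide_eq pos_divide_less_eq)
        then show "0 \<le> y" "y < L" by (simp_all add: y_def algebra_simps)
      qed
      have "y \<in> N0 \<union> {0}"
      proof (rule ccontr)
        assume "y \<notin> N0 \<union> {0}"
        then have "(f has_vector_derivative v y) (at y)" using y by (intro N0(2)) auto
        moreover have "((\<lambda>z. z - real_of_int k * L) has_vector_derivative 1) (at x)"
          by (auto intro!: derivative_eq_intros)
        ultimately have "((f \<circ> (\<lambda>z. z - real_of_int k * L)) has_vector_derivative 1 *\<^sub>R v y) (at x)"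
          by (intro vector_diff_chain_at) (auto simp: y_def)
        moreover have "f \<circ> (\<lambda>z. z - real_of_int k * L) = f"
          using P.minus_of_int by auto
        ultimately show False using x by (auto simp: ND_def differentiableI_vector)
      qed
      then show "x \<in> (\<Union>k::int. (+) (real_of_int k * L) ` (N0 \<union> {0}))"
        by (intro UN_I[of k] image_eqI[of _ _ y]) (auto simp: y_def)
    qed
  qed
  define D where "D x = vector_derivative f (at x)" for x
  have D: "(f has_vector_derivative D x) (at x)" if "x \<notin> ND" for x
    using that by (auto simp: ND_def D_def vector_derivative_works)
  define D0 where "D0 x = (if x \<in> ND then 0 else D x)" for x
  have D0le: "norm (D0 x) \<le> 1" for x
    using has_vector_derivative_norm_le_Lipschitz[OF D lip] by (auto simp: D0_def)
  have D0int: "(D0 has_integral (f b - f a)) {a..b}" if "a \<le> b" for a b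
    by (rule Lipschitz_fundamental_theorem[OF that lip negND]) (use D in \<open>auto simp: D0_def\<close>)
  have D0abs: "D0 absolutely_integrable_on {a..b}" if "a \<le> b" for a b
    by (rule absolutely_integrable_integrable_bound[where g="\<lambda>_. 1"])
       (use D0le D0int[OF that] in \<open>auto simp: has_integral_integrable\<close>)
  have nD0: "(\<lambda>x. norm (D0 x)) integrable_on {a..b}" if "a \<le> b" for a b
    using D0abs[OF that] by (simp add: absolutely_integrable_on_def)
  have speed: "integral {a..b} (\<lambda>x. norm (D0 x)) = b - a" if ab: "a \<le> b" for a b
  proof (rule antisym)
    have "integral {a..b} (\<lambda>x. norm (D0 x)) \<le> integral {a..b} (\<lambda>x. 1)"
      by (intro integral_le nD0 ab) (use D0le in auto)
    then show "integral {a..b} (\<lambda>x. norm (D0 x)) \<le> b - a" using ab by simp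
    have "ennreal (b - a) = curve_length f a b" using f ab by (simp add: closed_curve_def)
    also have "\<dots> \<le> ennreal (integral {a..b} (\<lambda>x. norm (D0 x)))"
    proof (rule curve_length_le_integral[OF ab nD0[OF ab]])
      fix x y assume xy: "a \<le> x" "x \<le> y" "y \<le> b"
      have "dist (f x) (f y) = norm (integral {x..y} D0)"
        using D0int[OF xy(2)] by (simp add: integral_unique dist_norm norm_minus_commute)
      also have "\<dots> \<le> integral {x..y} (\<lambda>x. norm (D0 x))"
        using D0int[OF xy(2)] nD0[OF xy(2)]
        by (intro integral_norm_bound_integral) (auto simp: has_integral_integrable)
      finally show "dist (f x) (f y) \<le> integral {x..y} (\<lambda>x. norm (D0 x))" .
    qed auto
    finally show "b - a \<le> integral {a..b} (\<lambda>x. norm (D0 x))"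
      using integral_nonneg[OF nD0[OF ab]] by (simp add: ennreal_le_iff)
  qed
  have "\<exists>N. negligible N \<and> (\<forall>x\<in>{- real n..real n} - N. 1 - norm (D0 x) = 0)" for n
  proof (rule AE_zero_if_integrals_zero)
    show "(\<lambda>x. 1 - norm (D0 x)) integrable_on {- real n..real n}"
      by (intro integrable_diff nD0) auto
    show "integral {a..b} (\<lambda>x. 1 - norm (D0 x)) = 0" if "a < b" for a b
      using that speed[of a b] nD0[of a b] by (subst integral_diff) auto
  qed
  then obtain N1 where N1: "\<And>n. negligible (N1 n)"
      "\<And>n x. x \<in> {- real n..real n} - N1 n \<Longrightarrow> norm (D0 x) = 1" by (metis diff_eq_diff_eq diff_zero diff_self)
  define N where "N = ND \<union> (\<Union>n. N1 n)"
  have negN: "negligible N" unfolding N_def using N1(1) negND by (intro negligible_Un negligible_countable_Union) auto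
  have unit: "norm (D x) = 1" if "x \<notin> N" for x
  proof -
    obtain n where "\<bar>x\<bar> \<le> real n" using real_arch_simple by blast
    then have "norm (D0 x) = 1" using that by (intro N1(2)[of x n]) (auto simp: N_def)
    then show ?thesis using that by (auto simp: D0_def N_def)
  qed
  \<comment> \<open>The limit of a sequence of difference quotients is a Borel function of the point.\<close>
  define l where "l x = lim (\<lambda>n. (f (x + inverse (real (Suc n))) - f x) /\<^sub>R inverse (real (Suc n)))" for x
  define e :: 'a where "e = (SOME i. i \<in> Basis)"
  have "e \<in> Basis" unfolding e_def using nonempty_Basis some_in_eq by blast
  then have e: "norm e = 1" by simp
  define T where "T x = (if norm (l x) = 1 then l x else e)" for x
  have [measurable]: "f \<in> borel_measurable borel"
    using cont[of UNIV] by (rule borel_measurable_continuous_onI)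
  have [measurable]: "l \<in> borel_measurable borel"
    unfolding l_def by measurable
  show ?thesis
  proof (rule that[OF _ _ _ negN])
    show "T \<in> borel_measurable borel" unfolding T_def by measurable
    show "T (s + L) = T s" for s
    proof -
      have "f (s + L + r) = f (s + r)" for r using per[of "s + r"] by (simp add: add_ac)
      then show ?thesis by (simp add: T_def l_def per)
    qed
    show "norm (T s) = 1" for s using e by (simp add: T_def)
    show "(f has_vector_derivative T s) (at s)" if s: "s \<notin> N" for s
    proof -
      have Ds: "(f has_vector_derivative D s) (at s)" using s by (intro D) (auto simp: N_def)
      have "filterlim (\<lambda>n. s + inverse (real (Suc n))) (at s) sequentially"
        unfolding filterlim_at using tendsto_add[OF tendsto_const LIMSEQ_inverse_real_of_nat, of s] by auto
      from filterlim_compose[OF Ds[unfolded has_vector_derivative_iff_quotient] this]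
      have "l s = D s" unfolding l_def by (intro limI) simp
      then show ?thesis using Ds unit[OF s] by (simp add: T_def)
    qed
  qed
qed

text \<open>
  The tangent is carried along as a separate Borel field of unit vectors, so that null sets of points
  without a derivative matter only where a derivative of \<open>f\<close> is taken.
\<close>

locale unit_speed_loop =
  fixes L :: real and f T :: "real \<Rightarrow> 'a::euclidean_space" and N :: "real set"
  assumes L_pos: "0 < L"
    and f_per: "f (s + L) = f s"
    and f_lip: "norm (f s - f t) \<le> \<bar>s - t\<bar>"
    and T_borel [measurable]: "T \<in> borel_measurable borel"
    and T_per: "T (s + L) = T s"
    and T_unit: "norm (T s) = 1"
    and N_negligible: "negligible N"
    and f_deriv: "s \<notin> N \<Longrightarrow> (f has_vector_derivative T s) (at s)"
begin

lemma f_cont: "continuous_on S f"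
proof -
  have "1-lipschitz_on S f" using f_lip by (intro lipschitz_onI) (auto simp: dist_norm)
  then show ?thesis by (rule lipschitz_on_continuous_on)
qed

lemma f_borel [measurable]: "f \<in> borel_measurable borel"
  using f_cont[of UNIV] by (rule borel_measurable_continuous_onI)

lemma T_integral: "a \<le> b \<Longrightarrow> (T has_integral (f b - f a)) {a..b}"
  by (rule Lipschitz_fundamental_theorem[where K=1, OF _ _ N_negligible]) (use f_lip f_deriv in auto)

lemma has_weak_deriv_tangent: "has_weak_deriv L f T"
proof -
  have Tabs: "T absolutely_integrable_on {0..L}"
    by (rule absolutely_integrable_integrable_bound[where g="\<lambda>_. 1"])
       (use T_unit T_integral[of 0 L] L_pos in \<open>auto simp: has_integral_integrable\<close>)
  have fabs: "f absolutely_integrable_on {0..L}"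
    by (intro absolutely_integrable_continuous_real f_cont)
  have "(LINT s:{0..L}|lebesgue. deriv \<phi> s *\<^sub>R f s) = - (LINT s:{0..L}|lebesgue. \<phi> s *\<^sub>R T s)"
    if \<phi>: "smooth_circle L \<phi>" for \<phi>
  proof -
    note D = smooth_circle_DERIV[OF \<phi>]
    have 1: "(\<lambda>s. deriv \<phi> s *\<^sub>R f s) absolutely_integrable_on {0..L}"
      using D(2) by (intro abs_integrable_continuous_scaleR fabs continuous_at_imp_continuous_on) auto
    have 2: "(\<lambda>s. \<phi> s *\<^sub>R T s) absolutely_integrable_on {0..L}"
      using D(1) by (intro abs_integrable_continuous_scaleR Tabs continuous_at_imp_continuous_on)
        (auto intro: DERIV_isCont)
    have "((\<lambda>x. deriv \<phi> x *\<^sub>R f x + \<phi> x *\<^sub>R T x) has_integral 0) {0..L}"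
      by (rule integration_by_parts_on_circle[where K=1, OF L_pos \<phi> _ _ N_negligible])
         (use f_lip f_deriv f_per[of 0] in auto)
    then have "integral {0..L} (\<lambda>x. deriv \<phi> x *\<^sub>R f x + \<phi> x *\<^sub>R T x) = 0" by (rule integral_unique)
    then have "integral {0..L} (\<lambda>x. deriv \<phi> x *\<^sub>R f x) + integral {0..L} (\<lambda>x. \<phi> x *\<^sub>R T x) = 0"
      using 1 2 by (subst (asm) integral_add) (auto simp: absolutely_integrable_on_def)
    then show ?thesis using 1 2 by (simp add: set_lebesgue_integral_eq_integral eq_neg_iff_add_eq_0)
  qed
  then show ?thesis using f_per T_per Tabs fabs
    by (auto simp: has_weak_deriv_def periodic_fun_simple_def)
qed

end

section \<open>The density as a mixed derivative\<close>

text \<open>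
  The kernel stands for \<open>1/\<Phi>\<close>; the value \<open>0\<close> on the nonpositive half-line makes it a Borel function on
  \<open>\<real>\<close> and lets all densities vanish on the diagonal.
\<close>

locale decreasing_kernel =
  fixes b :: "real \<Rightarrow> real"
  assumes b_pos: "0 < x \<Longrightarrow> 0 < b x"
    and b_antimono: "0 < x \<Longrightarrow> x \<le> y \<Longrightarrow> b y \<le> b x"
    and b_nonpos: "x \<le> 0 \<Longrightarrow> b x = 0"
    and b_integrable: "0 < x \<Longrightarrow> set_integrable lborel {x..} b"
begin

lemma b_nonneg: "0 \<le> b x"
  using b_pos[of x] b_nonpos[of x] by (cases "x \<le> 0") auto

lemma b_borel [measurable]: "b \<in> borel_measurable borel"
  by (rule borel_measurable_antimono_pos[OF b_antimono b_nonpos])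

text \<open>
  This is \<open>- x \<Lambda>(x)\<close> for \<open>x > 0\<close>.
\<close>

definition F :: "real \<Rightarrow> real" where
  "F x = (if 0 < x then (LINT t:{x..}|lborel. b t) else 0)"

lemma b_set_integrable: "0 < x \<Longrightarrow> set_integrable lborel {x..y} b"
  by (rule set_integrable_subset[OF b_integrable[of x]]) auto

lemma b_integrable_on: "0 < x \<Longrightarrow> b integrable_on {x..y}"
  using b_set_integrable[of x y] by (rule set_borel_integral_eq_integral(1))

lemma F_diff: assumes "0 < x" "x \<le> y" shows "F x - F y = integral {x..y} b"
proof -
  have "(LINT t:{x..<y} \<union> {y..}|lborel. b t) = (LINT t:{x..<y}|lborel. b t) + (LINT t:{y..}|lborel. b t)"
    using assms by (intro set_integral_Un) (auto intro: set_integrable_subset[OF b_integrable[of x]])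
  also have "{x..<y} \<union> {y..} = {x..}" using assms by auto
  also have "(LINT t:{x..<y}|lborel. b t) = integral {x..<y} b"
    by (intro set_borel_integral_eq_integral set_integrable_subset[OF b_integrable[of x]]) (use assms in auto)
  also have "\<dots> = integral {x..y} b"
    by (rule integral_spike_set) (auto intro: negligible_subset[of "{y}"])
  finally show ?thesis using assms by (simp add: F_def)
qed

lemma F_nonneg: "0 \<le> F x"
  by (auto simp: F_def b_nonneg set_lebesgue_integral_def intro!: integral_nonneg_AE)

lemma F_diff_le: assumes "0 < m" "m \<le> x" "m \<le> y" shows "\<bar>F x - F y\<bar> \<le> b m * \<bar>x - y\<bar>"
proof -
  have "0 \<le> F u - F v \<and> F u - F v \<le> b m * (v - u)" if "m \<le> u" "u \<le> v" for u v
  proof -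
    have "integral {u..v} b \<le> integral {u..v} (\<lambda>_. b m)"
      by (intro integral_le b_integrable_on) (use that assms in \<open>auto intro: b_antimono\<close>)
    moreover have "0 \<le> integral {u..v} b"
      by (intro integral_nonneg b_integrable_on) (use that assms b_nonneg in auto)
    ultimately show ?thesis using F_diff[of u v] that assms by (simp add: mult.commute)
  qed
  from this[of x y] this[of y x] assms show ?thesis by (cases "x \<le> y") auto
qed

lemma F_antimono: "0 < x \<Longrightarrow> x \<le> y \<Longrightarrow> F y \<le> F x"
  using F_diff[of x y] integral_nonneg[OF b_integrable_on[of x y]] b_nonneg by auto

lemma F_continuous_on: "0 < m \<Longrightarrow> continuous_on {m..} F"
  by (rule lipschitz_on_continuous_on[of "b m"])
     (auto intro!: lipschitz_onI F_diff_le simp: dist_real_def b_nonneg)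

lemma F_borel [measurable]: "F \<in> borel_measurable borel"
  by (rule borel_measurable_antimono_pos[OF F_antimono]) (auto simp: F_def)

lemma F_DERIV:
  assumes x: "0 < x" and c: "isCont b x"
  shows "(F has_real_derivative - b x) (at x)"
proof -
  define m where "m = x / 2"
  have m: "0 < m" "m < x" using x by (auto simp: m_def)
  have "((\<lambda>u. integral {m..u} b) has_vector_derivative b x) (at x within {m..x+1})"
    using integral_has_vector_derivative_continuous_at[of b m "x+1" x "{}"] m b_integrable_on
      continuous_at_imp_continuous_at_within[OF c, of "{m..x+1}"] by simp
  then have "((\<lambda>u. integral {m..u} b) has_vector_derivative b x) (at x)"
    using m at_within_Icc_at[of m x "x+1"] by simp
  then have "((\<lambda>u. F m - integral {m..u} b) has_real_derivative - b x) (at x)"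
    unfolding has_real_derivative_iff_has_vector_derivative
    by (auto intro!: derivative_eq_intros)
  then show ?thesis
  proof (rule has_field_derivative_transform_within_open)
    show "open {m<..}" "x \<in> {m<..}" using m by auto
    show "F m - integral {m..u} b = F u" if "u \<in> {m<..}" for u
      using F_diff[of m u] m that by auto
  qed
qed

lemma countable_discontinuities: "countable {x. 0 < x \<and> \<not> isCont b x}"
proof -
  have "countable {a \<in> {0<..}. \<not> isCont (\<lambda>x. - b x) a}"
    by (rule mono_on_ctble_discont_open) (auto simp: mono_on_def intro: b_antimono)
  moreover have "isCont (\<lambda>x. - b x) a = isCont b a" for a
    using isCont_minus[of a b] isCont_minus[of a "\<lambda>x. - b x"] by auto
  ultimately show ?thesis by simp
qed

text \<open>
  \<open>F\<close> has no derivative where \<open>b\<close> jumps, which happens at countably many values. Where \<open>r\<close> takes such a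
  value with \<open>r' = 0\<close>, the Lipschitz bound for \<open>F\<close> yields the derivative \<open>0\<close>; where \<open>r' \<noteq> 0\<close>, the point
  is isolated in its level set, so there are only countably many of these.
\<close>

lemma F_chain_rule_AE:
  fixes r r' :: "real \<Rightarrow> real"
  assumes r: "\<And>x. x \<in> S \<Longrightarrow> (r has_real_derivative r' x) (at x)"
    and pos: "\<And>x. x \<in> S \<Longrightarrow> 0 < r x"
  shows "\<exists>E. countable E \<and> (\<forall>x\<in>S - E. ((\<lambda>x. F (r x)) has_real_derivative - b (r x) * r' x) (at x))"
proof -
  define E where "E y = {x \<in> S. r x = y \<and> r' x \<noteq> 0}" for y
  have cE: "countable (E y)" for y
  proof (rule countable_if_all_points_isolated)
    fix x assume x: "x \<in> E y"
    have "((\<lambda>z. (r z - r x) / (z - x)) \<longlongrightarrow> r' x) (at x)"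
      using r x by (auto simp: E_def has_field_derivative_iff)
    moreover have "r' x \<noteq> 0" using x by (simp add: E_def)
    ultimately have "\<forall>\<^sub>F z in at x. (r z - r x) / (z - x) \<noteq> 0"
      by (metis tendsto_imp_eventually_ne)
    then obtain U where U: "open U" "x \<in> U" "\<And>z. z \<in> U \<Longrightarrow> z \<noteq> x \<Longrightarrow> (r z - r x) / (z - x) \<noteq> 0"
      unfolding eventually_at_topological by blast
    then have "U \<inter> E y = {x}" using x by (auto simp: E_def)
    then show "\<exists>U. open U \<and> x \<in> U \<and> U \<inter> E y = {x}" using U by blast
  qed
  define A where "A = {x. 0 < x \<and> \<not> isCont b x}"
  define X where "X = (\<Union>y\<in>A. E y)"
  have "countable X" unfolding X_def A_def by (intro countable_UN countable_discontinuities cE)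
  moreover have "((\<lambda>x. F (r x)) has_real_derivative - b (r x) * r' x) (at x)" if x: "x \<in> S - X" for x
  proof (cases "isCont b (r x)")
    case True
    show ?thesis
      by (rule DERIV_chain2[OF F_DERIV]) (use True r pos x in auto)
  next
    case False
    then have r0: "r' x = 0" using x pos by (auto simp: X_def A_def E_def)
    define m where "m = r x / 2"
    have m: "0 < m" "m < r x" using pos x by (auto simp: m_def)
    have rd: "((\<lambda>z. (r z - r x) / (z - x)) \<longlongrightarrow> 0) (at x)"
      using r[of x] x r0 by (auto simp: has_field_derivative_iff)
    have "isCont r x" using r x DERIV_isCont by blast
    then have "\<forall>\<^sub>F z in at x. m < r z"
      using m(2) by (auto simp: isCont_def intro: order_tendstoD)
    then have ev: "\<forall>\<^sub>F z in at x. norm ((F (r z) - F (r x)) / (z - x)) \<le> b m * \<bar>(r z - r x) / (z - x)\<bar>"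
    proof eventually_elim
      case (elim z)
      have "\<bar>F (r z) - F (r x)\<bar> \<le> b m * \<bar>r z - r x\<bar>" using elim m by (intro F_diff_le) auto
      then have "\<bar>F (r z) - F (r x)\<bar> / \<bar>z - x\<bar> \<le> b m * \<bar>r z - r x\<bar> / \<bar>z - x\<bar>"
        by (rule divide_right_mono) auto
      then show ?case by simp
    qed
    have "((\<lambda>z. (F (r z) - F (r x)) / (z - x)) \<longlongrightarrow> 0) (at x)"
      by (rule Lim_null_comparison[OF ev tendsto_mult_right_zero[OF tendsto_rabs_zero[OF rd]]])
    then show ?thesis using r0 by (simp add: has_field_derivative_iff)
  qed
  ultimately show ?thesis by blast
qed

end

locale loop_with_kernel = unit_speed_loop L f T N + decreasing_kernel b
  for L :: real and f T :: "real \<Rightarrow> 'a::euclidean_space" and N b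
begin

definition r where "r s h = norm (f s - f (s + h))"

text \<open>
  \<open>J s h\<close> is \<open>\<Lambda>(|\<Delta>f|) \<Delta>f \<bullet> \<tau>(s)\<close>, the \<open>s\<close>-derivative of \<open>G(|\<Delta>f|)\<close>, at the points \<open>s\<close> and \<open>s + h\<close>, and \<open>K s h\<close> is the mixed
  derivative of \<open>G(|\<Delta>f|)\<close>.
\<close>

definition J where "J s h = - F (r s h) * (sgn (f s - f (s + h)) \<bullet> T s)"

definition K where "K s h = F (r s h) / r s h * (T s \<bullet> T (s + h))
  - (b (r s h) + F (r s h) / r s h) * ((T s \<bullet> sgn (f s - f (s + h))) * (T (s + h) \<bullet> sgn (f s - f (s + h))))"

lemma negligible_shift: "negligible ((\<lambda>x. x - s) ` N)"
  using negligible_translation[OF N_negligible, of "-s"] by simp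

lemma diff_deriv:
  assumes "h \<notin> (\<lambda>x. x - s) ` N"
  shows "((\<lambda>h. f s - f (s + h)) has_vector_derivative - T (s + h)) (at h)"
proof -
  have "s + h \<notin> N" using assms by (force simp: image_iff)
  have "((\<lambda>h. s + h) has_vector_derivative 1) (at h)" by (auto intro!: derivative_eq_intros)
  from vector_diff_chain_at[OF this f_deriv[OF \<open>s + h \<notin> N\<close>]]
  have "((\<lambda>h. f (s + h)) has_vector_derivative T (s + h)) (at h)" by (simp add: o_def)
  then show ?thesis by (auto intro!: derivative_eq_intros)
qed

lemma r_deriv:
  assumes "h \<notin> (\<lambda>x. x - s) ` N" "0 < r s h"
  shows "(r s has_real_derivative - (T (s + h) \<bullet> sgn (f s - f (s + h)))) (at h)"
proof -
  have "((\<lambda>h. norm (f s - f (s + h))) has_real_derivative sgn (f s - f (s + h)) \<bullet> (- T (s + h))) (at h)"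
    by (rule norm_has_real_derivative[OF diff_deriv[OF assms(1)]]) (use assms(2) in \<open>auto simp: r_def\<close>)
  then show ?thesis by (simp add: r_def[abs_def] inner_commute)
qed

text \<open>
  For fixed \<open>s\<close> only the position \<open>f (s + h)\<close> varies, while \<open>T s\<close> is a constant vector; so \<open>J s\<close> is Lipschitz away
  from \<open>r = 0\<close>, even though \<open>T\<close> is only measurable, and its derivative is \<open>K s\<close> almost everywhere.
\<close>

lemma J_fundamental_theorem:
  assumes ac: "a \<le> c" and m: "0 < m" "\<And>h. h \<in> {a..c} \<Longrightarrow> m \<le> r s h"
  shows "(K s has_integral (J s c - J s a)) {a..c}"
proof -
  define N' where "N' = (\<lambda>x. x - s) ` N"
  define r' where "r' h = - (T (s + h) \<bullet> sgn (f s - f (s + h)))" for h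
  have rd: "(r s has_real_derivative r' h) (at h)" if "h \<in> {a..c} - N'" for h
    unfolding r'_def using that m(1) m(2)[of h] by (intro r_deriv) (auto simp: N'_def)
  obtain E where E: "countable E"
    "\<And>h. h \<in> {a..c} - N' - E \<Longrightarrow> ((\<lambda>h. F (r s h)) has_real_derivative - b (r s h) * r' h) (at h)"
  proof -
    have "0 < r s h" if "h \<in> {a..c} - N'" for h using that m(1) m(2)[of h] by auto
    from F_chain_rule_AE[of "{a..c} - N'" "r s" r', OF rd this] show ?thesis using that by blast
  qed
  have neg: "negligible (N' \<union> E)"
    using negligible_shift null_sets_completionI[OF countable_imp_null_set_lborel[OF E(1)]]
    by (auto simp: N'_def negligible_iff_null_sets)
  have lip: "norm (J s x - J s y) \<le> (b m + F m * (2 / m)) * \<bar>x - y\<bar>"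
    if x: "x \<in> {a..c}" and y: "y \<in> {a..c}" for x y
  proof -
    define S where "S h = sgn (f s - f (s + h)) \<bullet> T s" for h
    have S1: "\<bar>S x\<bar> \<le> 1"
    proof -
      have "\<bar>S x\<bar> \<le> norm (sgn (f s - f (s + x))) * norm (T s)"
        unfolding S_def by (rule Cauchy_Schwarz_ineq2)
      also have "\<dots> \<le> 1" using T_unit by (simp add: norm_sgn)
      finally show ?thesis .
    qed
    have fxy: "norm (f s - f (s + x) - (f s - f (s + y))) \<le> \<bar>x - y\<bar>"
      using f_lip[of "s + y" "s + x"] by (simp add: abs_minus_commute)
    have S2: "\<bar>S x - S y\<bar> \<le> 2 / m * \<bar>x - y\<bar>"
    proof -
      have "\<bar>S x - S y\<bar> = \<bar>(sgn (f s - f (s + x)) - sgn (f s - f (s + y))) \<bullet> T s\<bar>"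
        by (simp add: S_def inner_diff_left)
      also have "\<dots> \<le> norm (sgn (f s - f (s + x)) - sgn (f s - f (s + y))) * norm (T s)"
        by (rule Cauchy_Schwarz_ineq2)
      also have "\<dots> \<le> 2 / m * norm (f s - f (s + x) - (f s - f (s + y)))"
        using norm_sgn_diff_le[OF m(1), of "f s - f (s + x)" "f s - f (s + y)"] m(2)[OF x] m(2)[OF y] T_unit
        by (simp add: r_def)
      also have "\<dots> \<le> 2 / m * \<bar>x - y\<bar>" using fxy m(1) by (intro mult_left_mono) auto
      finally show ?thesis .
    qed
    have F2: "\<bar>F (r s x) - F (r s y)\<bar> \<le> b m * \<bar>x - y\<bar>"
    proof -
      have "\<bar>F (r s x) - F (r s y)\<bar> \<le> b m * \<bar>r s x - r s y\<bar>"
        by (intro F_diff_le m x y)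
      also have "\<bar>r s x - r s y\<bar> \<le> \<bar>x - y\<bar>"
        unfolding r_def using norm_triangle_ineq3 fxy order_trans by blast
      finally show ?thesis using b_nonneg by (simp add: mult_left_mono)
    qed
    have "J s x - J s y = - ((F (r s x) - F (r s y)) * S x + F (r s y) * (S x - S y))"
      by (simp add: J_def S_def algebra_simps)
    then have "\<bar>J s x - J s y\<bar> \<le> \<bar>F (r s x) - F (r s y)\<bar> * \<bar>S x\<bar> + \<bar>F (r s y)\<bar> * \<bar>S x - S y\<bar>"
      using abs_triangle_ineq[of "(F (r s x) - F (r s y)) * S x" "F (r s y) * (S x - S y)"]
      by (simp only: abs_minus_cancel abs_mult)
    also have "\<dots> \<le> (b m * \<bar>x - y\<bar>) * 1 + F m * (2 / m * \<bar>x - y\<bar>)"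
      by (intro add_mono mult_mono F2 S1 S2)
         (use F_antimono[OF m(1) m(2)[OF y]] F_nonneg b_nonneg in auto)
    finally show ?thesis by (simp add: algebra_simps)
  qed
  show ?thesis
  proof (rule Lipschitz_fundamental_theorem[OF ac lip neg])
    fix h assume h: "h \<in> {a<..<c} - (N' \<union> E)"
    then have hac: "h \<in> {a..c}" by auto
    define X where "X = f s - f (s + h)"
    have r0: "0 < r s h" using m(1) m(2)[OF hac] by simp
    have d1: "((\<lambda>h. F (r s h)) has_real_derivative - b (r s h) * r' h) (at h)" using h by (intro E(2)) auto
    have d2: "((\<lambda>h. (f s - f (s + h)) \<bullet> T s) has_real_derivative - (T (s + h) \<bullet> T s)) (at h)"
    proof -
      have "((\<lambda>h. (f s - f (s + h)) \<bullet> T s) has_derivative (\<lambda>t. (t *\<^sub>R - T (s + h)) \<bullet> T s)) (at h)"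
        using diff_deriv[of h s] h unfolding has_vector_derivative_def N'_def
        by (intro has_derivative_inner_left) auto
      moreover have "(\<lambda>t. (t *\<^sub>R - T (s + h)) \<bullet> T s) = (*) (- (T (s + h) \<bullet> T s))"
        by (simp add: fun_eq_iff)
      ultimately show ?thesis by (simp only: has_field_derivative_def)
    qed
    have d3: "(r s has_real_derivative r' h) (at h)" using h by (intro rd) auto
    have "((\<lambda>h. - (F (r s h) * ((f s - f (s + h)) \<bullet> T s / r s h))) has_real_derivative
        - (- b (r s h) * r' h * (X \<bullet> T s / r s h) +
            (- (T (s + h) \<bullet> T s) * r s h - X \<bullet> T s * r' h) / (r s h * r s h) * F (r s h))) (at h)"
      using r0 unfolding X_def by (intro DERIV_minus[OF DERIV_mult[OF d1 DERIV_divide[OF d2 d3]]]) simp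
    moreover have "J s = (\<lambda>h. - (F (r s h) * ((f s - f (s + h)) \<bullet> T s / r s h)))"
      by (rule ext) (simp add: J_def r_def sgn_div_norm divide_inverse)
    moreover have "- (- b (r s h) * r' h * (X \<bullet> T s / r s h) +
            (- (T (s + h) \<bullet> T s) * r s h - X \<bullet> T s * r' h) / (r s h * r s h) * F (r s h)) = K s h"
    proof -
      have X: "T s \<bullet> sgn X = X \<bullet> T s / r s h"
        by (simp add: r_def X_def sgn_div_norm divide_inverse inner_commute)
      show ?thesis unfolding K_def r'_def X_def[symmetric] X inner_commute[of "T (s + h)" "T s"]
        using r0 by (simp add: field_simps)
    qed
    ultimately show "(J s has_vector_derivative K s h) (at h)"
      by (simp only: has_real_derivative_iff_has_vector_derivative)
  qed
qed

end

section \<open>Integration over the circle and over its square\<close>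

lemma circle_dist_eq_infdist: "circle_dist L s t = infdist (s - t) (range (\<lambda>k::int. of_int k * L))"
  unfolding circle_dist_def
  by (simp add: infdist_notempty image_image dist_real_def diff_diff_eq)

lemma circle_dist_periodic: "circle_dist L s (t + L) = circle_dist L s t"
proof -
  have "range (\<lambda>k::int. t + L + of_int k * L) = range (\<lambda>k::int. t + of_int k * L)"
  proof (intro equalityI subsetI)
    fix x assume "x \<in> range (\<lambda>k::int. t + L + of_int k * L)"
    then obtain k :: int where "x = t + L + of_int k * L" by blast
    then have "x = t + of_int (k + 1) * L" by (simp add: algebra_simps)
    then show "x \<in> range (\<lambda>k::int. t + of_int k * L)" by blast
  next
    fix x assume "x \<in> range (\<lambda>k::int. t + of_int k * L)"
    then obtain k :: int where "x = t + of_int k * L" by blast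
    then have "x = t + L + of_int (k - 1) * L" by (simp add: algebra_simps)
    then show "x \<in> range (\<lambda>k::int. t + L + of_int k * L)" by blast
  qed
  then show ?thesis by (simp add: circle_dist_def)
qed

lemma circle_dist_shift:
  assumes L: "0 < L" and h: "\<bar>h\<bar> \<le> L / 2"
  shows "circle_dist L s (s + h) = \<bar>h\<bar>"
  unfolding circle_dist_def
proof (rule antisym)
  have "s + h \<in> range (\<lambda>k::int. s + h + of_int k * L)" by (rule range_eqI[of _ _ 0]) simp
  from infdist_le[OF this, of s] show "infdist s (range (\<lambda>k::int. s + h + of_int k * L)) \<le> \<bar>h\<bar>"
    by (simp add: dist_real_def)
  have ne: "range (\<lambda>k::int. s + h + of_int k * L) \<noteq> {}" by auto
  show "\<bar>h\<bar> \<le> infdist s (range (\<lambda>k::int. s + h + of_int k * L))"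
    unfolding infdist_notempty[OF ne]
  proof (rule cINF_greatest)
    fix y assume "y \<in> range (\<lambda>k::int. s + h + of_int k * L)"
    then obtain k :: int where y: "y = s + h + of_int k * L" by blast
    consider "k = 0" | "1 \<le> k" | "k \<le> -1" by linarith
    then show "\<bar>h\<bar> \<le> dist s y"
    proof cases
      case 1
      then show ?thesis by (simp add: y dist_real_def)
    next
      case 2
      then have "1 * L \<le> of_int k * L" using L by (intro mult_right_mono) auto
      then show ?thesis using h by (simp add: y dist_real_def)
    next
      case 3
      then have "of_int k * L \<le> -1 * L" using L by (intro mult_right_mono) auto
      then show ?thesis using h by (simp add: y dist_real_def)
    qed
  qed auto
qed

lemma circle_dist_borel: "(\<lambda>p. circle_dist L (fst p) (snd p)) \<in> borel_measurable borel"
  unfolding circle_dist_eq_infdist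
  by (intro borel_measurable_continuous_onI continuous_intros)

lemma set_integrable_bounded_Icc:
  fixes g :: "real \<Rightarrow> real"
  assumes [measurable]: "g \<in> borel_measurable borel" and "\<And>x. \<bar>g x\<bar> \<le> M"
  shows "set_integrable lborel {a..b} g"
  unfolding set_integrable_def
proof (rule integrableI_bounded_set_indicator)
  show "AE x in lborel. x \<in> {a..b} \<longrightarrow> norm (g x) \<le> M" using assms(2) by simp
qed (auto simp: emeasure_lborel_Icc_eq)

lemma fst_borel_real [measurable]: "(fst :: real \<times> real \<Rightarrow> real) \<in> borel_measurable borel"
  by (intro borel_measurable_continuous_onI continuous_intros)

lemma snd_borel_real [measurable]: "(snd :: real \<times> real \<Rightarrow> real) \<in> borel_measurable borel"
  by (intro borel_measurable_continuous_onI continuous_intros)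

lemma sgn_borel [measurable]: "(sgn :: 'a::euclidean_space \<Rightarrow> 'a) \<in> borel_measurable borel"
  unfolding sgn_div_norm[abs_def] by measurable

lemma negligible_Times_real:
  fixes N :: "real set"
  assumes "negligible N"
  shows "negligible (N \<times> (UNIV :: real set))" "negligible ((UNIV :: real set) \<times> N)"
proof -
  obtain N' where N': "N' \<in> null_sets lborel" "N \<subseteq> N'"
    using assms null_sets_completion_iff2[of N lborel] unfolding negligible_iff_null_sets by blast
  have "N' \<times> UNIV \<in> null_sets (lborel \<Otimes>\<^sub>M lborel)"
    using lborel.times_in_null_sets1[OF N'(1), of UNIV] by simp
  then have "negligible (N' \<times> (UNIV :: real set))"
    unfolding lborel_prod negligible_iff_null_sets by (rule null_sets_completionI)
  then show "negligible (N \<times> (UNIV :: real set))" using N'(2) by (auto intro: negligible_subset)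
  have "UNIV \<times> N' \<in> null_sets (lborel \<Otimes>\<^sub>M lborel)"
    by (rule lborel.times_in_null_sets2[OF _ N'(1)]) simp
  then have "negligible ((UNIV :: real set) \<times> N')"
    unfolding lborel_prod negligible_iff_null_sets by (rule null_sets_completionI)
  then show "negligible ((UNIV :: real set) \<times> N)" using N'(2) by (auto intro: negligible_subset)
qed

lemma negligible_diagonal: "negligible {p :: real \<times> real. fst p = snd p}"
proof -
  have "negligible {p :: real \<times> real. (1, -1) \<bullet> p = 0}"
    by (rule negligible_hyperplane) (simp add: zero_prod_def)
  then show ?thesis by (simp add: inner_prod_def)
qed

lemma set_integral_lebesgue_eq_lborel:
  fixes g :: "'a::euclidean_space \<Rightarrow> real"
  assumes "g \<in> borel_measurable borel" "S \<in> sets borel"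
  shows "g absolutely_integrable_on S \<longleftrightarrow> set_integrable lborel S g"
    and "(LINT x:S|lebesgue. g x) = (LINT x:S|lborel. g x)"
proof -
  have m: "(\<lambda>x. indicator S x *\<^sub>R g x) \<in> borel_measurable lborel"
    using assms by simp
  show "g absolutely_integrable_on S \<longleftrightarrow> set_integrable lborel S g"
    unfolding set_integrable_def by (rule integrable_completion[OF m])
  show "(LINT x:S|lebesgue. g x) = (LINT x:S|lborel. g x)"
    unfolding set_lebesgue_integral_def by (rule integral_completion[OF m])
qed

lemma lebesgue_integral_spike_borel:
  fixes g d :: "'a::euclidean_space \<Rightarrow> real"
  assumes g: "g \<in> borel_measurable borel" and S: "S \<in> sets borel"
    and Z: "negligible Z" and eq: "\<And>x. x \<in> S - Z \<Longrightarrow> d x = g x"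
  shows "d absolutely_integrable_on S \<longleftrightarrow> set_integrable lborel S g"
    and "set_integrable lborel S g \<Longrightarrow> (LINT x:S|lebesgue. d x) = (LINT x:S|lborel. g x)"
proof -
  have "d absolutely_integrable_on S \<longleftrightarrow> g absolutely_integrable_on S"
    using eq by (intro absolutely_integrable_spike_eq[OF Z]) auto
  then show iff: "d absolutely_integrable_on S \<longleftrightarrow> set_integrable lborel S g"
    using set_integral_lebesgue_eq_lborel(1)[OF g S] by simp
  assume gi: "set_integrable lborel S g"
  then have "(LINT x:S|lebesgue. d x) = integral S d"
    using iff by (intro set_lebesgue_integral_eq_integral) auto
  also have "\<dots> = integral S g" using eq by (intro integral_spike[OF Z]) auto
  also have "\<dots> = (LINT x:S|lebesgue. g x)"
    using gi set_integral_lebesgue_eq_lborel(1)[OF g S] by (intro set_lebesgue_integral_eq_integral(2)[symmetric]) auto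
  finally show "(LINT x:S|lebesgue. d x) = (LINT x:S|lborel. g x)"
    using set_integral_lebesgue_eq_lborel(2)[OF g S] by simp
qed

lemma nn_integral_periodic_shift:
  fixes p :: "real \<Rightarrow> ennreal"
  assumes L: "0 < L" and [measurable]: "p \<in> borel_measurable borel" and per: "\<And>x. p (x + L) = p x"
  shows "(\<integral>\<^sup>+x\<in>{a..a + L}. p x \<partial>lborel) = (\<integral>\<^sup>+x\<in>{0..L}. p x \<partial>lborel)"
proof -
  define I where "I u v = (\<integral>\<^sup>+x\<in>{u..<v}. p x \<partial>lborel)" for u v
  interpret P: periodic_fun_simple p L by standard (rule per)
  have shift: "I (u + d) (v + d) = (\<integral>\<^sup>+x\<in>{u..<v}. p (x + d) \<partial>lborel)" for u v d
    unfolding I_def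
    by (subst nn_integral_real_affine[where c=1 and t=d])
       (auto simp: indicator_def algebra_simps intro!: nn_integral_cong)
  have shift_int: "I (u + of_int k * L) (v + of_int k * L) = I u v" for u v k
    unfolding shift by (simp add: P.plus_of_int I_def)
  have join: "I u w = I u v + I v w" if "u \<le> v" "v \<le> w" for u v w
  proof -
    have "I u w = (\<integral>\<^sup>+x\<in>{u..<v} \<union> {v..<w}. p x \<partial>lborel)"
      using that by (simp add: I_def ivl_disj_un_two(3))
    also have "\<dots> = I u v + I v w"
      unfolding I_def by (rule nn_integral_disjoint_pair) auto
    finally show ?thesis .
  qed
  have closed: "(\<integral>\<^sup>+x\<in>{u..v}. p x \<partial>lborel) = I u v" for u v
    unfolding I_def
    by (rule nn_integral_cong_AE) (use AE_lborel_singleton[of v] in \<open>auto simp: indicator_def elim!: eventually_mono\<close>)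
  define k where "k = \<lfloor>a / L\<rfloor>"
  define d where "d = a - of_int k * L"
  have "of_int k \<le> a / L" "a / L < of_int k + 1" unfolding k_def by linarith+
  then have "of_int k * L \<le> a" "a < (of_int k + 1) * L"
    using L by (simp_all add: pos_le_divide_eq pos_divide_less_eq)
  then have d: "0 \<le> d" "d \<le> L" by (simp_all add: d_def algebra_simps)
  have "I a (a + L) = I d (d + L)"
    using shift_int[of d k "d + L"] by (simp add: d_def algebra_simps)
  also have "\<dots> = I d L + I L (d + L)" using d by (intro join) auto
  also have "I L (d + L) = I 0 d" using shift_int[of 0 1 d] by simp
  also have "I d L + I 0 d = I 0 L" using join[of 0 d L] d by (simp add: add.commute)
  finally show ?thesis by (simp add: closed)
qed

text \<open>
  Transfers identities between integrals of nonnegative functions to real functions through the positive and negative parts.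
\<close>

lemma integrable_integral_eqI:
  fixes g :: "'c \<Rightarrow> real" and g' :: "'d \<Rightarrow> real"
  assumes [measurable]: "g \<in> borel_measurable M" "g' \<in> borel_measurable M'"
    and pos: "(\<integral>\<^sup>+x. ennreal (g x) \<partial>M) = (\<integral>\<^sup>+x. ennreal (g' x) \<partial>M')"
    and neg: "(\<integral>\<^sup>+x. ennreal (- g x) \<partial>M) = (\<integral>\<^sup>+x. ennreal (- g' x) \<partial>M')"
  shows "integrable M g \<longleftrightarrow> integrable M' g'" "integral\<^sup>L M g = integral\<^sup>L M' g'"
proof -
  show iff: "integrable M g \<longleftrightarrow> integrable M' g'"
    using pos neg by (simp add: real_integrable_def)
  show "integral\<^sup>L M g = integral\<^sup>L M' g'"
  proof (cases "integrable M g")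
    case True
    then show ?thesis using iff pos neg by (simp add: real_lebesgue_integral_def)
  next
    case False
    then show ?thesis using iff by (simp add: not_integrable_integral_eq)
  qed
qed

lemma nn_integral_periodic_translate:
  fixes p :: "real \<Rightarrow> ennreal"
  assumes L: "0 < L" and [measurable]: "p \<in> borel_measurable borel" and per: "\<And>x. p (x + L) = p x"
  shows "(\<integral>\<^sup>+x\<in>{0..L}. p (x + a) \<partial>lborel) = (\<integral>\<^sup>+x\<in>{0..L}. p x \<partial>lborel)"
proof -
  have "(\<integral>\<^sup>+x\<in>{0..L}. p (x + a) \<partial>lborel) = (\<integral>\<^sup>+x\<in>{a..a + L}. p x \<partial>lborel)"
    by (subst nn_integral_real_affine[where c=1 and t="- a"])
       (auto simp: indicator_def intro!: nn_integral_cong)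
  then show ?thesis using nn_integral_periodic_shift[OF assms] by simp
qed

lemma integral_periodic_shift:
  fixes p :: "real \<Rightarrow> real"
  assumes L: "0 < L" and [measurable]: "p \<in> borel_measurable borel" and per: "\<And>x. p (x + L) = p x"
  shows "(LINT x:{0..L}|lborel. p (x + a)) = (LINT x:{0..L}|lborel. p x)"
  unfolding set_lebesgue_integral_def
proof (rule integrable_integral_eqI(2))
  have *: "(\<integral>\<^sup>+x. ennreal (indicator {0..L} x * q (x + a)) \<partial>lborel) = (\<integral>\<^sup>+x. ennreal (indicator {0..L} x * q x) \<partial>lborel)"
    if [measurable]: "q \<in> borel_measurable borel" and per: "\<And>x. q (x + L) = q x" for q :: "real \<Rightarrow> real"
  proof -
    have "(\<integral>\<^sup>+x. ennreal (indicator {0..L} x * q (x + a)) \<partial>lborel) = (\<integral>\<^sup>+x\<in>{0..L}. ennreal (q (x + a)) \<partial>lborel)"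
      by (auto simp: indicator_def intro!: nn_integral_cong)
    also have "\<dots> = (\<integral>\<^sup>+x\<in>{0..L}. ennreal (q x) \<partial>lborel)"
      by (rule nn_integral_periodic_translate[OF L]) (auto simp: per)
    also have "\<dots> = (\<integral>\<^sup>+x. ennreal (indicator {0..L} x * q x) \<partial>lborel)"
      by (auto simp: indicator_def intro!: nn_integral_cong)
    finally show ?thesis .
  qed
  show "(\<integral>\<^sup>+x. ennreal (indicator {0..L} x *\<^sub>R p (x + a)) \<partial>lborel) = (\<integral>\<^sup>+x. ennreal (indicator {0..L} x *\<^sub>R p x) \<partial>lborel)"
    using *[of p] per by simp
  show "(\<integral>\<^sup>+x. ennreal (- (indicator {0..L} x *\<^sub>R p (x + a))) \<partial>lborel) = (\<integral>\<^sup>+x. ennreal (- (indicator {0..L} x *\<^sub>R p x)) \<partial>lborel)"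
    using *[of "\<lambda>x. - p x"] per by simp
qed auto

lemma shear_measurable: "(\<lambda>p::real \<times> real. (fst p, fst p + snd p)) \<in> borel_measurable borel"
  by (intro borel_measurable_continuous_onI continuous_intros)

text \<open>
  For fixed \<open>s\<close> the period \<open>{0..L}\<close> in \<open>t\<close> is exchanged for the period centred at \<open>s\<close>; in the new coordinate
  \<open>h = t - s\<close> the circle distance is \<open>|h|\<close>.
\<close>

lemma nn_integral_rotate_square:
  fixes g :: "real \<times> real \<Rightarrow> ennreal"
  assumes L: "0 < L" and [measurable]: "g \<in> borel_measurable borel" and per: "\<And>s t. g (s, t + L) = g (s, t)"
  shows "(\<integral>\<^sup>+p\<in>{0..L} \<times> {0..L}. g p \<partial>lborel)
    = (\<integral>\<^sup>+p\<in>{0..L} \<times> {- (L / 2)..L / 2}. g (fst p, fst p + snd p) \<partial>lborel)"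
proof -
  have [measurable]: "g \<in> borel_measurable (borel \<Otimes>\<^sub>M borel)" by (simp add: borel_prod)
  have gs: "(\<lambda>p. g (fst p, fst p + snd p)) \<in> borel_measurable borel"
    using measurable_compose[OF shear_measurable assms(2)] by simp
  have B: "{0..L} \<times> {- (L / 2)..L / 2} \<in> sets borel" by (auto intro!: borel_closed closed_Times)
  have "(\<integral>\<^sup>+p\<in>{0..L} \<times> {0..L}. g p \<partial>lborel)
      = (\<integral>\<^sup>+p. g p * indicator ({0..L} \<times> {0..L}) p \<partial>(lborel \<Otimes>\<^sub>M lborel))"
    by (simp add: lborel_prod)
  also have "\<dots> = (\<integral>\<^sup>+s. \<integral>\<^sup>+t. g (s, t) * indicator ({0..L} \<times> {0..L}) (s, t) \<partial>lborel \<partial>lborel)"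
    by (rule lborel.nn_integral_fst[symmetric]) measurable
  also have "\<dots> = (\<integral>\<^sup>+s. \<integral>\<^sup>+h. g (s, s + h) * indicator ({0..L} \<times> {- (L / 2)..L / 2}) (s, h) \<partial>lborel \<partial>lborel)"
  proof (rule nn_integral_cong)
    fix s :: real
    have "(\<integral>\<^sup>+t. g (s, t) * indicator ({0..L} \<times> {0..L}) (s, t) \<partial>lborel)
       = (\<integral>\<^sup>+t. indicator {0..L} s * (g (s, t) * indicator {0..L} t) \<partial>lborel)"
      by (rule nn_integral_cong) (auto simp: indicator_def)
    also have "\<dots> = indicator {0..L} s * (\<integral>\<^sup>+t\<in>{0..L}. g (s, t) \<partial>lborel)"
      by (rule nn_integral_cmult) measurable
    also have "(\<integral>\<^sup>+t\<in>{0..L}. g (s, t) \<partial>lborel) = (\<integral>\<^sup>+t\<in>{s - L / 2..s - L / 2 + L}. g (s, t) \<partial>lborel)"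
      by (rule nn_integral_periodic_shift[OF L, symmetric]) (auto simp: per)
    also have "\<dots> = (\<integral>\<^sup>+h\<in>{- (L / 2)..L / 2}. g (s, s + h) \<partial>lborel)"
      by (subst nn_integral_real_affine[where c=1 and t=s])
         (auto simp: indicator_def field_simps intro!: nn_integral_cong)
    also have "indicator {0..L} s * \<dots> = (\<integral>\<^sup>+h. indicator {0..L} s * (g (s, s + h) * indicator {- (L / 2)..L / 2} h) \<partial>lborel)"
      by (rule nn_integral_cmult[symmetric]) measurable
    also have "\<dots> = (\<integral>\<^sup>+h. g (s, s + h) * indicator ({0..L} \<times> {- (L / 2)..L / 2}) (s, h) \<partial>lborel)"
      by (rule nn_integral_cong) (auto simp: indicator_def)
    finally show "(\<integral>\<^sup>+t. g (s, t) * indicator ({0..L} \<times> {0..L}) (s, t) \<partial>lborel)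
       = (\<integral>\<^sup>+h. g (s, s + h) * indicator ({0..L} \<times> {- (L / 2)..L / 2}) (s, h) \<partial>lborel)" .
  qed
  also have "\<dots> = (\<integral>\<^sup>+p. g (fst p, fst p + snd p) * indicator ({0..L} \<times> {- (L / 2)..L / 2}) p \<partial>(lborel \<Otimes>\<^sub>M lborel))"
    using gs B by (subst lborel.nn_integral_fst[symmetric])
      (auto intro!: borel_measurable_times_ennreal borel_measurable_indicator simp: lborel_prod)
  finally show ?thesis by (simp add: lborel_prod)
qed

lemma integral_rotate_square:
  fixes g :: "real \<times> real \<Rightarrow> real"
  assumes L: "0 < L" and [measurable]: "g \<in> borel_measurable borel" and per: "\<And>s t. g (s, t + L) = g (s, t)"
  shows "set_integrable lborel ({0..L} \<times> {0..L}) g \<longleftrightarrow>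
      set_integrable lborel ({0..L} \<times> {- (L / 2)..L / 2}) (\<lambda>p. g (fst p, fst p + snd p))"
    and "(LINT p:({0..L} \<times> {0..L})|lborel. g p) =
      (LINT p:({0..L} \<times> {- (L / 2)..L / 2})|lborel. g (fst p, fst p + snd p))"
proof -
  let ?A = "{0..L} \<times> {0..L}" and ?B = "{0..L} \<times> {- (L / 2)..L / 2}"
  have [measurable]: "?A \<in> sets borel" "?B \<in> sets borel" by (auto intro!: borel_closed closed_Times)
  have *: "(\<integral>\<^sup>+p. ennreal (indicator ?A p * q p) \<partial>lborel)
      = (\<integral>\<^sup>+p. ennreal (indicator ?B p * q (fst p, fst p + snd p)) \<partial>lborel)"
    if [measurable]: "q \<in> borel_measurable borel" and per: "\<And>s t. q (s, t + L) = q (s, t)" for q :: "real \<times> real \<Rightarrow> real"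
  proof -
    have "(\<integral>\<^sup>+p. ennreal (indicator ?A p * q p) \<partial>lborel) = (\<integral>\<^sup>+p\<in>?A. ennreal (q p) \<partial>lborel)"
      by (auto simp: indicator_def intro!: nn_integral_cong)
    also have "\<dots> = (\<integral>\<^sup>+p\<in>?B. ennreal (q (fst p, fst p + snd p)) \<partial>lborel)"
      using that(1) by (intro nn_integral_rotate_square[OF L]) (auto simp: per)
    also have "\<dots> = (\<integral>\<^sup>+p. ennreal (indicator ?B p * q (fst p, fst p + snd p)) \<partial>lborel)"
      by (auto simp: indicator_def intro!: nn_integral_cong)
    finally show ?thesis .
  qed
  have m: "(\<lambda>p. indicator ?A p *\<^sub>R g p) \<in> borel_measurable lborel"
    "(\<lambda>p. indicator ?B p *\<^sub>R g (fst p, fst p + snd p)) \<in> borel_measurable lborel"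
    using measurable_compose[OF shear_measurable assms(2)]
    by (auto intro!: borel_measurable_times borel_measurable_indicator)
  have 1: "(\<integral>\<^sup>+p. ennreal (indicator ?A p *\<^sub>R g p) \<partial>lborel)
      = (\<integral>\<^sup>+p. ennreal (indicator ?B p *\<^sub>R g (fst p, fst p + snd p)) \<partial>lborel)"
    using *[of g] per by simp
  have 2: "(\<integral>\<^sup>+p. ennreal (- (indicator ?A p *\<^sub>R g p)) \<partial>lborel)
      = (\<integral>\<^sup>+p. ennreal (- (indicator ?B p *\<^sub>R g (fst p, fst p + snd p))) \<partial>lborel)"
    using *[of "\<lambda>p. - g p"] per by simp
  show "set_integrable lborel ?A g \<longleftrightarrow> set_integrable lborel ?B (\<lambda>p. g (fst p, fst p + snd p))"
    unfolding set_integrable_def by (rule integrable_integral_eqI(1)[OF m 1 2])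
  show "(LINT p:?A|lborel. g p) = (LINT p:?B|lborel. g (fst p, fst p + snd p))"
    unfolding set_lebesgue_integral_def by (rule integrable_integral_eqI(2)[OF m 1 2])
qed

lemma integral_rotate_square_cong:
  fixes g e :: "real \<times> real \<Rightarrow> real"
  assumes L: "0 < L" and g: "g \<in> borel_measurable borel" and per: "\<And>s t. g (s, t + L) = g (s, t)"
    and eq: "\<And>s h. \<bar>h\<bar> \<le> L / 2 \<Longrightarrow> g (s, s + h) = e (s, h)"
  shows "set_integrable lborel ({0..L} \<times> {0..L}) g \<longleftrightarrow> set_integrable lborel ({0..L} \<times> {- (L / 2)..L / 2}) e"
    and "(LINT p:({0..L} \<times> {0..L})|lborel. g p) = (LINT p:({0..L} \<times> {- (L / 2)..L / 2})|lborel. e p)"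
proof -
  have *: "g (fst p, fst p + snd p) = e p" if "p \<in> {0..L} \<times> {- (L / 2)..L / 2}" for p
    using eq[of "snd p" "fst p"] that by (auto simp: abs_le_iff)
  have B: "{0..L} \<times> {- (L / 2)..L / 2} \<in> sets lborel" by (auto intro!: borel_closed closed_Times)
  show "set_integrable lborel ({0..L} \<times> {0..L}) g \<longleftrightarrow> set_integrable lborel ({0..L} \<times> {- (L / 2)..L / 2}) e"
    unfolding integral_rotate_square(1)[OF L g per] by (rule set_integrable_cong[OF refl refl *])
  show "(LINT p:({0..L} \<times> {0..L})|lborel. g p) = (LINT p:({0..L} \<times> {- (L / 2)..L / 2})|lborel. e p)"
    unfolding integral_rotate_square(2)[OF L g per] by (rule set_lebesgue_integral_cong[OF B]) (use * in blast)
qed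

section \<open>Absolute convergence of the two parts\<close>

context decreasing_kernel
begin

lemma nn_integral_tail: "0 < k \<Longrightarrow> (\<integral>\<^sup>+h\<in>{k..}. ennreal (b h) \<partial>lborel) = ennreal (F k)"
proof -
  assume k: "0 < k"
  have "(\<integral>\<^sup>+h\<in>{k..}. ennreal (b h) \<partial>lborel) = (\<integral>\<^sup>+h. ennreal (indicator {k..} h *\<^sub>R b h) \<partial>lborel)"
    by (rule nn_integral_cong) (auto simp: indicator_def)
  also have "\<dots> = ennreal (\<integral>h. indicator {k..} h *\<^sub>R b h \<partial>lborel)"
    using b_integrable[OF k] by (intro nn_integral_eq_integral) (auto simp: set_integrable_def b_nonneg)
  finally show ?thesis using k by (simp add: F_def set_lebesgue_integral_def)
qed

text \<open>
  Exchanging the order of integration leaves \<open>\<integral>\<^sub>k\<^sup>a b(h)/h dh \<le> F(k)/k\<close>, which the hypothesis bounds by \<open>b(k)\<close>.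
\<close>

lemma Hardy_type_inequality:
  fixes q :: "real \<Rightarrow> ennreal"
  assumes [measurable]: "q \<in> borel_measurable borel"
    and H: "\<And>x. 0 < x \<Longrightarrow> x \<le> a \<Longrightarrow> F x / x \<le> b x"
  shows "(\<integral>\<^sup>+h\<in>{0<..a}. ennreal (b h / h) * (\<integral>\<^sup>+k\<in>{0<..h}. q k \<partial>lborel) \<partial>lborel)
    \<le> (\<integral>\<^sup>+k\<in>{0<..a}. q k * ennreal (b k) \<partial>lborel)"
proof -
  let ?m = "\<lambda>k h. if 0 < k \<and> k \<le> h \<and> h \<le> a then ennreal (b h / h) * q k else 0"
  have [measurable]: "(\<lambda>p. fst p \<le> (snd p :: real)) \<in> measurable (borel \<Otimes>\<^sub>M borel) (count_space UNIV)"
    by measurable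
  have "(\<integral>\<^sup>+h\<in>{0<..a}. ennreal (b h / h) * (\<integral>\<^sup>+k\<in>{0<..h}. q k \<partial>lborel) \<partial>lborel)
      = (\<integral>\<^sup>+h. \<integral>\<^sup>+k. ?m k h \<partial>lborel \<partial>lborel)"
  proof (rule nn_integral_cong)
    fix h :: real
    show "ennreal (b h / h) * (\<integral>\<^sup>+k\<in>{0<..h}. q k \<partial>lborel) * indicator {0<..a} h =
        (\<integral>\<^sup>+k. ?m k h \<partial>lborel)"
    proof (cases "0 < h \<and> h \<le> a")
      case True
      then have "ennreal (b h / h) * (\<integral>\<^sup>+k\<in>{0<..h}. q k \<partial>lborel) * indicator {0<..a} h =
         (\<integral>\<^sup>+k. ennreal (b h / h) * (q k * indicator {0<..h} k) \<partial>lborel)"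
        by (simp add: nn_integral_cmult)
      also have "\<dots> = (\<integral>\<^sup>+k. ?m k h \<partial>lborel)"
        by (rule nn_integral_cong) (use True in \<open>auto simp: indicator_def\<close>)
      finally show ?thesis .
    next
      case False
      then have "(\<lambda>k. ?m k h) = (\<lambda>k. 0)" by auto
      then show ?thesis using False by (simp add: indicator_def)
    qed
  qed
  also have "\<dots> = (\<integral>\<^sup>+k. \<integral>\<^sup>+h. ?m k h \<partial>lborel \<partial>lborel)"
    by (rule lborel_pair.Fubini') measurable
  also have "\<dots> \<le> (\<integral>\<^sup>+k\<in>{0<..a}. q k * ennreal (b k) \<partial>lborel)"
  proof (rule nn_integral_mono)
    fix k :: real
    show "(\<integral>\<^sup>+h. ?m k h \<partial>lborel)
        \<le> q k * ennreal (b k) * indicator {0<..a} k"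
    proof (cases "0 < k \<and> k \<le> a")
      case True
      have "(\<integral>\<^sup>+h. ?m k h \<partial>lborel)
        \<le> (\<integral>\<^sup>+h. q k * (ennreal (1 / k) * (ennreal (b h) * indicator {k..} h)) \<partial>lborel)"
      proof (rule nn_integral_mono)
        fix h :: real
        have "ennreal (b h / h) \<le> ennreal (1 / k) * ennreal (b h)" if "k \<le> h"
        proof -
          have "b h / h \<le> b h / k" using True that b_nonneg by (intro divide_left_mono) auto
          then have "b h / h \<le> 1 / k * b h" by simp
          then show ?thesis using True by (subst ennreal_mult[symmetric]) (auto simp: b_nonneg intro: ennreal_leI)
        qed
        then show "?m k h \<le>
            q k * (ennreal (1 / k) * (ennreal (b h) * indicator {k..} h))"
          by (auto simp: indicator_def mult.commute intro: mult_left_mono)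
      qed
      also have "\<dots> = q k * (ennreal (1 / k) * ennreal (F k))"
        using True by (simp add: nn_integral_cmult nn_integral_tail)
      also have "\<dots> \<le> q k * ennreal (b k)"
        using H[of k] True F_nonneg by (subst ennreal_mult[symmetric]) (auto intro!: mult_left_mono ennreal_leI)
      finally show ?thesis using True by simp
    next
      case False
      then have "(\<lambda>h. ?m k h) = (\<lambda>h. 0)" by auto
      then show ?thesis by simp
    qed
  qed
  finally show ?thesis .
qed

end

lemma nn_integral_symmetric_interval:
  fixes w :: "real \<Rightarrow> ennreal"
  assumes [measurable]: "w \<in> borel_measurable borel" and a: "0 < a"
  shows "(\<integral>\<^sup>+h\<in>{-a..a}. w h \<partial>lborel)
    = (\<integral>\<^sup>+h\<in>{0<..a}. w h \<partial>lborel) + (\<integral>\<^sup>+h\<in>{0<..a}. w (- h) \<partial>lborel)"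
proof -
  have "(\<integral>\<^sup>+h\<in>{-a..a}. w h \<partial>lborel) = (\<integral>\<^sup>+h\<in>{0<..a} \<union> {-a..<0}. w h \<partial>lborel)"
    by (rule nn_integral_cong_AE)
       (use AE_lborel_singleton[of 0] a in \<open>auto simp: indicator_def elim!: eventually_mono\<close>)
  also have "\<dots> = (\<integral>\<^sup>+h\<in>{0<..a}. w h \<partial>lborel) + (\<integral>\<^sup>+h\<in>{-a..<0}. w h \<partial>lborel)"
    by (rule nn_integral_disjoint_pair) auto
  also have "(\<integral>\<^sup>+h\<in>{-a..<0}. w h \<partial>lborel) = (\<integral>\<^sup>+h\<in>{0<..a}. w (- h) \<partial>lborel)"
    by (subst nn_integral_real_affine[where c="-1" and t=0])
       (auto simp: indicator_def intro!: nn_integral_cong)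
  finally show ?thesis .
qed

context unit_speed_loop
begin

text \<open>
  The squared length of the component of \<open>T s\<close> orthogonal to the chord from \<open>f s\<close> to \<open>f (s + h)\<close>.
\<close>

definition P where "P s h = 1 - (T s \<bullet> sgn (f s - f (s + h)))\<^sup>2"

definition q where "q s h = (norm (T s - T (s + h)))\<^sup>2"

lemma inner_unit_sgn_le: "\<bar>T s \<bullet> sgn x\<bar> \<le> 1"
proof -
  have "\<bar>T s \<bullet> sgn x\<bar> \<le> norm (T s) * norm (sgn x)" by (rule Cauchy_Schwarz_ineq2)
  then show ?thesis using T_unit by (auto simp: norm_sgn split: if_splits)
qed

lemma P_nonneg: "0 \<le> P s h"
  using abs_square_le_1[THEN iffD2, OF inner_unit_sgn_le] by (simp add: P_def)

lemma q_eq: "q s h = 2 - 2 * (T s \<bullet> T (s + h))"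
proof -
  have "q s h = (norm (T s))\<^sup>2 + (norm (T (s + h)))\<^sup>2 - 2 * (T s \<bullet> T (s + h))"
    unfolding q_def power2_norm_eq_inner by (simp add: inner_diff inner_commute)
  then show ?thesis using T_unit by simp
qed

lemma q_borel [measurable]: "q s \<in> borel_measurable borel"
  unfolding q_def[abs_def] by measurable

lemma P_borel [measurable]: "P s \<in> borel_measurable borel"
  unfolding P_def[abs_def] by measurable

lemma q_nonneg: "0 \<le> q s h"
  by (simp add: q_def)

lemma q_has_integral:
  assumes "\<sigma> = 1 \<or> \<sigma> = -1" and h: "0 \<le> h"
  shows "((\<lambda>k. q s (\<sigma> * k)) has_integral (2 * h - 2 * (\<sigma> * (T s \<bullet> (f (s + \<sigma> * h) - f s))))) {0..h}"
proof -
  have 1: "((\<lambda>k. T (s + \<sigma> * k)) has_integral (\<sigma> *\<^sub>R (f (s + \<sigma> * h) - f s))) {0..h}"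
    using assms(1)
  proof
    assume [simp]: "\<sigma> = 1"
    have "((\<lambda>k. T (1 *\<^sub>R k + s)) has_integral (f (s + h) - f s)) ((\<lambda>x. x - s) ` {s..s + h})"
      using has_integral_affinity[of T "f (s + h) - f s" s "s + h" 1 s] T_integral[of s "s + h"] h by simp
    then show ?thesis by (simp add: add.commute)
  next
    assume [simp]: "\<sigma> = -1"
    have "((\<lambda>k. T (-1 *\<^sub>R k + s)) has_integral (f s - f (s - h))) {0..h}"
      using has_integral_affinity[of T "f s - f (s - h)" "s - h" s "-1" s] T_integral[of "s - h" s] h by simp
    then show ?thesis by simp
  qed
  have "((\<lambda>k. T s \<bullet> T (s + \<sigma> * k)) has_integral (T s \<bullet> (\<sigma> *\<^sub>R (f (s + \<sigma> * h) - f s)))) {0..h}"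
    using has_integral_linear[OF 1 bounded_linear_inner_right[of "T s"]] by (simp add: o_def)
  then have "((\<lambda>k. 2 - 2 * (T s \<bullet> T (s + \<sigma> * k))) has_integral
      (2 * h - 2 * (T s \<bullet> (\<sigma> *\<^sub>R (f (s + \<sigma> * h) - f s))))) {0..h}"
    using has_integral_const_real[of "2::real" 0 h] h
    by (intro has_integral_diff has_integral_mult_right) (auto simp: mult.commute)
  then show ?thesis by (simp add: q_eq)
qed

text \<open>
  Let \<open>m\<close> be the mean of \<open>T s \<bullet> T\<close> over the arc, that is, \<open>T s\<close> times the chord divided by \<open>h\<close>. The chord is no
  longer than \<open>h\<close>, hence \<open>P \<le> 1 - m\<^sup>2 \<le> 2 - 2 m\<close>, and \<open>2 - 2 m\<close> is the mean of \<open>q\<close>. The sign \<open>\<sigma>\<close> covers the arcs on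
  both sides of \<open>s\<close>.
\<close>

lemma P_le_mean_q:
  assumes \<sigma>: "\<sigma> = 1 \<or> \<sigma> = -1" and h: "0 < h"
  shows "ennreal (P s (\<sigma> * h)) \<le> ennreal (1 / h) * (\<integral>\<^sup>+k\<in>{0<..h}. ennreal (q s (\<sigma> * k)) \<partial>lborel)"
proof -
  let ?I = "2 * h - 2 * (\<sigma> * (T s \<bullet> (f (s + \<sigma> * h) - f s)))"
  define x where "x = f s - f (s + \<sigma> * h)"
  define m where "m = \<sigma> * (T s \<bullet> (f (s + \<sigma> * h) - f s)) / h"
  have xh: "norm x \<le> h" using f_lip[of s "s + \<sigma> * h"] \<sigma> h by (auto simp: x_def)
  have absm: "\<bar>m\<bar> = \<bar>T s \<bullet> x\<bar> / h"
  proof -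
    have "T s \<bullet> (f (s + \<sigma> * h) - f s) = - (T s \<bullet> x)" by (simp add: x_def inner_diff_right)
    then show ?thesis using \<sigma> h by (auto simp: m_def abs_mult)
  qed
  have "\<bar>m\<bar> \<le> \<bar>T s \<bullet> sgn x\<bar>"
  proof (cases "x = 0")
    case False
    have "\<bar>T s \<bullet> x\<bar> / h \<le> \<bar>T s \<bullet> x\<bar> / norm x"
      using xh False by (intro divide_left_mono) (auto intro: mult_pos_pos h)
    then show ?thesis by (simp add: absm sgn_div_norm abs_mult divide_inverse mult.commute)
  qed (simp add: absm)
  then have "m\<^sup>2 \<le> (T s \<bullet> sgn x)\<^sup>2" by (rule abs_le_square_iff[THEN iffD1])
  then have "P s (\<sigma> * h) \<le> 1 - m\<^sup>2" by (simp add: P_def x_def)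
  also have "\<dots> \<le> 2 - 2 * m"
    using zero_le_power2[of "1 - m"] by (simp add: power2_diff)
  also have "2 - 2 * m = 1 / h * ?I"
    using h by (simp add: m_def field_simps)
  finally have "ennreal (P s (\<sigma> * h)) \<le> ennreal (1 / h * ?I)"
    by (rule ennreal_leI)
  also have "\<dots> = ennreal (1 / h) * ennreal ?I"
    using h by (subst ennreal_mult') auto
  also have "ennreal ?I
      = (\<integral>\<^sup>+k. ennreal (q s (\<sigma> * k)) * indicator {0..h} k \<partial>lborel)"
  proof -
    have "((\<lambda>k. q s (\<sigma> * k)) has_integral ?I) {0..h}"
      using q_has_integral[OF \<sigma>] h by simp
    from nn_integral_has_integral_lebesgue'[OF _ this] show ?thesis
      by (auto simp: q_nonneg mult.commute)
  qed
  also have "\<dots> = (\<integral>\<^sup>+k\<in>{0<..h}. ennreal (q s (\<sigma> * k)) \<partial>lborel)"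
    by (rule nn_integral_cong_AE)
       (use AE_lborel_singleton[of 0] in \<open>auto simp: indicator_def elim!: eventually_mono\<close>)
  finally show ?thesis .
qed

end

context loop_with_kernel
begin

lemma P_integral_le_slice:
  assumes a: "0 < a" and H: "\<And>x. 0 < x \<Longrightarrow> x \<le> a \<Longrightarrow> F x / x \<le> b x"
  shows "(\<integral>\<^sup>+h\<in>{-a..a}. ennreal (P s h * b \<bar>h\<bar>) \<partial>lborel) \<le> (\<integral>\<^sup>+h\<in>{-a..a}. ennreal (q s h * b \<bar>h\<bar>) \<partial>lborel)"
proof -
  have half: "(\<integral>\<^sup>+h\<in>{0<..a}. ennreal (P s (\<sigma> * h) * b \<bar>\<sigma> * h\<bar>) \<partial>lborel)
     \<le> (\<integral>\<^sup>+h\<in>{0<..a}. ennreal (q s (\<sigma> * h) * b \<bar>\<sigma> * h\<bar>) \<partial>lborel)" if \<sigma>: "\<sigma> = 1 \<or> \<sigma> = -1" for \<sigma>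
  proof -
    have abs: "\<bar>\<sigma> * h\<bar> = h" if "0 < h" for h using \<sigma> that by auto
    have "(\<integral>\<^sup>+h\<in>{0<..a}. ennreal (P s (\<sigma> * h) * b \<bar>\<sigma> * h\<bar>) \<partial>lborel)
       \<le> (\<integral>\<^sup>+h\<in>{0<..a}. ennreal (b h / h) * (\<integral>\<^sup>+k\<in>{0<..h}. ennreal (q s (\<sigma> * k)) \<partial>lborel) \<partial>lborel)"
    proof (rule nn_integral_mono)
      fix h
      show "ennreal (P s (\<sigma> * h) * b \<bar>\<sigma> * h\<bar>) * indicator {0<..a} h \<le>
        ennreal (b h / h) * (\<integral>\<^sup>+k\<in>{0<..h}. ennreal (q s (\<sigma> * k)) \<partial>lborel) * indicator {0<..a} h"
      proof (cases "h \<in> {0<..a}")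
        case True
        then have h: "0 < h" by simp
        have "ennreal (P s (\<sigma> * h) * b h) = ennreal (b h) * ennreal (P s (\<sigma> * h))"
          by (subst ennreal_mult[symmetric]) (auto simp: b_nonneg P_nonneg mult.commute)
        also have "\<dots> \<le> ennreal (b h) * (ennreal (1 / h) * (\<integral>\<^sup>+k\<in>{0<..h}. ennreal (q s (\<sigma> * k)) \<partial>lborel))"
          by (intro mult_left_mono P_le_mean_q[OF \<sigma> h]) auto
        also have "\<dots> = ennreal (b h / h) * (\<integral>\<^sup>+k\<in>{0<..h}. ennreal (q s (\<sigma> * k)) \<partial>lborel)"
          using h by (simp add: ennreal_mult[symmetric] b_nonneg mult.assoc[symmetric])
        finally show ?thesis using True abs[OF h] by simp
      qed simp
    qed
    also have "\<dots> \<le> (\<integral>\<^sup>+k\<in>{0<..a}. ennreal (q s (\<sigma> * k)) * ennreal (b k) \<partial>lborel)"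
      by (rule Hardy_type_inequality[OF _ H]) auto
    also have "\<dots> = (\<integral>\<^sup>+h\<in>{0<..a}. ennreal (q s (\<sigma> * h) * b \<bar>\<sigma> * h\<bar>) \<partial>lborel)"
      by (rule nn_integral_cong) (auto simp: indicator_def abs ennreal_mult q_nonneg b_nonneg)
    finally show ?thesis .
  qed
  show ?thesis
    using add_mono[OF half[of 1] half[of "-1"]]
    by (simp add: nn_integral_symmetric_interval[OF _ a])
qed

end

text \<open>
  The hypotheses in rotated coordinates: \<open>bilip\<close> is the bi-Lipschitz bound, \<open>comparison\<close> results from it
  by monotonicity and doubling of \<open>\<Phi>\<close>, \<open>tail_le\<close> is \<open>1/\<Phi> + \<Lambda> \<ge> 0\<close>, and \<open>seminorm\<close> is membership in \<open>W\<^sub>\<Phi>\<close>.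
\<close>

locale energy_setting = loop_with_kernel L f T N b
  for L :: real and f T :: "real \<Rightarrow> 'a::euclidean_space" and N b +
  fixes c C :: real
  assumes c_pos: "0 < c"
    and bilip: "\<bar>h\<bar> \<le> L / 2 \<Longrightarrow> c * \<bar>h\<bar> \<le> r s h"
    and comparison: "0 < \<bar>h\<bar> \<Longrightarrow> \<bar>h\<bar> \<le> L / 2 \<Longrightarrow> b (r s h) \<le> C * b \<bar>h\<bar>"
    and tail_le: "0 < x \<Longrightarrow> x \<le> L / 2 \<Longrightarrow> F x / x \<le> b x"
    and seminorm: "(\<integral>\<^sup>+p\<in>{0..L} \<times> {- (L / 2)..L / 2}. ennreal (q (fst p) (snd p) * b \<bar>snd p\<bar>) \<partial>lborel) < \<infinity>"
begin

abbreviation A where "A \<equiv> {0..L} \<times> {- (L / 2)..L / 2}"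

lemma A_sets [measurable]: "A \<in> sets borel"
  by (auto intro!: borel_closed closed_Times)

lemma r_le: "r s h \<le> \<bar>h\<bar>"
  using f_lip[of s "s + h"] by (simp add: r_def)

lemma r_pos: "h \<noteq> 0 \<Longrightarrow> \<bar>h\<bar> \<le> L / 2 \<Longrightarrow> 0 < r s h"
  using bilip[of h s] c_pos by (smt (verit) mult_pos_pos zero_less_abs_iff)

lemma r_0 [simp]: "r s 0 = 0"
  by (simp add: r_def)

lemma r_borel [measurable]: "(\<lambda>p. r (fst p) (snd p)) \<in> borel_measurable borel"
  unfolding r_def by measurable

lemma q_borel2 [measurable]: "(\<lambda>p. q (fst p) (snd p)) \<in> borel_measurable borel"
  unfolding q_def by measurable

lemma P_borel2 [measurable]: "(\<lambda>p. P (fst p) (snd p)) \<in> borel_measurable borel"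
  unfolding P_def by measurable

lemma P_swap_borel2 [measurable]: "(\<lambda>p. P (fst p + snd p) (- snd p)) \<in> borel_measurable borel"
  unfolding P_def by measurable

lemma nn_integral_A:
  assumes "g \<in> borel_measurable borel"
  shows "(\<integral>\<^sup>+p\<in>A. g p \<partial>lborel) = (\<integral>\<^sup>+s\<in>{0..L}. (\<integral>\<^sup>+h\<in>{- (L / 2)..L / 2}. g (s, h) \<partial>lborel) \<partial>lborel)"
    and "(\<integral>\<^sup>+p\<in>A. g p \<partial>lborel) = (\<integral>\<^sup>+h\<in>{- (L / 2)..L / 2}. (\<integral>\<^sup>+s\<in>{0..L}. g (s, h) \<partial>lborel) \<partial>lborel)"
proof -
  let ?A = "\<integral>\<^sup>+p\<in>A. g p \<partial>lborel"
  let ?P = "\<integral>\<^sup>+p. g p * indicator A p \<partial>(lborel \<Otimes>\<^sub>M lborel)"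
  let ?SH = "\<integral>\<^sup>+s\<in>{0..L}. (\<integral>\<^sup>+h\<in>{- (L / 2)..L / 2}. g (s, h) \<partial>lborel) \<partial>lborel"
  let ?HS = "\<integral>\<^sup>+h\<in>{- (L / 2)..L / 2}. (\<integral>\<^sup>+s\<in>{0..L}. g (s, h) \<partial>lborel) \<partial>lborel"
  have [measurable]: "g \<in> borel_measurable (borel \<Otimes>\<^sub>M borel)" using assms by (simp add: borel_prod)
  have gA: "(\<lambda>p. g p * indicator A p) \<in> borel_measurable (lborel \<Otimes>\<^sub>M lborel)"
    using assms by (simp add: lborel_prod)
  have 1: "?A = ?P"
    by (simp add: lborel_prod)
  have "?P = (\<integral>\<^sup>+s. \<integral>\<^sup>+h. g (s, h) * indicator A (s, h) \<partial>lborel \<partial>lborel)"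
    by (rule lborel.nn_integral_fst[symmetric, OF gA])
  also have "\<dots> = ?SH"
  proof (rule nn_integral_cong)
    fix s
    show "(\<integral>\<^sup>+h. g (s, h) * indicator A (s, h) \<partial>lborel) = (\<integral>\<^sup>+h\<in>{- (L / 2)..L / 2}. g (s, h) \<partial>lborel) * indicator {0..L} s"
      by (cases "s \<in> {0..L}") (auto simp: indicator_def intro!: nn_integral_cong)
  qed
  finally show "?A = ?SH"
    using 1 by simp
  have "?P = (\<integral>\<^sup>+h. \<integral>\<^sup>+s. g (s, h) * indicator A (s, h) \<partial>lborel \<partial>lborel)"
    by (rule lborel_pair.nn_integral_snd[symmetric, OF gA])
  also have "\<dots> = ?HS"
  proof (rule nn_integral_cong)
    fix h
    show "(\<integral>\<^sup>+s. g (s, h) * indicator A (s, h) \<partial>lborel) = (\<integral>\<^sup>+s\<in>{0..L}. g (s, h) \<partial>lborel) * indicator {- (L / 2)..L / 2} h"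
      by (cases "h \<in> {- (L / 2)..L / 2}") (auto simp: indicator_def intro!: nn_integral_cong)
  qed
  finally show "?A = ?HS"
    using 1 by simp
qed

lemma P_integral_le:
  "(\<integral>\<^sup>+p\<in>A. ennreal (P (fst p) (snd p) * b \<bar>snd p\<bar>) \<partial>lborel)
    \<le> (\<integral>\<^sup>+p\<in>A. ennreal (q (fst p) (snd p) * b \<bar>snd p\<bar>) \<partial>lborel)"
proof -
  have "(\<lambda>p. ennreal (P (fst p) (snd p) * b \<bar>snd p\<bar>)) \<in> borel_measurable borel"
    "(\<lambda>p. ennreal (q (fst p) (snd p) * b \<bar>snd p\<bar>)) \<in> borel_measurable borel" by measurable
  note A1 = nn_integral_A(1)[OF this(1)] and A2 = nn_integral_A(1)[OF this(2)]
  show ?thesis unfolding A1 A2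
  proof (rule nn_integral_mono, rule mult_right_mono)
    fix s
    show "(\<integral>\<^sup>+h\<in>{- (L / 2)..L / 2}. ennreal (P (fst (s, h)) (snd (s, h)) * b \<bar>snd (s, h)\<bar>) \<partial>lborel)
        \<le> (\<integral>\<^sup>+h\<in>{- (L / 2)..L / 2}. ennreal (q (fst (s, h)) (snd (s, h)) * b \<bar>snd (s, h)\<bar>) \<partial>lborel)"
      using P_integral_le_slice[of "L / 2" s] tail_le L_pos by simp
  qed simp
qed

text \<open>
  The component of the other tangent \<open>T (s + h)\<close> orthogonal to the chord is \<open>P (s + h) (- h)\<close>. Translating \<open>s\<close> by \<open>h\<close>
  over the circle and reflecting \<open>h\<close> exchanges the two.
\<close>

lemma P_swap_integral:
  "(\<integral>\<^sup>+p\<in>A. ennreal (P (fst p + snd p) (- snd p) * b \<bar>snd p\<bar>) \<partial>lborel)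
    = (\<integral>\<^sup>+p\<in>A. ennreal (P (fst p) (snd p) * b \<bar>snd p\<bar>) \<partial>lborel)"
proof -
  have m: "(\<lambda>p. ennreal (P (fst p + snd p) (- snd p) * b \<bar>snd p\<bar>)) \<in> borel_measurable borel"
    "(\<lambda>p. ennreal (P (fst p) (snd p) * b \<bar>snd p\<bar>)) \<in> borel_measurable borel" by measurable
  have per: "P (s + L) h = P s h" for s h
  proof -
    have "f (s + L + h) = f (s + h)" using f_per[of "s + h"] by (simp add: ac_simps)
    then show ?thesis by (simp only: P_def f_per T_per)
  qed
  have m1 [measurable]: "(\<lambda>s. P s h) \<in> borel_measurable borel" for h
    unfolding P_def by measurable
  have "(\<integral>\<^sup>+p\<in>A. ennreal (P (fst p + snd p) (- snd p) * b \<bar>snd p\<bar>) \<partial>lborel)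
     = (\<integral>\<^sup>+h\<in>{- (L / 2)..L / 2}. (\<integral>\<^sup>+s\<in>{0..L}. ennreal (P (s + h) (- h) * b \<bar>h\<bar>) \<partial>lborel) \<partial>lborel)"
    using nn_integral_A(2)[OF m(1)] by simp
  also have "\<dots> = (\<integral>\<^sup>+h\<in>{- (L / 2)..L / 2}. (\<integral>\<^sup>+s\<in>{0..L}. ennreal (P s (- h) * b \<bar>h\<bar>) \<partial>lborel) \<partial>lborel)"
    by (intro nn_integral_cong arg_cong2[where f="(*)"] refl nn_integral_periodic_translate[OF L_pos])
       (auto simp: per)
  also have "\<dots> = (\<integral>\<^sup>+h\<in>{- (L / 2)..L / 2}. (\<integral>\<^sup>+s\<in>{0..L}. ennreal (P s h * b \<bar>h\<bar>) \<partial>lborel) \<partial>lborel)"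
  proof -
    have "(\<lambda>p. ennreal (P (snd p) (fst p) * b \<bar>fst p\<bar>)) \<in> borel_measurable borel"
      unfolding P_def by measurable
    then have [measurable]: "(\<lambda>p. ennreal (P (snd p) (fst p) * b \<bar>fst p\<bar>)) \<in> borel_measurable (borel \<Otimes>\<^sub>M borel)"
      by (simp add: borel_prod)
    have "(\<lambda>h. \<integral>\<^sup>+s. (\<lambda>p. ennreal (P (snd p) (fst p) * b \<bar>fst p\<bar>)) (h, s) * indicator {0..L} s \<partial>lborel) \<in> borel_measurable borel"
      by measurable
    then have [measurable]: "(\<lambda>h. \<integral>\<^sup>+s\<in>{0..L}. ennreal (P s h * b \<bar>h\<bar>) \<partial>lborel) \<in> borel_measurable borel" by simp
    show ?thesis
      by (subst (2) nn_integral_real_affine[where c="-1" and t=0])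
         (auto simp: indicator_def intro!: nn_integral_cong)
  qed
  also have "\<dots> = (\<integral>\<^sup>+p\<in>A. ennreal (P (fst p) (snd p) * b \<bar>snd p\<bar>) \<partial>lborel)"
    using nn_integral_A(2)[OF m(2)] by simp
  finally show ?thesis .
qed

definition e1 where "e1 p = b (r (fst p) (snd p)) * q (fst p) (snd p) / 2"

text \<open>
  The wedge product term of \<open>\<E>\<^sub>2\<close>.
\<close>

definition W where "W s h = T s \<bullet> T (s + h)
  - (T s \<bullet> sgn (f s - f (s + h))) * (T (s + h) \<bullet> sgn (f s - f (s + h)))"

definition e2 where
  "e2 p = (b (r (fst p) (snd p)) + F (r (fst p) (snd p)) / r (fst p) (snd p)) * W (fst p) (snd p)"

lemma e1_borel [measurable]: "e1 \<in> borel_measurable borel"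
  unfolding e1_def[abs_def] by measurable

lemma e2_borel [measurable]: "e2 \<in> borel_measurable borel"
  unfolding e2_def[abs_def] W_def by measurable

lemma C_nonneg: "0 \<le> C"
proof -
  have "0 < b (L / 2)" "0 \<le> b (r 0 (L / 2))" using L_pos b_pos b_nonneg by auto
  then show ?thesis using comparison[of "L / 2" 0] L_pos by (smt (verit) abs_of_pos half_gt_zero mult_neg_pos)
qed

lemma e1_integrable: "set_integrable lborel A e1"
  unfolding set_integrable_def
proof (rule integrableI_bounded)
  have "(\<integral>\<^sup>+p. ennreal (norm (indicator A p *\<^sub>R e1 p)) \<partial>lborel)
      \<le> (\<integral>\<^sup>+p. ennreal (C / 2) * (ennreal (q (fst p) (snd p) * b \<bar>snd p\<bar>) * indicator A p) \<partial>lborel)"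
  proof (rule nn_integral_mono)
    fix p :: "real \<times> real"
    show "ennreal (norm (indicator A p *\<^sub>R e1 p)) \<le> ennreal (C / 2) * (ennreal (q (fst p) (snd p) * b \<bar>snd p\<bar>) * indicator A p)"
    proof (cases "p \<in> A")
      case True
      then have h: "\<bar>snd p\<bar> \<le> L / 2" by (auto simp: mem_Times_iff)
      have "norm (e1 p) \<le> C / 2 * (q (fst p) (snd p) * b \<bar>snd p\<bar>)"
      proof (cases "snd p = 0")
        case True
        then show ?thesis by (simp add: e1_def b_nonpos)
      next
        case False
        then have "b (r (fst p) (snd p)) * q (fst p) (snd p) \<le> (C * b \<bar>snd p\<bar>) * q (fst p) (snd p)"
          using h by (intro mult_right_mono comparison q_nonneg) auto
        then show ?thesis by (simp add: e1_def b_nonneg q_nonneg abs_mult mult_ac)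
      qed
      then show ?thesis using True C_nonneg by (simp add: ennreal_mult'[symmetric] ennreal_leI)
    qed simp
  qed
  also have "\<dots> = ennreal (C / 2) * (\<integral>\<^sup>+p\<in>A. ennreal (q (fst p) (snd p) * b \<bar>snd p\<bar>) \<partial>lborel)"
    by (rule nn_integral_cmult) measurable
  also have "\<dots> < \<infinity>" using seminorm by (simp add: ennreal_mult_less_top)
  finally show "(\<integral>\<^sup>+p. ennreal (norm (indicator A p *\<^sub>R e1 p)) \<partial>lborel) < \<infinity>" .
qed measurable

text \<open>
  With \<open>S\<close> the direction of the chord, \<open>W\<close> is the inner product of the components of the two tangents orthogonal to \<open>S\<close>.
\<close>

lemma W_bound:
  assumes "0 < r s h"
  shows "\<bar>W s h\<bar> \<le> (P s h + P (s + h) (- h)) / 2"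
proof -
  define S where "S = sgn (f s - f (s + h))"
  have S1: "norm S = 1" using assms by (auto simp: S_def r_def norm_sgn)
  have SS: "S \<bullet> S = 1" using S1 by (simp add: dot_square_norm)
  have TT: "T x \<bullet> T x = 1" for x using T_unit by (simp add: dot_square_norm)
  define u where "u = T s - (T s \<bullet> S) *\<^sub>R S"
  define v where "v = T (s + h) - (T (s + h) \<bullet> S) *\<^sub>R S"
  have "W s h = u \<bullet> v"
    unfolding W_def S_def[symmetric] u_def v_def using SS
    by (simp add: inner_diff inner_commute[of S "T s"] inner_commute[of S "T (s + h)"])
  moreover have "P s h = u \<bullet> u"
    unfolding P_def S_def[symmetric] u_def using SS TT
    by (simp add: inner_diff inner_commute[of S "T s"] inner_commute[of S "T (s + h)"] power2_eq_square)
  moreover have "P (s + h) (- h) = v \<bullet> v"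
  proof -
    have "sgn (f (s + h) - f (s + h + - h)) = - S"
    proof -
      have "s + h + - h = s" by simp
      then show ?thesis unfolding S_def by (metis minus_diff_eq sgn_minus)
    qed
    then show ?thesis
      unfolding P_def v_def using SS TT
      by (simp add: inner_diff inner_commute[of S "T s"] inner_commute[of S "T (s + h)"] power2_eq_square)
  qed
  moreover have "2 * \<bar>u \<bullet> v\<bar> \<le> u \<bullet> u + v \<bullet> v"
  proof -
    have "0 \<le> (u - v) \<bullet> (u - v)" "0 \<le> (u + v) \<bullet> (u + v)" by simp_all
    then show ?thesis by (simp add: inner_diff inner_add inner_commute[of v u] abs_le_iff)
  qed
  ultimately show ?thesis by simp
qed

text \<open>
  Both summands of the coefficient \<open>b(r) - \<Lambda>(r)\<close> are nonnegative, and \<open>tail_le\<close> bounds it by \<open>2 b(r)\<close>.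
\<close>

lemma e2_integrable: "set_integrable lborel A e2"
  unfolding set_integrable_def
proof (rule integrableI_bounded)
  let ?P = "\<lambda>p. ennreal (P (fst p) (snd p) * b \<bar>snd p\<bar>)"
  let ?P' = "\<lambda>p. ennreal (P (fst p + snd p) (- snd p) * b \<bar>snd p\<bar>)"
  have "(\<integral>\<^sup>+p. ennreal (norm (indicator A p *\<^sub>R e2 p)) \<partial>lborel)
      \<le> (\<integral>\<^sup>+p. ennreal C * (?P p * indicator A p + ?P' p * indicator A p) \<partial>lborel)"
  proof (rule nn_integral_mono)
    fix p :: "real \<times> real"
    obtain s h where p: "p = (s, h)" by fastforce
    show "ennreal (norm (indicator A p *\<^sub>R e2 p)) \<le> ennreal C * (?P p * indicator A p + ?P' p * indicator A p)"
    proof (cases "p \<in> A")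
      case True
      then have h: "\<bar>h\<bar> \<le> L / 2" by (auto simp: p)
      have "norm (e2 p) \<le> C * (P s h * b \<bar>h\<bar> + P (s + h) (- h) * b \<bar>h\<bar>)"
      proof (cases "h = 0")
        case True
        then show ?thesis by (simp add: e2_def p b_nonpos)
      next
        case False
        then have r0: "0 < r s h" using r_pos h by blast
        have "0 \<le> F (r s h) / r s h" using F_nonneg r0 by simp
        moreover have "F (r s h) / r s h \<le> b (r s h)" using r_le[of s h] r0 h by (intro tail_le) auto
        moreover have "b (r s h) \<le> C * b \<bar>h\<bar>" using h False by (intro comparison) auto
        ultimately have "\<bar>b (r s h) + F (r s h) / r s h\<bar> \<le> 2 * (C * b \<bar>h\<bar>)"
          using b_nonneg[of "r s h"] by linarith
        then have "\<bar>b (r s h) + F (r s h) / r s h\<bar> * \<bar>W s h\<bar> \<le> (2 * (C * b \<bar>h\<bar>)) * ((P s h + P (s + h) (- h)) / 2)"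
          by (intro mult_mono W_bound[OF r0]) (auto simp: C_nonneg b_nonneg)
        moreover have "norm (e2 p) = \<bar>b (r s h) + F (r s h) / r s h\<bar> * \<bar>W s h\<bar>"
          by (simp add: e2_def p abs_mult)
        ultimately show ?thesis by (simp add: distrib_left mult_ac)
      qed
      then have "ennreal (norm (e2 p)) \<le> ennreal (C * (P s h * b \<bar>h\<bar> + P (s + h) (- h) * b \<bar>h\<bar>))"
        by (rule ennreal_leI)
      also have "\<dots> = ennreal C * (?P p + ?P' p)"
      proof -
        have gen: "ennreal (C * (x + y)) = ennreal C * (ennreal x + ennreal y)" if "0 \<le> x" "0 \<le> y" for x y
          using that C_nonneg by (simp add: ennreal_mult)
        show ?thesis unfolding p fst_conv snd_conv by (rule gen) (intro mult_nonneg_nonneg P_nonneg b_nonneg)+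
      qed
      finally show ?thesis using True by simp
    qed simp
  qed
  also have "\<dots> = ennreal C * ((\<integral>\<^sup>+p\<in>A. ?P p \<partial>lborel) + (\<integral>\<^sup>+p\<in>A. ?P' p \<partial>lborel))"
  proof -
    have m: "(\<lambda>p. ?P p * indicator A p) \<in> borel_measurable lborel" by measurable
    have m': "(\<lambda>p. ?P' p * indicator A p) \<in> borel_measurable lborel" by measurable
    show ?thesis
      unfolding nn_integral_add[OF m m', symmetric] by (intro nn_integral_cmult borel_measurable_add m m')
  qed
  also have "\<dots> < \<infinity>"
  proof -
    have gen: "ennreal C * (x + x) < \<infinity>" if "x < \<infinity>" for x
      using that by (simp add: ennreal_mult_less_top)
    show ?thesis unfolding P_swap_integral by (rule gen[OF le_less_trans[OF P_integral_le seminorm]])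
  qed
  finally show "(\<integral>\<^sup>+p. ennreal (norm (indicator A p *\<^sub>R e2 p)) \<partial>lborel) < \<infinity>" .
  show "(\<lambda>p. indicator A p *\<^sub>R e2 p) \<in> borel_measurable lborel" by measurable
qed

end

section \<open>Boundary terms near the diagonal\<close>

context energy_setting
begin

definition e where "e p = b (r (fst p) (snd p)) - b \<bar>snd p\<bar>"

lemma e_borel [measurable]: "e \<in> borel_measurable borel"
  unfolding e_def[abs_def] by measurable

text \<open>
  The point of the decomposition: the terms in \<open>b(r)\<close> cancel, and the rest is a kernel of the arc distance
  plus a mixed derivative.
\<close>

lemma density_sum: "e1 p + e2 p - e p = b \<bar>snd p\<bar> + K (fst p) (snd p)"
proof -
  have "e1 p = b (r (fst p) (snd p)) * (1 - T (fst p) \<bullet> T (fst p + snd p))"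
    by (simp add: e1_def q_eq field_simps)
  then show ?thesis by (simp add: e2_def e_def K_def W_def algebra_simps)
qed

definition D where "D \<epsilon> = {- (L / 2)..- \<epsilon>} \<union> {\<epsilon>..L / 2}"

text \<open>
  Since \<open>f (s + L/2) = f (s - L/2)\<close>, the boundary terms of \<open>J s\<close> at \<open>h = \<plusminus> L/2\<close> cancel; those at \<open>\<plusminus> \<epsilon>\<close> remain.
\<close>

lemma slice_integral:
  assumes \<epsilon>: "0 < \<epsilon>" "\<epsilon> \<le> L / 2"
  shows "((\<lambda>h. b \<bar>h\<bar> + K s h) has_integral (2 * (F \<epsilon> - F (L / 2)) + (J s (- \<epsilon>) - J s \<epsilon>))) (D \<epsilon>)"
proof -
  have m: "0 < c * \<epsilon>" using c_pos \<epsilon> by simp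
  have rm: "c * \<epsilon> \<le> r s h" if "\<epsilon> \<le> \<bar>h\<bar>" "\<bar>h\<bar> \<le> L / 2" for h
    using bilip[OF that(2), of s] mult_left_mono[OF that(1), of c] c_pos by linarith
  have Jper: "J s (- (L / 2)) = J s (L / 2)"
  proof -
    have "f (s + L / 2) = f (s - L / 2)" using f_per[of "s - L / 2"] by (simp add: algebra_simps)
    then show ?thesis by (simp add: J_def r_def)
  qed
  have Kp: "(K s has_integral (J s (L / 2) - J s \<epsilon>)) {\<epsilon>..L / 2}"
    by (rule J_fundamental_theorem[OF \<epsilon>(2) m]) (use \<epsilon> in \<open>auto intro!: rm\<close>)
  have Kn: "(K s has_integral (J s (- \<epsilon>) - J s (- (L / 2)))) {- (L / 2)..- \<epsilon>}"
    by (rule J_fundamental_theorem[OF _ m]) (use \<epsilon> in \<open>auto intro!: rm\<close>)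
  have bp0: "(b has_integral (F \<epsilon> - F (L / 2))) {\<epsilon>..L / 2}"
    using F_diff[OF \<epsilon>] b_integrable_on[OF \<epsilon>(1)] by (simp add: has_integral_integrable_integral)
  have bp: "((\<lambda>h. b \<bar>h\<bar>) has_integral (F \<epsilon> - F (L / 2))) {\<epsilon>..L / 2}"
    by (rule has_integral_eq[OF _ bp0]) (use \<epsilon> in auto)
  have bn0: "((\<lambda>h. b (- h)) has_integral (F \<epsilon> - F (L / 2))) {- (L / 2)..- \<epsilon>}"
    using bp0 Henstock_Kurzweil_Integration.has_integral_reflect_real[of b _ "L / 2" \<epsilon>] by simp
  have bn: "((\<lambda>h. b \<bar>h\<bar>) has_integral (F \<epsilon> - F (L / 2))) {- (L / 2)..- \<epsilon>}"
    by (rule has_integral_eq[OF _ bn0]) (use \<epsilon> in auto)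
  have "((\<lambda>h. b \<bar>h\<bar> + K s h) has_integral
     ((F \<epsilon> - F (L / 2) + (J s (- \<epsilon>) - J s (- (L / 2)))) + (F \<epsilon> - F (L / 2) + (J s (L / 2) - J s \<epsilon>)))) (D \<epsilon>)"
    unfolding D_def
  proof (rule has_integral_Un)
    have "{- (L / 2)..- \<epsilon>} \<inter> {\<epsilon>..L / 2} = {}" using \<epsilon> by auto
    then show "negligible ({- (L / 2)..- \<epsilon>} \<inter> {\<epsilon>..L / 2})" by simp
  qed (intro has_integral_add bn Kn bp Kp)+
  then show ?thesis by (simp add: Jper algebra_simps)
qed

lemma r_borel1 [measurable]: "(\<lambda>s. r s h) \<in> borel_measurable borel"
  unfolding r_def by measurable

lemma J_borel1 [measurable]: "(\<lambda>s. J s h) \<in> borel_measurable borel"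
  unfolding J_def by measurable

lemma J_bound:
  assumes "0 < \<epsilon>" "\<epsilon> \<le> \<bar>h\<bar>" "\<bar>h\<bar> \<le> L / 2"
  shows "\<bar>J s h\<bar> \<le> F (c * \<epsilon>)"
proof -
  have "c * \<epsilon> \<le> r s h"
    using bilip[OF assms(3), of s] mult_left_mono[OF assms(2), of c] c_pos by linarith
  then have "F (r s h) \<le> F (c * \<epsilon>)" using c_pos assms by (intro F_antimono) auto
  then have "F (r s h) * \<bar>sgn (f s - f (s + h)) \<bullet> T s\<bar> \<le> F (c * \<epsilon>) * 1"
    by (intro mult_mono) (auto simp: F_nonneg inner_commute[of _ "T s"] inner_unit_sgn_le)
  then show ?thesis by (simp add: J_def abs_mult F_nonneg)
qed

lemma truncated_integral:
  assumes \<epsilon>: "0 < \<epsilon>" "\<epsilon> \<le> L / 2" and G: "set_integrable lborel A (\<lambda>p. e1 p + e2 p - e p)"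
  shows "(LINT p:({0..L} \<times> D \<epsilon>)|lborel. e1 p + e2 p - e p) =
    2 * L * (F \<epsilon> - F (L / 2)) + (LINT s:{0..L}|lborel. J s (- \<epsilon>) - J s \<epsilon>)"
proof -
  let ?V = "\<lambda>s. 2 * (F \<epsilon> - F (L / 2)) + (J s (- \<epsilon>) - J s \<epsilon>)"
  define g where "g p = indicator ({0..L} \<times> D \<epsilon>) p *\<^sub>R (e1 p + e2 p - e p)" for p
  have Dm [measurable]: "D \<epsilon> \<in> sets borel" unfolding D_def by auto
  have "closed (D \<epsilon>)" unfolding D_def by auto
  then have BD: "{0..L} \<times> D \<epsilon> \<in> sets borel" by (intro borel_closed closed_Times) auto
  have "set_integrable lborel ({0..L} \<times> D \<epsilon>) (\<lambda>p. e1 p + e2 p - e p)"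
    by (rule set_integrable_subset[OF G]) (use BD \<epsilon> in \<open>auto simp: D_def\<close>)
  then have gi: "integrable lborel g" unfolding g_def set_integrable_def .
  then have gi2: "integrable (lborel \<Otimes>\<^sub>M lborel) g" by (simp add: lborel_prod)
  have slice: "(\<integral>h. g (s, h) \<partial>lborel) = indicator {0..L} s *\<^sub>R ?V s"
    if si: "integrable lborel (\<lambda>h. g (s, h))" for s
  proof (cases "s \<in> {0..L}")
    case True
    have eq: "g (s, h) = indicator (D \<epsilon>) h *\<^sub>R (b \<bar>h\<bar> + K s h)" for h
      using True by (simp add: g_def density_sum indicator_def)
    have "set_integrable lborel (D \<epsilon>) (\<lambda>h. b \<bar>h\<bar> + K s h)"
      using si by (simp add: set_integrable_def eq)
    from set_borel_integral_eq_integral(2)[OF this]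
    have "(\<integral>h. g (s, h) \<partial>lborel) = integral (D \<epsilon>) (\<lambda>h. b \<bar>h\<bar> + K s h)"
      by (simp add: eq set_lebesgue_integral_def)
    also have "\<dots> = ?V s"
      by (rule integral_unique[OF slice_integral[OF \<epsilon>]])
    finally show ?thesis using True by simp
  next
    case False
    then have "g (s, h) = 0" for h by (auto simp: g_def indicator_def)
    then show ?thesis using False by simp
  qed
  have "(LINT p:({0..L} \<times> D \<epsilon>)|lborel. e1 p + e2 p - e p) = integral\<^sup>L (lborel \<Otimes>\<^sub>M lborel) g"
    by (simp add: set_lebesgue_integral_def g_def[abs_def] lborel_prod)
  also have "\<dots> = (\<integral>s. (\<integral>h. g (s, h) \<partial>lborel) \<partial>lborel)"
    by (rule lborel_pair.integral_fst'[symmetric, OF gi2])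
  also have "\<dots> = (\<integral>s. indicator {0..L} s *\<^sub>R ?V s \<partial>lborel)"
  proof (rule integral_cong_AE)
    show "(\<lambda>s. \<integral>h. g (s, h) \<partial>lborel) \<in> borel_measurable lborel"
      using borel_measurable_integrable[OF lborel_pair.integrable_fst'[OF gi2]] by simp
    show "AE s in lborel. (\<integral>h. g (s, h) \<partial>lborel) =
        indicator {0..L} s *\<^sub>R ?V s"
      using lborel_pair.AE_integrable_fst'[OF gi2] by eventually_elim (rule slice)
  qed measurable
  also have "\<dots> = (LINT s:{0..L}|lborel. ?V s)"
    by (simp add: set_lebesgue_integral_def)
  also have "\<dots> = (LINT s:{0..L}|lborel. 2 * (F \<epsilon> - F (L / 2))) + (LINT s:{0..L}|lborel. J s (- \<epsilon>) - J s \<epsilon>)"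
  proof (rule set_integral_add(2))
    show "set_integrable lborel {0..L} (\<lambda>s. 2 * (F \<epsilon> - F (L / 2)))"
      by (rule set_integrable_bounded_Icc[where M="\<bar>2 * (F \<epsilon> - F (L / 2))\<bar>"]) auto
    show "set_integrable lborel {0..L} (\<lambda>s. J s (- \<epsilon>) - J s \<epsilon>)"
    proof (rule set_integrable_bounded_Icc[where M="2 * F (c * \<epsilon>)"])
      show "\<bar>J s (- \<epsilon>) - J s \<epsilon>\<bar> \<le> 2 * F (c * \<epsilon>)" for s
        using J_bound[of \<epsilon> \<epsilon> s] J_bound[of \<epsilon> "- \<epsilon>" s] \<epsilon> by simp
    qed measurable
  qed
  also have "(LINT s:{0..L}|lborel. 2 * (F \<epsilon> - F (L / 2))) = 2 * L * (F \<epsilon> - F (L / 2))"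
    using L_pos by (simp add: set_integral_const)
  finally show ?thesis .
qed

text \<open>
  This is \<open>- \<Lambda>(|f(s) - f(s + \<epsilon>)|)\<close>.
\<close>

definition neg_Lam where "neg_Lam \<epsilon> s = F (r s \<epsilon>) / r s \<epsilon>"

lemma neg_Lam_borel [measurable]: "neg_Lam \<epsilon> \<in> borel_measurable borel"
  unfolding neg_Lam_def[abs_def] by measurable

lemma r_lower: "0 < \<epsilon> \<Longrightarrow> \<epsilon> \<le> L / 2 \<Longrightarrow> c * \<epsilon> \<le> r s \<epsilon>"
  using bilip[of \<epsilon> s] by simp

lemma neg_Lam_bound:
  assumes \<epsilon>: "0 < \<epsilon>" "\<epsilon> \<le> L / 2"
  shows "\<bar>neg_Lam \<epsilon> s\<bar> \<le> F (c * \<epsilon>) / (c * \<epsilon>)"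
proof -
  have "0 < c * \<epsilon>" using c_pos \<epsilon> by simp
  then have "F (r s \<epsilon>) / r s \<epsilon> \<le> F (c * \<epsilon>) / (c * \<epsilon>)"
    using r_lower[OF \<epsilon>] by (intro frac_le F_antimono F_nonneg) auto
  then show ?thesis using F_nonneg by (simp add: neg_Lam_def r_def)
qed

text \<open>
  The integrand is, up to sign, the derivative of \<open>G(r s \<epsilon>)\<close> in \<open>s\<close>, a periodic function. Therefore the boundary
  terms on the two sides of the diagonal agree.
\<close>

lemma chord_derivative_integral_zero:
  assumes \<epsilon>: "0 < \<epsilon>" "\<epsilon> \<le> L / 2"
  shows "((\<lambda>s. neg_Lam \<epsilon> s * ((T (s + \<epsilon>) - T s) \<bullet> (f (s + \<epsilon>) - f s))) has_integral 0) {0..L}"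
proof -
  \<comment> \<open>Strictly below all chord lengths, so that the primitive \<open>H\<close> is differentiable at each of them.\<close>
  define m where "m = c * \<epsilon> / 2"
  have m: "0 < m" "m < c * \<epsilon>" using c_pos \<epsilon> by (auto simp: m_def)
  have rm: "m < r s \<epsilon>" for s using r_lower[OF \<epsilon>, of s] m by linarith
  define H where "H x = integral {m..x} F" for x
  have Fi: "F integrable_on {u..v}" if "m \<le> u" for u v
    by (intro integrable_continuous_interval continuous_on_subset[OF F_continuous_on[OF m(1)]]) (use that in auto)
  have Hd: "(H has_real_derivative F x) (at x)" if "m < x" for x
  proof -
    have "(H has_vector_derivative F x) (at x within {m..x + 1})"
      unfolding H_def
      by (rule integral_has_vector_derivative)
         (use that in \<open>auto intro!: continuous_on_subset[OF F_continuous_on[OF m(1)]]\<close>)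
    then show ?thesis
      using at_within_Icc_at[of m x "x + 1"] that by (simp add: has_real_derivative_iff_has_vector_derivative)
  qed
  have Hlip: "\<bar>H x - H y\<bar> \<le> F m * \<bar>x - y\<bar>" if "m \<le> x" "m \<le> y" for x y
  proof -
    have *: "\<bar>H v - H u\<bar> \<le> F m * (v - u)" if "m \<le> u" "u \<le> v" for u v
    proof -
      have "H v - H u = integral {u..v} F"
        using Henstock_Kurzweil_Integration.integral_combine[of m u v F] that Fi[of m v] by (simp add: H_def)
      moreover have "0 \<le> integral {u..v} F" by (intro integral_nonneg Fi that) (simp add: F_nonneg)
      moreover have "integral {u..v} F \<le> integral {u..v} (\<lambda>_. F m)"
        by (intro integral_le Fi that) (use that m(1) in \<open>auto intro!: F_antimono\<close>)
      ultimately show ?thesis using that by (simp add: mult.commute)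
    qed
    show ?thesis using *[of x y] *[of y x] that by (cases "x \<le> y") (auto simp: abs_minus_commute)
  qed
  define N' where "N' = N \<union> (\<lambda>x. x - \<epsilon>) ` N"
  have "negligible N'"
    unfolding N'_def using N_negligible negligible_translation[OF N_negligible, of "- \<epsilon>"] by simp
  have "((\<lambda>s. neg_Lam \<epsilon> s * ((T (s + \<epsilon>) - T s) \<bullet> (f (s + \<epsilon>) - f s))) has_integral (H (r L \<epsilon>) - H (r 0 \<epsilon>))) {0..L}"
  proof (rule Lipschitz_fundamental_theorem[OF _ _ \<open>negligible N'\<close>])
    show "0 \<le> L" using L_pos by simp
    show "norm (H (r x \<epsilon>) - H (r y \<epsilon>)) \<le> (F m * 2) * \<bar>x - y\<bar>" for x y
    proof -
      have "norm (H (r x \<epsilon>) - H (r y \<epsilon>)) \<le> F m * \<bar>r x \<epsilon> - r y \<epsilon>\<bar>"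
        using Hlip[OF less_imp_le[OF rm] less_imp_le[OF rm]] by simp
      also have "\<bar>r x \<epsilon> - r y \<epsilon>\<bar> \<le> norm ((f x - f (x + \<epsilon>)) - (f y - f (y + \<epsilon>)))"
        unfolding r_def by (rule norm_triangle_ineq3)
      also have "\<dots> \<le> norm (f x - f y) + norm (f (y + \<epsilon>) - f (x + \<epsilon>))"
        using norm_triangle_ineq[of "f x - f y" "f (y + \<epsilon>) - f (x + \<epsilon>)"] by (simp add: algebra_simps)
      also have "\<dots> \<le> 2 * \<bar>x - y\<bar>"
        using f_lip[of x y] f_lip[of "y + \<epsilon>" "x + \<epsilon>"] by (simp add: abs_minus_commute)
      finally show ?thesis using F_nonneg by (simp add: mult_left_mono mult.assoc)
    qed
    fix s assume "s \<in> {0<..<L} - N'"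
    then have s: "s \<notin> N" "s + \<epsilon> \<notin> N" by (auto simp: N'_def image_iff)
    have "((\<lambda>s. s + \<epsilon>) has_vector_derivative 1) (at s)" by (auto intro!: derivative_eq_intros)
    from vector_diff_chain_at[OF this f_deriv[OF s(2)]]
    have "((\<lambda>s. f (s + \<epsilon>)) has_vector_derivative T (s + \<epsilon>)) (at s)" by (simp add: o_def)
    then have "((\<lambda>s. f s - f (s + \<epsilon>)) has_vector_derivative (T s - T (s + \<epsilon>))) (at s)"
      by (intro has_vector_derivative_diff f_deriv s)
    then have "((\<lambda>s. norm (f s - f (s + \<epsilon>))) has_real_derivative sgn (f s - f (s + \<epsilon>)) \<bullet> (T s - T (s + \<epsilon>))) (at s)"
      by (rule norm_has_real_derivative) (use rm[of s] m in \<open>auto simp: r_def\<close>)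
    then have rd: "((\<lambda>s. r s \<epsilon>) has_real_derivative sgn (f s - f (s + \<epsilon>)) \<bullet> (T s - T (s + \<epsilon>))) (at s)"
      by (simp add: r_def)
    have "((\<lambda>s. H (r s \<epsilon>)) has_real_derivative F (r s \<epsilon>) * (sgn (f s - f (s + \<epsilon>)) \<bullet> (T s - T (s + \<epsilon>)))) (at s)"
      by (rule DERIV_chain2[OF Hd[OF rm] rd])
    moreover have "F (r s \<epsilon>) * (sgn (f s - f (s + \<epsilon>)) \<bullet> (T s - T (s + \<epsilon>)))
        = neg_Lam \<epsilon> s * ((T (s + \<epsilon>) - T s) \<bullet> (f (s + \<epsilon>) - f s))"
    proof -
      have "(f s - f (s + \<epsilon>)) \<bullet> (T s - T (s + \<epsilon>)) = (T (s + \<epsilon>) - T s) \<bullet> (f (s + \<epsilon>) - f s)"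
        by (simp add: inner_diff inner_commute)
      then show ?thesis by (simp add: neg_Lam_def sgn_div_norm r_def divide_inverse mult.assoc)
    qed
    ultimately show "((\<lambda>s. H (r s \<epsilon>)) has_vector_derivative
        neg_Lam \<epsilon> s * ((T (s + \<epsilon>) - T s) \<bullet> (f (s + \<epsilon>) - f s))) (at s)"
      by (simp add: has_real_derivative_iff_has_vector_derivative)
  qed
  moreover have "r L \<epsilon> = r 0 \<epsilon>"
    using f_per[of 0] f_per[of \<epsilon>] by (simp add: r_def add.commute)
  ultimately show ?thesis by simp
qed

text \<open>
  Translating the term at \<open>- \<epsilon>\<close> by \<open>\<epsilon>\<close> turns the difference into \<open>- \<integral> neg_Lam \<epsilon> s (T s + T (s + \<epsilon>)) \<bullet> (f (s + \<epsilon>) - f s) ds\<close>,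
  where \<open>T s\<close> and \<open>T (s + \<epsilon>)\<close> contribute equally. The right-hand side is arranged so that its first two
  terms tend to zero with \<open>\<epsilon>\<close>.
\<close>

lemma boundary_flux:
  assumes \<epsilon>: "0 < \<epsilon>" "\<epsilon> \<le> L / 2"
  shows "(LINT s:{0..L}|lborel. J s (- \<epsilon>) - J s \<epsilon>) =
     2 * (\<epsilon> * (LINT s:{0..L}|lborel. - neg_Lam \<epsilon> s + F \<epsilon> / \<epsilon>))
     - (LINT s:{0..L}|lborel. - neg_Lam \<epsilon> s * (2 * \<epsilon> - 2 * (T s \<bullet> (f (s + \<epsilon>) - f s)))) - 2 * L * F \<epsilon>"
proof -
  define v where "v s = T s \<bullet> (f (s + \<epsilon>) - f s)" for s
  define w where "w s = T (s + \<epsilon>) \<bullet> (f (s + \<epsilon>) - f s)" for s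
  have [measurable]: "v \<in> borel_measurable borel" "w \<in> borel_measurable borel"
    unfolding v_def[abs_def] w_def[abs_def] by measurable
  have chord: "norm (f (s + \<epsilon>) - f s) \<le> \<epsilon>" for s using f_lip[of "s + \<epsilon>" s] \<epsilon> by simp
  have Tx: "\<bar>T t \<bullet> x\<bar> \<le> norm x" for t x
    using Cauchy_Schwarz_ineq2[of "T t" x] T_unit by simp
  have vb: "\<bar>v s\<bar> \<le> \<epsilon>" for s using Tx chord order_trans unfolding v_def by blast
  have wb: "\<bar>w s\<bar> \<le> \<epsilon>" for s using Tx chord order_trans unfolding w_def by blast
  define M where "M = F (c * \<epsilon>) / (c * \<epsilon>)"
  have gb: "\<bar>neg_Lam \<epsilon> s\<bar> \<le> M" for s unfolding M_def by (rule neg_Lam_bound[OF \<epsilon>])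
  have M0: "0 \<le> M" using gb[of 0] by linarith
  have gi: "set_integrable lborel {0..L} (neg_Lam \<epsilon>)"
    by (rule set_integrable_bounded_Icc[OF _ gb]) measurable
  have gvi: "set_integrable lborel {0..L} (\<lambda>s. neg_Lam \<epsilon> s * v s)"
  proof (rule set_integrable_bounded_Icc[where M="M * \<epsilon>"])
    show "\<bar>neg_Lam \<epsilon> s * v s\<bar> \<le> M * \<epsilon>" for s
      unfolding abs_mult by (intro mult_mono gb vb M0) auto
  qed measurable
  have gwi: "set_integrable lborel {0..L} (\<lambda>s. neg_Lam \<epsilon> s * w s)"
  proof (rule set_integrable_bounded_Icc[where M="M * \<epsilon>"])
    show "\<bar>neg_Lam \<epsilon> s * w s\<bar> \<le> M * \<epsilon>" for s
      unfolding abs_mult by (intro mult_mono gb wb M0) auto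
  qed measurable
  have sg: "F (r s \<epsilon>) * (sgn (f (s + \<epsilon>) - f s) \<bullet> x) = neg_Lam \<epsilon> s * (x \<bullet> (f (s + \<epsilon>) - f s))" for s x
    by (simp add: neg_Lam_def r_def sgn_div_norm divide_inverse norm_minus_commute inner_commute)
  have J1: "- J s \<epsilon> = - (neg_Lam \<epsilon> s * v s)" for s
  proof -
    have "sgn (f s - f (s + \<epsilon>)) = - sgn (f (s + \<epsilon>) - f s)" by (metis minus_diff_eq sgn_minus)
    then have "- J s \<epsilon> = - (F (r s \<epsilon>) * (sgn (f (s + \<epsilon>) - f s) \<bullet> T s))" by (simp add: J_def)
    then show ?thesis by (simp add: sg v_def)
  qed
  have J2: "J (s + \<epsilon>) (- \<epsilon>) = - (neg_Lam \<epsilon> s * w s)" for s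
  proof -
    have "s + \<epsilon> + - \<epsilon> = s" by simp
    then have "J (s + \<epsilon>) (- \<epsilon>) = - (F (r s \<epsilon>) * (sgn (f (s + \<epsilon>) - f s) \<bullet> T (s + \<epsilon>)))"
      unfolding J_def r_def by (simp add: norm_minus_commute)
    then show ?thesis by (simp add: sg w_def)
  qed
  have Jper: "J (s + L) h = J s h" for s h
  proof -
    have "f (s + L + h) = f (s + h)" using f_per[of "s + h"] by (simp add: ac_simps)
    then show ?thesis by (simp only: J_def r_def f_per T_per)
  qed
  have Ji: "set_integrable lborel {0..L} (\<lambda>s. J s h)" if "\<bar>h\<bar> = \<epsilon>" for h
    by (rule set_integrable_bounded_Icc[where M="F (c * \<epsilon>)"]) (use that \<epsilon> in \<open>auto intro!: J_bound\<close>)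
  have "(LINT s:{0..L}|lborel. J s (- \<epsilon>) - J s \<epsilon>) = (LINT s:{0..L}|lborel. J s (- \<epsilon>)) - (LINT s:{0..L}|lborel. J s \<epsilon>)"
    using \<epsilon> by (intro set_integral_diff Ji) auto
  also have "(LINT s:{0..L}|lborel. J s (- \<epsilon>)) = (LINT s:{0..L}|lborel. J (s + \<epsilon>) (- \<epsilon>))"
    by (rule integral_periodic_shift[OF L_pos, symmetric]) (auto simp: Jper)
  also have "\<dots> = - (LINT s:{0..L}|lborel. neg_Lam \<epsilon> s * w s)"
    unfolding J2 by (rule set_integral_uminus[OF gwi])
  also have "(LINT s:{0..L}|lborel. J s \<epsilon>) = (LINT s:{0..L}|lborel. neg_Lam \<epsilon> s * v s)"
    using J1 by simp
  also have "(LINT s:{0..L}|lborel. neg_Lam \<epsilon> s * w s) = (LINT s:{0..L}|lborel. neg_Lam \<epsilon> s * v s)"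
  proof -
    have "(LINT s:{0..L}|lborel. neg_Lam \<epsilon> s * w s) - (LINT s:{0..L}|lborel. neg_Lam \<epsilon> s * v s)
        = (LINT s:{0..L}|lborel. neg_Lam \<epsilon> s * w s - neg_Lam \<epsilon> s * v s)"
      by (rule set_integral_diff(2)[symmetric, OF gwi gvi])
    also have "\<dots> = integral {0..L} (\<lambda>s. neg_Lam \<epsilon> s * w s - neg_Lam \<epsilon> s * v s)"
      by (rule set_borel_integral_eq_integral(2)[OF set_integral_diff(1)[OF gwi gvi]])
    also have "\<dots> = 0"
      using integral_unique[OF chord_derivative_integral_zero[OF \<epsilon>]]
      by (simp add: v_def w_def inner_diff_left right_diff_distrib)
    finally show ?thesis by simp
  qed
  finally have lhs: "(LINT s:{0..L}|lborel. J s (- \<epsilon>) - J s \<epsilon>) = - 2 * (LINT s:{0..L}|lborel. neg_Lam \<epsilon> s * v s)"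
    by simp
  have ci: "set_integrable lborel {0..L} (\<lambda>s. k)" for k :: real
    by (rule set_integrable_bounded_Icc[where M="\<bar>k\<bar>"]) auto
  have "(LINT s:{0..L}|lborel. - neg_Lam \<epsilon> s + F \<epsilon> / \<epsilon>) = (LINT s:{0..L}|lborel. F \<epsilon> / \<epsilon> - neg_Lam \<epsilon> s)"
    by (simp add: algebra_simps)
  also have "\<dots> = (LINT s:{0..L}|lborel. F \<epsilon> / \<epsilon>) - (LINT s:{0..L}|lborel. neg_Lam \<epsilon> s)"
    by (rule set_integral_diff(2)[OF ci gi])
  also have "(LINT s:{0..L}|lborel. F \<epsilon> / \<epsilon>) = L * (F \<epsilon> / \<epsilon>)"
    using L_pos by (simp add: set_integral_const)
  finally have X: "\<epsilon> * (LINT s:{0..L}|lborel. - neg_Lam \<epsilon> s + F \<epsilon> / \<epsilon>) = L * F \<epsilon> - \<epsilon> * (LINT s:{0..L}|lborel. neg_Lam \<epsilon> s)"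
    using \<epsilon> by (simp add: right_diff_distrib)
  have "(LINT s:{0..L}|lborel. - neg_Lam \<epsilon> s * (2 * \<epsilon> - 2 * v s)) =
      (LINT s:{0..L}|lborel. 2 * (neg_Lam \<epsilon> s * v s) - (2 * \<epsilon>) * neg_Lam \<epsilon> s)"
    by (simp add: algebra_simps)
  also have "\<dots> = (LINT s:{0..L}|lborel. 2 * (neg_Lam \<epsilon> s * v s)) - (LINT s:{0..L}|lborel. (2 * \<epsilon>) * neg_Lam \<epsilon> s)"
    by (intro set_integral_diff set_integrable_mult_right gvi gi)
  also have "\<dots> = 2 * (LINT s:{0..L}|lborel. neg_Lam \<epsilon> s * v s) - 2 * \<epsilon> * (LINT s:{0..L}|lborel. neg_Lam \<epsilon> s)"
    by (simp only: set_integral_mult_right)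
  finally show ?thesis using lhs X by (simp add: v_def)
qed

text \<open>
  The densities vanish at \<open>h = 0\<close>, so the truncated integrals exhaust the full one by dominated convergence.
\<close>

lemma energy_identity:
  assumes e_int: "set_integrable lborel A e"
    and lim1: "((\<lambda>\<epsilon>. \<epsilon> * (LINT s:{0..L}|lborel. - neg_Lam \<epsilon> s + F \<epsilon> / \<epsilon>)) \<longlongrightarrow> 0) (at_right 0)"
    and lim2: "((\<lambda>\<epsilon>. LINT s:{0..L}|lborel. - neg_Lam \<epsilon> s * (2 * \<epsilon> - 2 * (T s \<bullet> (f (s + \<epsilon>) - f s)))) \<longlongrightarrow> 0) (at_right 0)"
  shows "(LINT p:A|lborel. e p) = (LINT p:A|lborel. e1 p) + (LINT p:A|lborel. e2 p) + 2 * L * F (L / 2)"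
proof -
  let ?G = "\<lambda>p. e1 p + e2 p - e p"
  have Gi: "set_integrable lborel A ?G"
    by (intro set_integral_diff set_integral_add e1_integrable e2_integrable e_int)
  define \<epsilon> where "\<epsilon> n = L / 2 * inverse (real (Suc n))" for n
  have \<epsilon>_pos: "0 < \<epsilon> n" and \<epsilon>_le: "\<epsilon> n \<le> L / 2" for n
    using L_pos by (auto simp: \<epsilon>_def field_simps)
  have \<epsilon>_lim: "\<epsilon> \<longlonglongrightarrow> 0"
    unfolding \<epsilon>_def using tendsto_mult_right_zero[OF LIMSEQ_inverse_real_of_nat] .
  have \<epsilon>_at: "filterlim \<epsilon> (at_right 0) sequentially"
    unfolding filterlim_at using \<epsilon>_lim \<epsilon>_pos by (auto simp: less_imp_neq[symmetric])
  have Bm [measurable]: "{0..L} \<times> D (\<epsilon> n) \<in> sets borel" for n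
    by (intro borel_closed closed_Times) (auto simp: D_def)
  have "(\<lambda>n. LINT p:({0..L} \<times> D (\<epsilon> n))|lborel. ?G p) \<longlonglongrightarrow> (LINT p:A|lborel. ?G p)"
    unfolding set_lebesgue_integral_def
  proof (rule integral_dominated_convergence[where w="\<lambda>p. norm (indicator A p *\<^sub>R ?G p)"])
    show "integrable lborel (\<lambda>p. norm (indicator A p *\<^sub>R ?G p))"
      using Gi unfolding set_integrable_def by (rule integrable_norm)
    show "AE p in lborel. (\<lambda>n. indicator ({0..L} \<times> D (\<epsilon> n)) p *\<^sub>R ?G p)
        \<longlonglongrightarrow> indicator A p *\<^sub>R ?G p"
    proof (rule AE_I2, rule tendsto_eventually)
      fix p :: "real \<times> real"
      obtain s h where p: "p = (s, h)" by fastforce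
      show "\<forall>\<^sub>F n in sequentially. indicator ({0..L} \<times> D (\<epsilon> n)) p *\<^sub>R ?G p
          = indicator A p *\<^sub>R ?G p"
      proof (cases "h = 0")
        case True
        then have "?G p = 0" by (simp add: density_sum p K_def b_nonpos)
        then show ?thesis by simp
      next
        case False
        have "\<forall>\<^sub>F n in sequentially. \<epsilon> n < \<bar>h\<bar>"
          using \<epsilon>_lim False by (intro order_tendstoD(2)[of _ 0]) auto
        then show ?thesis
        proof eventually_elim
          case (elim n)
          have "p \<in> {0..L} \<times> D (\<epsilon> n) \<longleftrightarrow> p \<in> A"
            using elim \<epsilon>_pos[of n] by (auto simp: p D_def abs_if split: if_splits)
          then show ?case by (simp add: indicator_def)
        qed
      qed
    qed
    show "AE p in lborel. norm (indicator ({0..L} \<times> D (\<epsilon> n)) p *\<^sub>R ?G p)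
        \<le> norm (indicator A p *\<^sub>R ?G p)" for n
      using \<epsilon>_pos[of n] by (auto intro!: AE_I2 simp: indicator_def D_def)
  qed measurable
  moreover have "(\<lambda>n. LINT p:({0..L} \<times> D (\<epsilon> n))|lborel. ?G p) \<longlonglongrightarrow> 2 * 0 - 0 - 2 * L * F (L / 2)"
  proof -
    let ?X = "\<lambda>\<epsilon>. \<epsilon> * (LINT s:{0..L}|lborel. - neg_Lam \<epsilon> s + F \<epsilon> / \<epsilon>)"
    let ?Y = "\<lambda>\<epsilon>. LINT s:{0..L}|lborel. - neg_Lam \<epsilon> s * (2 * \<epsilon> - 2 * (T s \<bullet> (f (s + \<epsilon>) - f s)))"
    have "(LINT p:({0..L} \<times> D (\<epsilon> n))|lborel. ?G p) = 2 * ?X (\<epsilon> n) - ?Y (\<epsilon> n) - 2 * L * F (L / 2)" for n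
      unfolding truncated_integral[OF \<epsilon>_pos \<epsilon>_le Gi] boundary_flux[OF \<epsilon>_pos \<epsilon>_le]
      by (simp add: right_diff_distrib)
    moreover have "(\<lambda>n. 2 * ?X (\<epsilon> n) - ?Y (\<epsilon> n) - 2 * L * F (L / 2)) \<longlonglongrightarrow> 2 * 0 - 0 - 2 * L * F (L / 2)"
      by (intro tendsto_intros filterlim_compose[OF lim1 \<epsilon>_at] filterlim_compose[OF lim2 \<epsilon>_at])
    ultimately show ?thesis by simp
  qed
  ultimately have "(LINT p:A|lborel. ?G p) = - 2 * L * F (L / 2)"
    using LIMSEQ_unique by fastforce
  moreover have "(LINT p:A|lborel. ?G p) = (LINT p:A|lborel. e1 p) + (LINT p:A|lborel. e2 p) - (LINT p:A|lborel. e p)"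
    using e1_integrable e2_integrable e_int by (simp add: set_integral_diff set_integral_add)
  ultimately show ?thesis by simp
qed

end

section \<open>The decomposition of the energy\<close>

theorem theorem1p1:
  fixes L :: real and \<Phi> :: "real \<Rightarrow> real" and f :: "real \<Rightarrow> real ^ 'n"
  assumes L_pos: "0 < L"
    and Phi_pos: "\<And>x. 0 < x \<Longrightarrow> 0 < \<Phi> x"
    and cond1: "mono_on {0<..} \<Phi>"
    and cond2: "\<And>x. 0 < x \<Longrightarrow> (\<lambda>t. 1 / \<Phi> t) absolutely_integrable_on {x..}"
    and cond3: "\<And>g :: real \<Rightarrow> real ^ 'n. closed_curve L g \<Longrightarrow> finite_energy L \<Phi> g \<Longrightarrow>
        g \<in> W_Phi L \<Phi> \<inter> W1inf L \<and> bilipschitz_circle L g"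
    and cond4: "\<And>(g :: real \<Rightarrow> real ^ 'n) g'.
        bilipschitz_circle L g \<Longrightarrow> g \<in> W_Phi L \<Phi> \<inter> W1inf L \<Longrightarrow>
        has_weak_deriv L g g' \<Longrightarrow> (AE s in lebesgue. norm (g' s) = 1) \<Longrightarrow>
        ((\<lambda>\<epsilon>. \<epsilon> * (LINT s:{0..L}|lebesgue. Lam \<Phi> (norm (g s - g (s + \<epsilon>))) - Lam \<Phi> \<epsilon>))
           \<longlongrightarrow> 0) (at_right 0) \<and>
        ((\<lambda>\<epsilon>. LINT s:{0..L}|lebesgue. Lam \<Phi> (norm (g s - g (s + \<epsilon>))) *
              (LINT t:{s..s + \<epsilon>}|lebesgue. (norm (g' s - g' t))\<^sup>2))
           \<longlongrightarrow> 0) (at_right 0)"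
    and cond5a: "\<And>c. 0 < c \<Longrightarrow> c < 1 \<Longrightarrow>
        \<exists>C>0. \<forall>x\<in>{0<..L/2}. \<Phi> (c * x) \<ge> C * \<Phi> x"
    and cond5b: "(INF x\<in>{0<..L/2}. ereal (1 / \<Phi> x + Lam \<Phi> x)) \<ge> 0"
    and curve: "closed_curve L f"
    and finite: "finite_energy L \<Phi> f"
  shows "energy1_density \<Phi> f absolutely_integrable_on ({0..L} \<times> {0..L}) \<and>
         energy2_density \<Phi> f absolutely_integrable_on ({0..L} \<times> {0..L}) \<and>
         energy L \<Phi> f = energy1 L \<Phi> f + energy2 L \<Phi> f
           + 2 * L * (LINT x:{L/2..}|lebesgue. 1 / \<Phi> x)"
proof -
  let ?S = "{0..L} \<times> {0..L}"
  have S: "?S \<in> sets borel" by (auto intro!: borel_closed closed_Times)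
  have W: "f \<in> W_Phi L \<Phi>" "f \<in> W1inf L" and bil: "bilipschitz_circle L f"
    using cond3[OF curve finite] by auto
  have f_lip: "norm (f s - f t) \<le> \<bar>s - t\<bar>" for s t
    using closed_curve_Lipschitz[OF curve] by (simp add: dist_norm)
  have f_per: "f (s + L) = f s" for s
    using curve by (simp add: closed_curve_def periodic_fun_simple_def)
  obtain T N where T: "T \<in> borel_measurable borel" "\<And>s. T (s + L) = T s" "\<And>s. norm (T s) = 1"
    "negligible N" "\<And>s. s \<notin> N \<Longrightarrow> (f has_vector_derivative T s) (at s)"
    using ex_borel_unit_tangent[OF L_pos curve W(2)] by blast
  define b where "b x = (if 0 < x then 1 / \<Phi> x else 0)" for x
  have b_anti: "b y \<le> b x" if "0 < x" "x \<le> y" for x y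
    using that Phi_pos[of x] cond1 by (auto simp: b_def mono_on_def intro!: divide_left_mono mult_pos_pos Phi_pos)
  have b_borel: "b \<in> borel_measurable borel"
    by (rule borel_measurable_antimono_pos[OF b_anti]) (auto simp: b_def)
  have b_tail: "set_integrable lborel {x..} b"
    "(LINT t:{x..}|lebesgue. 1 / \<Phi> t) = (LINT t:{x..}|lborel. b t)" if x: "0 < x" for x
  proof -
    show i: "set_integrable lborel {x..} b"
      using cond2[OF x] lebesgue_integral_spike_borel(1)[OF b_borel _ negligible_empty, of "{x..}" "\<lambda>t. 1 / \<Phi> t"] x
      by (auto simp: b_def)
    show "(LINT t:{x..}|lebesgue. 1 / \<Phi> t) = (LINT t:{x..}|lborel. b t)"
      by (rule lebesgue_integral_spike_borel(2)[OF b_borel _ negligible_empty _ i]) (use x in \<open>auto simp: b_def\<close>)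
  qed
  interpret B: decreasing_kernel b
    by standard (use Phi_pos b_anti b_tail in \<open>auto simp: b_def\<close>)
  interpret U: unit_speed_loop L f T N
    by standard (use L_pos f_per f_lip T in auto)
  interpret UB: loop_with_kernel L f T N b ..
  note [measurable] = T(1) b_borel B.F_borel U.f_borel circle_dist_borel
  have Lam_eq: "Lam \<Phi> x = - (B.F x / x)" if "0 < x" for x
    using b_tail(2)[OF that] that by (simp add: Lam_def B.F_def)
  obtain c0 C0 where c0: "0 < c0" "\<And>s t. c0 * circle_dist L s t \<le> dist (f s) (f t)"
    "\<And>s t. dist (f s) (f t) \<le> C0 * circle_dist L s t"
    using bil unfolding bilipschitz_circle_def by blast
  define c where "c = min c0 (1 / 2)"
  have c: "0 < c" "c < 1" using c0(1) by (auto simp: c_def)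
  obtain C where C: "0 < C" "\<And>x. x \<in> {0<..L / 2} \<Longrightarrow> C * \<Phi> x \<le> \<Phi> (c * x)"
    using cond5a[OF c] by blast
  have bilip: "c * \<bar>h\<bar> \<le> UB.r s h" if h: "\<bar>h\<bar> \<le> L / 2" for s h
  proof -
    have "c * \<bar>h\<bar> \<le> c0 * \<bar>h\<bar>" by (intro mult_right_mono) (auto simp: c_def)
    then show ?thesis using c0(2)[of s "s + h"] circle_dist_shift[OF L_pos h, of s] by (simp add: UB.r_def dist_norm)
  qed
  have comparison: "b (UB.r s h) \<le> (1 / C) * b \<bar>h\<bar>" if h: "0 < \<bar>h\<bar>" "\<bar>h\<bar> \<le> L / 2" for s h
  proof -
    have ch: "0 < c * \<bar>h\<bar>" using c h by simp
    have "b (UB.r s h) \<le> b (c * \<bar>h\<bar>)" by (rule b_anti[OF ch bilip[OF h(2)]])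
    also have "\<dots> = 1 / \<Phi> (c * \<bar>h\<bar>)" using ch by (simp add: b_def)
    also have "\<dots> \<le> 1 / (C * \<Phi> \<bar>h\<bar>)"
      using C h ch Phi_pos by (intro divide_left_mono mult_pos_pos) auto
    also have "\<dots> = (1 / C) * b \<bar>h\<bar>" using h by (simp add: b_def)
    finally show ?thesis .
  qed
  have tail: "B.F x / x \<le> b x" if x: "0 < x" "x \<le> L / 2" for x
  proof -
    have "0 \<le> (INF x\<in>{0<..L/2}. ereal (1 / \<Phi> x + Lam \<Phi> x))" by (rule cond5b)
    also have "\<dots> \<le> ereal (1 / \<Phi> x + Lam \<Phi> x)" by (rule INF_lower) (use x in auto)
    finally show ?thesis using x Lam_eq[of x] by (simp add: b_def)
  qed
  \<comment> \<open>Off \<open>Z\<close> the two points are different points of the circle; \<open>L\<close> is excluded because it represents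
    the same point as \<open>0\<close>.\<close>
  define Z where "Z N' = ((N' \<union> {L}) \<times> UNIV) \<union> (UNIV \<times> (N' \<union> {L})) \<union> {p. fst p = snd p}" for N' :: "real set"
  have Z: "negligible (Z N')" if "negligible N'" for N'
    unfolding Z_def using that by (intro negligible_Un negligible_Times_real negligible_diagonal) auto
  have r_pos: "0 < norm (f s - f t)" if "(s, t) \<in> ?S - Z N'" for s t N'
  proof -
    have "s \<in> {0..<L}" "t \<in> {0..<L}" "s \<noteq> t" using that by (auto simp: Z_def)
    then show ?thesis using curve by (auto simp: closed_curve_def dest: inj_onD)
  qed
  have d_pos: "0 < circle_dist L s t" if "(s, t) \<in> ?S - Z N'" for s t N'
  proof -
    have "0 < C0 * circle_dist L s t" using r_pos[OF that] c0(3)[of s t] unfolding dist_norm by linarith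
    moreover have "0 \<le> circle_dist L s t" by (simp add: circle_dist_def infdist_nonneg)
    ultimately show ?thesis by (cases "circle_dist L s t = 0") auto
  qed
  \<comment> \<open>The weak derivative from the definition of \<open>W\<^sub>\<Phi>\<close> is almost everywhere the tangent.\<close>
  define gq where "gq p = (norm (T (fst p) - T (snd p)))\<^sup>2 * b (circle_dist L (fst p) (snd p))" for p
  have gq_borel: "gq \<in> borel_measurable borel" unfolding gq_def by measurable
  obtain v where v: "has_weak_deriv L f v"
    "(\<lambda>(s, t). (norm (v s - v t))\<^sup>2 / \<Phi> (circle_dist L s t)) absolutely_integrable_on ?S"
    using W(1) by (auto simp: W_Phi_def)
  obtain N2 where N2: "negligible N2" "\<And>x. x \<in> {0..L} - N2 \<Longrightarrow> v x = T x"
    using weak_deriv_unique[OF L_pos v(1) U.has_weak_deriv_tangent] by blast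
  have gq_int: "set_integrable lborel ?S gq"
  proof (rule lebesgue_integral_spike_borel(1)[OF gq_borel S Z[OF N2(1)], THEN iffD1, OF _ v(2)])
    fix p assume p: "p \<in> ?S - Z N2"
    obtain s t where st: "p = (s, t)" by fastforce
    have "v s = T s" "v t = T t" using p N2(2) by (auto simp: st Z_def)
    then show "(case p of (s, t) \<Rightarrow> (norm (v s - v t))\<^sup>2 / \<Phi> (circle_dist L s t)) = gq p"
      using d_pos[of s t N2] p by (simp add: st gq_def b_def)
  qed
  have q_int: "set_integrable lborel ({0..L} \<times> {- (L / 2)..L / 2}) (\<lambda>p. U.q (fst p) (snd p) * b \<bar>snd p\<bar>)"
    by (rule integral_rotate_square_cong(1)[OF L_pos gq_borel, THEN iffD1, OF _ _ gq_int])
       (auto simp: gq_def T circle_dist_periodic circle_dist_shift[OF L_pos] U.q_def)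
  have semi: "(\<integral>\<^sup>+p\<in>{0..L} \<times> {- (L / 2)..L / 2}. ennreal (U.q (fst p) (snd p) * b \<bar>snd p\<bar>) \<partial>lborel) < \<infinity>"
    (is "?I < \<infinity>")
  proof -
    have "?I = (\<integral>\<^sup>+p. ennreal (norm (indicator ({0..L} \<times> {- (L / 2)..L / 2}) p *\<^sub>R (U.q (fst p) (snd p) * b \<bar>snd p\<bar>))) \<partial>lborel)"
      by (rule nn_integral_cong) (auto simp: indicator_def B.b_nonneg U.q_nonneg)
    then show ?thesis using q_int unfolding set_integrable_def integrable_iff_bounded by simp
  qed
  interpret E: energy_setting L f T N b c "1 / C"
    by standard (use c bilip comparison tail semi in auto)
  \<comment> \<open>Borel functions that agree with the three densities off the null set \<open>Z N\<close>.\<close>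
  define ge where "ge p = b (norm (f (fst p) - f (snd p))) - b (circle_dist L (fst p) (snd p))" for p
  define g1 where "g1 p = b (norm (f (fst p) - f (snd p))) * (norm (T (fst p) - T (snd p)))\<^sup>2 / 2" for p
  define g2 where "g2 p = (b (norm (f (fst p) - f (snd p))) + B.F (norm (f (fst p) - f (snd p))) / norm (f (fst p) - f (snd p)))
     * (T (fst p) \<bullet> T (snd p) - (T (fst p) \<bullet> sgn (f (fst p) - f (snd p))) * (T (snd p) \<bullet> sgn (f (fst p) - f (snd p))))" for p
  have g_borel: "ge \<in> borel_measurable borel" "g1 \<in> borel_measurable borel" "g2 \<in> borel_measurable borel"
    unfolding ge_def g1_def g2_def by measurable
  have rot_e: "set_integrable lborel ?S ge \<longleftrightarrow> set_integrable lborel E.A E.e"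
    "(LINT p:?S|lborel. ge p) = (LINT p:E.A|lborel. E.e p)"
    by (rule integral_rotate_square_cong[OF L_pos g_borel(1)];
        simp add: ge_def E.e_def f_per circle_dist_periodic circle_dist_shift[OF L_pos] UB.r_def)+
  have rot_1: "set_integrable lborel ?S g1 \<longleftrightarrow> set_integrable lborel E.A E.e1"
    "(LINT p:?S|lborel. g1 p) = (LINT p:E.A|lborel. E.e1 p)"
    by (rule integral_rotate_square_cong[OF L_pos g_borel(2)];
        simp add: g1_def E.e1_def f_per T U.q_def UB.r_def)+
  have rot_2: "set_integrable lborel ?S g2 \<longleftrightarrow> set_integrable lborel E.A E.e2"
    "(LINT p:?S|lborel. g2 p) = (LINT p:E.A|lborel. E.e2 p)"
    by (rule integral_rotate_square_cong[OF L_pos g_borel(3)];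
        simp add: g2_def E.e2_def E.W_def f_per T UB.r_def)+
  have tangent: "tangent f s = T s" if "s \<notin> N" for s
    unfolding tangent_def by (rule vector_derivative_at[OF T(5)[OF that]])
  note spike = lebesgue_integral_spike_borel[OF _ S Z[OF T(4)]]
  have eq_e: "energy_density L \<Phi> f p = ge p" if p: "p \<in> ?S - Z N" for p
  proof -
    obtain s t where st: "p = (s, t)" by fastforce
    show ?thesis using r_pos[of s t N] d_pos[of s t N] p by (simp add: st energy_density_def ge_def b_def)
  qed
  have eq_1: "energy1_density \<Phi> f p = g1 p" if p: "p \<in> ?S - Z N" for p
  proof -
    obtain s t where st: "p = (s, t)" by fastforce
    have "tangent f s = T s" "tangent f t = T t" using p by (auto simp: st Z_def intro: tangent)
    then show ?thesis using r_pos[of s t N] p by (simp add: st energy1_density_def g1_def b_def)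
  qed
  have eq_2: "energy2_density \<Phi> f p = g2 p" if p: "p \<in> ?S - Z N" for p
  proof -
    obtain s t where st: "p = (s, t)" by fastforce
    have T': "tangent f s = T s" "tangent f t = T t" using p by (auto simp: st Z_def intro: tangent)
    have r: "0 < norm (f s - f t)" using r_pos[of s t N] p by (simp add: st)
    define R where "R = sgn (f s - f t)"
    have "R \<bullet> R = 1" using r by (simp add: R_def dot_square_norm norm_sgn)
    then have "wedge_inner (T s) R (T t) R = T s \<bullet> T t - (T s \<bullet> R) * (T t \<bullet> R)"
      by (simp add: wedge_inner_def inner_commute)
    then show ?thesis using r
      by (simp add: st energy2_density_def g2_def T' b_def Lam_eq sgn_div_norm[symmetric] R_def)
  qed
  have ev: "\<forall>\<^sub>F \<epsilon> in at_right 0. 0 < \<epsilon> \<and> \<epsilon> \<le> L / 2"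
    using L_pos by (auto simp: eventually_at_right_field intro!: exI[of _ "L / 2"])
  have AE1: "AE s in lebesgue. norm (T s) = 1" using T(3) by simp
  note lims = cond4[OF bil _ U.has_weak_deriv_tangent AE1]
  have Lam_r: "Lam \<Phi> (norm (f s - f (s + \<epsilon>))) = - E.neg_Lam \<epsilon> s" if "0 < \<epsilon>" "\<epsilon> \<le> L / 2" for s \<epsilon>
    using Lam_eq[of "UB.r s \<epsilon>"] E.r_pos[of \<epsilon> s] that by (simp add: E.neg_Lam_def UB.r_def)
  have lim1: "((\<lambda>\<epsilon>. \<epsilon> * (LINT s:{0..L}|lborel. - E.neg_Lam \<epsilon> s + B.F \<epsilon> / \<epsilon>)) \<longlongrightarrow> 0) (at_right 0)"
  proof (rule Lim_transform_eventually)
    show "((\<lambda>\<epsilon>. \<epsilon> * (LINT s:{0..L}|lebesgue. Lam \<Phi> (norm (f s - f (s + \<epsilon>))) - Lam \<Phi> \<epsilon>)) \<longlongrightarrow> 0) (at_right 0)"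
      using lims W by blast
    show "\<forall>\<^sub>F \<epsilon> in at_right 0. \<epsilon> * (LINT s:{0..L}|lebesgue. Lam \<Phi> (norm (f s - f (s + \<epsilon>))) - Lam \<Phi> \<epsilon>)
       = \<epsilon> * (LINT s:{0..L}|lborel. - E.neg_Lam \<epsilon> s + B.F \<epsilon> / \<epsilon>)"
      using ev
    proof eventually_elim
      case (elim \<epsilon>)
      then have "Lam \<Phi> (norm (f s - f (s + \<epsilon>))) - Lam \<Phi> \<epsilon> = - E.neg_Lam \<epsilon> s + B.F \<epsilon> / \<epsilon>" for s
        using Lam_r[of \<epsilon> s] Lam_eq[of \<epsilon>] by simp
      moreover have "(LINT s:{0..L}|lebesgue. - E.neg_Lam \<epsilon> s + B.F \<epsilon> / \<epsilon>) = (LINT s:{0..L}|lborel. - E.neg_Lam \<epsilon> s + B.F \<epsilon> / \<epsilon>)"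
        by (rule set_integral_lebesgue_eq_lborel(2)[OF _ atLeastAtMost_borel])
           (intro borel_measurable_add borel_measurable_uminus E.neg_Lam_borel borel_measurable_const)
      ultimately show ?case by simp
    qed
  qed
  let ?v = "\<lambda>\<epsilon> s. 2 * \<epsilon> - 2 * (T s \<bullet> (f (s + \<epsilon>) - f s))"
  have lim2: "((\<lambda>\<epsilon>. LINT s:{0..L}|lborel. - E.neg_Lam \<epsilon> s * ?v \<epsilon> s) \<longlongrightarrow> 0) (at_right 0)"
  proof (rule Lim_transform_eventually)
    show "((\<lambda>\<epsilon>. LINT s:{0..L}|lebesgue. Lam \<Phi> (norm (f s - f (s + \<epsilon>))) *
              (LINT t:{s..s + \<epsilon>}|lebesgue. (norm (T s - T t))\<^sup>2)) \<longlongrightarrow> 0) (at_right 0)"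
      using lims W by blast
    show "\<forall>\<^sub>F \<epsilon> in at_right 0. (LINT s:{0..L}|lebesgue. Lam \<Phi> (norm (f s - f (s + \<epsilon>))) *
              (LINT t:{s..s + \<epsilon>}|lebesgue. (norm (T s - T t))\<^sup>2))
       = (LINT s:{0..L}|lborel. - E.neg_Lam \<epsilon> s * ?v \<epsilon> s)"
      using ev
    proof eventually_elim
      case (elim \<epsilon>)
      have inner: "(LINT t:{s..s + \<epsilon>}|lebesgue. (norm (T s - T t))\<^sup>2) = ?v \<epsilon> s" for s
      proof -
        have qt: "(norm (T s - T t))\<^sup>2 = U.q s (t - s)" for t by (simp add: U.q_def)
        have hi: "((\<lambda>t. U.q s (t - s)) has_integral ?v \<epsilon> s) {s..s + \<epsilon>}"
        proof -
          have "(U.q s has_integral ?v \<epsilon> s) (cbox 0 \<epsilon>)"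
            using U.q_has_integral[of 1 \<epsilon> s] elim by simp
          from has_integral_affinity[OF this, of 1 "- s"] show ?thesis by (simp add: add.commute)
        qed
        have "(\<lambda>t. U.q s (t - s)) absolutely_integrable_on {s..s + \<epsilon>}"
          using has_integral_integrable[OF hi] by (intro nonnegative_absolutely_integrable_1) (auto simp: U.q_nonneg)
        from set_lebesgue_integral_eq_integral(2)[OF this] show ?thesis
          unfolding qt using integral_unique[OF hi] by simp
      qed
      have "(LINT s:{0..L}|lebesgue. - E.neg_Lam \<epsilon> s * ?v \<epsilon> s)
          = (LINT s:{0..L}|lborel. - E.neg_Lam \<epsilon> s * ?v \<epsilon> s)"
      proof (rule set_integral_lebesgue_eq_lborel(2)[OF _ atLeastAtMost_borel])
        have "(\<lambda>s. T s \<bullet> (f (s + \<epsilon>) - f s)) \<in> borel_measurable borel" by measurable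
        then show "(\<lambda>s. - E.neg_Lam \<epsilon> s * ?v \<epsilon> s) \<in> borel_measurable borel"
          by (intro borel_measurable_times borel_measurable_uminus borel_measurable_diff E.neg_Lam_borel borel_measurable_const)
      qed
      then show ?case using elim by (simp add: inner Lam_r)
    qed
  qed
  have ei: "set_integrable lborel ?S ge"
    using finite spike(1)[OF g_borel(1) eq_e] by (simp add: finite_energy_def)
  have i1: "set_integrable lborel ?S g1" using rot_1(1) E.e1_integrable by simp
  have i2: "set_integrable lborel ?S g2" using rot_2(1) E.e2_integrable by simp
  have id: "(LINT p:?S|lborel. ge p) = (LINT p:?S|lborel. g1 p) + (LINT p:?S|lborel. g2 p) + 2 * L * B.F (L / 2)"
    unfolding rot_e(2) rot_1(2) rot_2(2)
    by (rule E.energy_identity[OF _ lim1 lim2]) (use rot_e(1) ei in simp)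
  show ?thesis
  proof (intro conjI)
    show "energy1_density \<Phi> f absolutely_integrable_on ?S" using spike(1)[OF g_borel(2) eq_1] i1 by simp
    show "energy2_density \<Phi> f absolutely_integrable_on ?S" using spike(1)[OF g_borel(3) eq_2] i2 by simp
    have "(LINT x:{L/2..}|lebesgue. 1 / \<Phi> x) = B.F (L / 2)"
      using b_tail(2)[of "L / 2"] L_pos by (simp add: B.F_def)
    then show "energy L \<Phi> f = energy1 L \<Phi> f + energy2 L \<Phi> f + 2 * L * (LINT x:{L/2..}|lebesgue. 1 / \<Phi> x)"
      using id spike(2)[OF g_borel(1) eq_e ei] spike(2)[OF g_borel(2) eq_1 i1] spike(2)[OF g_borel(3) eq_2 i2]
      by (simp add: energy_def energy1_def energy2_def)
  qed
qed

end
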